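(* Let $G=(V,E,w)$ be an undirected graph with non-negative edge weights, $n$ vertices and $m$ edges, and let $k$ be an integer with $2\le k=O(\log n)$. There is a deterministic algorithm running in time $\tilde{O}(n^{2-1/k}m^{1/k})$ that returns distance estimates $\hat\delta(u,v)$ such that for every $u,v\in V$, \[ d_G(u,v)\le \hat\delta(u,v)\le d_G(u,v)+2(k-1)\cdot W(u,v).\]
   Context: $d_G$ is the shortest-path distance in $G$. For $u,v\in V$, $W(u,v)$ is the maximum weight of an edge on a shortest $u$–$v$ path $P_{uv}$ in $G$. *)

theory Defs
  imports Complex_Main "Graph_Theory.Graph_Theory"
begin

section \<open>Graphs\<close>

text \<open>
  A finite simple undirected graph is a \<open>pair_graph\<close>: a finite, loop-free, symmetric set of pairs.
  Each undirected edge is present as two opposite arcs, so \<open>m\<close> is the number of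
  unordered pairs and not \<open>card (parcs G)\<close>.
\<close>

definition uedges :: "'a pair_pre_digraph \<Rightarrow> 'a set set" where
  "uedges G = (\<lambda>(u, v). {u, v}) ` parcs G"

definition weighted_graph :: "'a pair_pre_digraph \<Rightarrow> ('a \<times> 'a \<Rightarrow> real) \<Rightarrow> bool" where
  "weighted_graph G w \<longleftrightarrow> pair_graph G \<and>
     (\<forall>(u, v) \<in> parcs G. 0 \<le> w (u, v) \<and> w (u, v) = w (v, u))"

text \<open>The distance is \<open>\<infinity>\<close> between vertices in different components.\<close>

definition gdist :: "'a pair_pre_digraph \<Rightarrow> ('a \<times> 'a \<Rightarrow> real) \<Rightarrow> 'a \<Rightarrow> 'a \<Rightarrow> ereal" where
  "gdist G w u v = wf_digraph.\<mu> (with_proj G) w u v"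

definition shortest_path ::
    "'a pair_pre_digraph \<Rightarrow> ('a \<times> 'a \<Rightarrow> real) \<Rightarrow> 'a \<Rightarrow> ('a \<times> 'a) list \<Rightarrow> 'a \<Rightarrow> bool" where
  "shortest_path G w u p v \<longleftrightarrow>
     pre_digraph.apath (with_proj G) u p v \<and> ereal (wf_digraph.awalk_cost w p) = gdist G w u v"

text \<open>
  \<open>W(u,v)\<close> for the choice \<open>p\<close> of the shortest path \<open>P\<^sub>u\<^sub>v\<close>. Weights being non-negative, inserting \<open>0\<close>
  only matters for the empty path, i.e. for \<open>u = v\<close>.
\<close>

definition max_weight :: "('a \<times> 'a \<Rightarrow> real) \<Rightarrow> ('a \<times> 'a) list \<Rightarrow> real" where
  "max_weight w p = Max (insert 0 (w ` set p))"


section \<open>Machine model\<close>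

text \<open>
  Deterministic algorithms are programs of a structured random access machine. Integer cells hold
  words below a bound \<open>B\<close> (a power of \<open>n\<close>, i.e. words of \<open>O(log n)\<close> bits); an operation whose result
  does not fit into a word gets stuck. As usual for shortest paths with real weights, there are
  separate cells for reals, which can only be copied, added and compared. A program
  uses finitely many named registers and arrays. Every constant, read, operation, test and
  assignment has unit cost. Array indices are words.
\<close>

type_synonym name = string

datatype iop = Plus | Minus | Times | Div | Mod

datatype iexp =
    Const nat
  | IReg name
  | IArr name iexp
  | IOp iop iexp iexp

datatype rexp =
    RZero
  | RReg name
  | RArr name iexp
  | RPlus rexp rexp

datatype bexp =
    ILess iexp iexp
  | IEq iexp iexp
  | RLess rexp rexp
  | Not bexp
  | And bexp bexp

datatype com =
    Skip
  | ISet name iexp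
  | RSet name rexp
  | IStore name iexp iexp   \<comment> \<open>array, index, value\<close>
  | RStore name iexp rexp
  | Seq com com
  | Cond bexp com com
  | While bexp com

record state =
  ireg :: "name \<Rightarrow> nat"
  rreg :: "name \<Rightarrow> real"
  iarr :: "name \<Rightarrow> nat \<Rightarrow> nat"
  rarr :: "name \<Rightarrow> nat \<Rightarrow> real"

text \<open>Subtraction is truncated at \<open>0\<close>; \<open>x div 0 = 0\<close> and \<open>x mod 0 = x\<close>.\<close>

fun iop_val :: "iop \<Rightarrow> nat \<Rightarrow> nat \<Rightarrow> nat" where
  "iop_val Plus x y = x + y"
| "iop_val Minus x y = x - y"
| "iop_val Times x y = x * y"
| "iop_val Div x y = x div y"
| "iop_val Mod x y = x mod y"

fun ival :: "state \<Rightarrow> iexp \<Rightarrow> nat" where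
  "ival s (Const c) = c"
| "ival s (IReg x) = ireg s x"
| "ival s (IArr a e) = iarr s a (ival s e)"
| "ival s (IOp f e1 e2) = iop_val f (ival s e1) (ival s e2)"

fun rval :: "state \<Rightarrow> rexp \<Rightarrow> real" where
  "rval s RZero = 0"
| "rval s (RReg x) = rreg s x"
| "rval s (RArr a e) = rarr s a (ival s e)"
| "rval s (RPlus e1 e2) = rval s e1 + rval s e2"

fun bval :: "state \<Rightarrow> bexp \<Rightarrow> bool" where
  "bval s (ILess e1 e2) \<longleftrightarrow> ival s e1 < ival s e2"
| "bval s (IEq e1 e2) \<longleftrightarrow> ival s e1 = ival s e2"
| "bval s (RLess e1 e2) \<longleftrightarrow> rval s e1 < rval s e2"
| "bval s (Not b) \<longleftrightarrow> \<not> bval s b"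
| "bval s (And b1 b2) \<longleftrightarrow> bval s b1 \<and> bval s b2"

text \<open>No value occurring during the evaluation exceeds the word size.\<close>

fun ifits :: "nat \<Rightarrow> state \<Rightarrow> iexp \<Rightarrow> bool" where
  "ifits B s (Const c) \<longleftrightarrow> c < B"
| "ifits B s (IReg x) \<longleftrightarrow> ireg s x < B"
| "ifits B s (IArr a e) \<longleftrightarrow> ifits B s e \<and> iarr s a (ival s e) < B"
| "ifits B s (IOp f e1 e2) \<longleftrightarrow> ifits B s e1 \<and> ifits B s e2 \<and> ival s (IOp f e1 e2) < B"

fun rfits :: "nat \<Rightarrow> state \<Rightarrow> rexp \<Rightarrow> bool" where
  "rfits B s RZero \<longleftrightarrow> True"
| "rfits B s (RReg x) \<longleftrightarrow> True"
| "rfits B s (RArr a e) \<longleftrightarrow> ifits B s e"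
| "rfits B s (RPlus e1 e2) \<longleftrightarrow> rfits B s e1 \<and> rfits B s e2"

fun bfits :: "nat \<Rightarrow> state \<Rightarrow> bexp \<Rightarrow> bool" where
  "bfits B s (ILess e1 e2) \<longleftrightarrow> ifits B s e1 \<and> ifits B s e2"
| "bfits B s (IEq e1 e2) \<longleftrightarrow> ifits B s e1 \<and> ifits B s e2"
| "bfits B s (RLess e1 e2) \<longleftrightarrow> rfits B s e1 \<and> rfits B s e2"
| "bfits B s (Not b) \<longleftrightarrow> bfits B s b"
| "bfits B s (And b1 b2) \<longleftrightarrow> bfits B s b1 \<and> bfits B s b2"

fun icost :: "iexp \<Rightarrow> nat" where
  "icost (Const c) = 1"
| "icost (IReg x) = 1"
| "icost (IArr a e) = icost e + 1"
| "icost (IOp f e1 e2) = icost e1 + icost e2 + 1"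

fun rcost :: "rexp \<Rightarrow> nat" where
  "rcost RZero = 1"
| "rcost (RReg x) = 1"
| "rcost (RArr a e) = icost e + 1"
| "rcost (RPlus e1 e2) = rcost e1 + rcost e2 + 1"

fun bcost :: "bexp \<Rightarrow> nat" where
  "bcost (ILess e1 e2) = icost e1 + icost e2 + 1"
| "bcost (IEq e1 e2) = icost e1 + icost e2 + 1"
| "bcost (RLess e1 e2) = rcost e1 + rcost e2 + 1"
| "bcost (Not b) = bcost b + 1"
| "bcost (And b1 b2) = bcost b1 + bcost b2 + 1"

text \<open>
  \<open>exec B c s t s'\<close>: with word bound \<open>B\<close>, program \<open>c\<close> started in \<open>s\<close> halts in \<open>s'\<close> after \<open>t\<close> steps,
  without overflow.
\<close>

inductive exec :: "nat \<Rightarrow> com \<Rightarrow> state \<Rightarrow> nat \<Rightarrow> state \<Rightarrow> bool" for B where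
  exec_Skip: "exec B Skip s 1 s"
| exec_ISet: "ifits B s e \<Longrightarrow>
    exec B (ISet x e) s (icost e + 1) (s\<lparr>ireg := (ireg s)(x := ival s e)\<rparr>)"
| exec_RSet: "rfits B s e \<Longrightarrow>
    exec B (RSet x e) s (rcost e + 1) (s\<lparr>rreg := (rreg s)(x := rval s e)\<rparr>)"
| exec_IStore: "ifits B s i \<Longrightarrow> ifits B s e \<Longrightarrow>
    exec B (IStore a i e) s (icost i + icost e + 1)
      (s\<lparr>iarr := (iarr s)(a := (iarr s a)(ival s i := ival s e))\<rparr>)"
| exec_RStore: "ifits B s i \<Longrightarrow> rfits B s e \<Longrightarrow>
    exec B (RStore a i e) s (icost i + rcost e + 1)
      (s\<lparr>rarr := (rarr s)(a := (rarr s a)(ival s i := rval s e))\<rparr>)"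
| exec_Seq: "exec B c1 s t1 s1 \<Longrightarrow> exec B c2 s1 t2 s2 \<Longrightarrow>
    exec B (Seq c1 c2) s (t1 + t2) s2"
| exec_CondT: "bfits B s b \<Longrightarrow> bval s b \<Longrightarrow> exec B c1 s t s' \<Longrightarrow>
    exec B (Cond b c1 c2) s (bcost b + 1 + t) s'"
| exec_CondF: "bfits B s b \<Longrightarrow> \<not> bval s b \<Longrightarrow> exec B c2 s t s' \<Longrightarrow>
    exec B (Cond b c1 c2) s (bcost b + 1 + t) s'"
| exec_WhileF: "bfits B s b \<Longrightarrow> \<not> bval s b \<Longrightarrow>
    exec B (While b c) s (bcost b + 1) s"
| exec_WhileT: "bfits B s b \<Longrightarrow> bval s b \<Longrightarrow> exec B c s t1 s1 \<Longrightarrow> exec B (While b c) s1 t2 s2 \<Longrightarrow>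
    exec B (While b c) s (bcost b + 1 + t1 + t2) s2"

lemma exec_deterministic:
  "exec B c s t s' \<Longrightarrow> exec B c s t2 s2 \<Longrightarrow> t2 = t \<and> s2 = s'"
proof (induction arbitrary: t2 s2 rule: exec.induct)
  case exec_Skip
  from exec_Skip.prems show ?case by cases auto
next
  case exec_ISet
  from exec_ISet.prems show ?case by cases auto
next
  case exec_RSet
  from exec_RSet.prems show ?case by cases auto
next
  case exec_IStore
  from exec_IStore.prems show ?case by cases auto
next
  case exec_RStore
  from exec_RStore.prems show ?case by cases auto
next
  case exec_Seq
  from exec_Seq.prems show ?case by cases (auto dest!: exec_Seq.IH)
next
  case exec_CondT
  from exec_CondT.prems show ?case by cases (use exec_CondT.hyps(2) in \<open>auto dest!: exec_CondT.IH\<close>)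
next
  case exec_CondF
  from exec_CondF.prems show ?case by cases (use exec_CondF.hyps(2) in \<open>auto dest!: exec_CondF.IH\<close>)
next
  case exec_WhileF
  from exec_WhileF.prems show ?case by cases (use exec_WhileF.hyps(2) in \<open>auto\<close>)
next
  case exec_WhileT
  from exec_WhileT.prems show ?case
    by cases (use exec_WhileT.hyps(2) in \<open>auto dest!: exec_WhileT.IH\<close>)
qed


section \<open>Input and output\<close>

text \<open>
  A graph on \<open>{..<n}\<close> is given as a list of its \<open>m\<close> edges, in arbitrary order and with
  each edge in one arbitrary orientation. All other cells are initially \<open>0\<close>.
\<close>

definition edge_list :: "'a pair_pre_digraph \<Rightarrow> ('a \<times> 'a) list \<Rightarrow> bool" where
  "edge_list G es \<longleftrightarrow> set es \<subseteq> parcs G \<and> distinct (map (\<lambda>(u, v). {u, v}) es) \<and>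
     (\<lambda>(u, v). {u, v}) ` set es = uedges G"

definition input_state ::
    "nat \<Rightarrow> (nat \<times> nat) list \<Rightarrow> (nat \<times> nat \<Rightarrow> real) \<Rightarrow> nat \<Rightarrow> state" where
  "input_state n es w k = \<lparr>
     ireg = (\<lambda>_. 0)(''n'' := n, ''m'' := length es, ''k'' := k),
     rreg = (\<lambda>_. 0),
     iarr = (\<lambda>_ _. 0)(
       ''src'' := (\<lambda>i. if i < length es then fst (es ! i) else 0),
       ''tgt'' := (\<lambda>i. if i < length es then snd (es ! i) else 0)),
     rarr = (\<lambda>_ _. 0)(
       ''wt'' := (\<lambda>i. if i < length es then w (es ! i) else 0))\<rparr>"

text \<open>
  The estimates are returned in row-major matrices: an entry of \<open>''finite''\<close> that is \<open>0\<close> (in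
  particular, one that was never written) means \<open>\<infinity>\<close>, otherwise the estimate is the entry of
  \<open>''est''\<close>.
\<close>

definition estimate :: "nat \<Rightarrow> state \<Rightarrow> nat \<Rightarrow> nat \<Rightarrow> ereal" where
  "estimate n s u v =
     (if iarr s ''finite'' (u * n + v) = 0 then \<infinity> else ereal (rarr s ''est'' (u * n + v)))"

end

theory Submission
  imports Defs
begin

text \<open>
  Only the \<open>a\<close> non-isolated vertices matter. Let \<open>r\<close> be the least integer with \<open>r ^ k * a \<ge> m\<close>, and
  let \<open>s\<^sub>l = r ^ (k - l)\<close> for \<open>1 \<le> l \<le> k\<close>, whereas \<open>s\<^sub>0\<close> exceeds all degrees. Call the first \<open>s\<^sub>l\<close>
  entries of the sorted adjacency list of \<open>b\<close>, headed by \<open>b\<close> itself, the near neighbours of \<open>b\<close> at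
  level \<open>l\<close>. A greedy set \<open>D\<^sub>l\<close> of \<open>O(a log n / s\<^sub>l)\<close> vertices hits these sets wherever they are full,
  and every such \<open>b\<close> has a pivot in \<open>D\<^sub>l\<close> among them. Level \<open>l\<close> runs Dijkstra's algorithm from
  every \<open>u\<close> in \<open>D\<^sub>l\<close> on the at most \<open>a s\<^sub>l\<^sub>-\<^sub>1\<close> arcs from near neighbours at level \<open>l - 1\<close>, starting from
  the estimates of the paths that reach \<open>b\<close> through its pivot of level \<open>l - 1\<close>. On a shortest path from \<open>u\<close>,
  consider the last arc that is not among these arcs, and let it enter \<open>b\<close>. The pivot of \<open>b\<close> is no
  farther from \<open>b\<close> than the length of this arc, so that the detour through the pivot costs at most
  \<open>2 W\<close> on top of the error of the previous level. Level \<open>1\<close> is exact and \<open>D\<^sub>k\<close> contains all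
  non-isolated vertices, which gives the surplus \<open>2 (k - 1) W\<close>. Every level takes
  \<open>O(a\<^sup>2 r + m)\<close> steps up to logarithmic factors.
\<close>

section \<open>Program logic\<close>

text \<open>Already for \<open>r = 1\<close> a level costs the square of the number of vertices it
  treats, and \<open>n ^ 2\<close> exceeds \<open>n powr (2 - 1 / k) * m powr (1 / k)\<close> when
  \<open>m\<close> is far below \<open>n\<close>. With \<open>a \<le> 2 m\<close> instead,
  \<open>a powr (1 / k)\<close> is at most \<open>2 m powr (1 / k)\<close>. For the same reason no
  matrix is cleared: unwritten cells mean infinity. The sizes are powers of one ratio so that the
  number of runs, about \<open>a / r ^ (k - l)\<close>, times the number of arcs,
  \<open>a r ^ (k - l + 1)\<close>, is \<open>a ^ 2 r\<close> at every level. As \<open>r\<close> is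
  least, \<open>r = 1\<close> or \<open>(r - 1) ^ k * a < m\<close>, and either way
  \<open>r a powr (1 / k)\<close> is \<open>O(m powr (1 / k))\<close>. The search for
  \<open>r\<close> computes powers that may overshoot \<open>m\<close>; they stay below
  \<open>2 ^ k * n ^ 2\<close> or are 1, and \<open>k = O(log n)\<close> keeps such words
  logarithmic. The surplus is proved for all walks with weights at most \<open>W\<close>, by
  induction on the last arc, rather than for shortest paths only. A detour uses the estimate from
  the pivot to \<open>u\<close>, hence a reversed walk: undirectedness enters there.\<close>

notation Seq (infixr ";;" 60)

abbreviation (input) iplus (infixl "+\<^sub>i" 65) where "a +\<^sub>i b \<equiv> IOp Plus a b"
abbreviation (input) iminus (infixl "-\<^sub>i" 65) where "a -\<^sub>i b \<equiv> IOp Minus a b"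
abbreviation (input) itimes (infixl "*\<^sub>i" 70) where "a *\<^sub>i b \<equiv> IOp Times a b"
abbreviation (input) idiv (infixl "div\<^sub>i" 70) where "a div\<^sub>i b \<equiv> IOp Div a b"
abbreviation (input) BOr where "BOr b c \<equiv> Not (And (Not b) (Not c))"

definition iset :: "name \<Rightarrow> nat \<Rightarrow> state \<Rightarrow> state" where
  "iset x v s = s\<lparr>ireg := (ireg s)(x := v)\<rparr>"
definition rset :: "name \<Rightarrow> real \<Rightarrow> state \<Rightarrow> state" where
  "rset x v s = s\<lparr>rreg := (rreg s)(x := v)\<rparr>"
definition iput :: "name \<Rightarrow> nat \<Rightarrow> nat \<Rightarrow> state \<Rightarrow> state" where
  "iput a i v s = s\<lparr>iarr := (iarr s)(a := (iarr s a)(i := v))\<rparr>"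
definition rput :: "name \<Rightarrow> nat \<Rightarrow> real \<Rightarrow> state \<Rightarrow> state" where
  "rput a i v s = s\<lparr>rarr := (rarr s)(a := (rarr s a)(i := v))\<rparr>"

lemma ireg_update [simp]:
  "ireg (iset x v s) y = (if y = x then v else ireg s y)"
  "ireg (rset x r s) = ireg s" "ireg (iput a i v s) = ireg s" "ireg (rput a i r s) = ireg s"
  by (auto simp: iset_def rset_def iput_def rput_def)

lemma rreg_update [simp]:
  "rreg (rset x r s) y = (if y = x then r else rreg s y)"
  "rreg (iset x v s) = rreg s" "rreg (iput a i v s) = rreg s" "rreg (rput a i r s) = rreg s"
  by (auto simp: iset_def rset_def iput_def rput_def)

lemma iarr_update [simp]:
  "iarr (iput a i v s) b = (if b = a then (iarr s a)(i := v) else iarr s b)"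
  "iarr (rset x r s) = iarr s" "iarr (iset x v s) = iarr s" "iarr (rput a i r s) = iarr s"
  by (auto simp: iset_def rset_def iput_def rput_def)

lemma rarr_update [simp]:
  "rarr (rput a i r s) b = (if b = a then (rarr s a)(i := r) else rarr s b)"
  "rarr (rset x r s) = rarr s" "rarr (iset x v s) = rarr s" "rarr (iput a i v s) = rarr s"
  by (auto simp: iset_def rset_def iput_def rput_def)

fun writes :: "com \<Rightarrow> name set" where
  "writes Skip = {}"
| "writes (ISet x e) = {x}"
| "writes (RSet x e) = {x}"
| "writes (IStore x i e) = {x}"
| "writes (RStore x i e) = {x}"
| "writes (Seq c d) = writes c \<union> writes d"
| "writes (Cond b c d) = writes c \<union> writes d"
| "writes (While b c) = writes c"

text \<open>One namespace stands for all four kinds of cells: a name in \<open>W\<close> frees the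
  register and the array of that name alike. This is coarse, but a frame condition then reduces to a
  test on finite sets of names.\<close>

definition same :: "name set \<Rightarrow> state \<Rightarrow> state \<Rightarrow> bool" where
  "same W s s' \<longleftrightarrow> (\<forall>x. x \<notin> W \<longrightarrow> ireg s' x = ireg s x \<and> rreg s' x = rreg s x \<and>
     iarr s' x = iarr s x \<and> rarr s' x = rarr s x)"

lemma sameD:
  assumes "same W s s'" "x \<notin> W"
  shows "ireg s' x = ireg s x" "rreg s' x = rreg s x" "iarr s' x = iarr s x" "rarr s' x = rarr s x"
  using assms by (auto simp: same_def)

lemma same_refl [simp]: "same W s s"
  by (simp add: same_def)

lemma same_trans: "same W s s' \<Longrightarrow> same W' s' s'' \<Longrightarrow> W \<subseteq> X \<Longrightarrow> W' \<subseteq> X \<Longrightarrow> same X s s''"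
  by (simp add: same_def subset_iff) metis

lemma same_mono: "same W s s' \<Longrightarrow> W \<subseteq> X \<Longrightarrow> same X s s'"
  by (auto simp: same_def)

lemma same_update [simp]:
  "x \<in> W \<Longrightarrow> same W s (iset x v s') \<longleftrightarrow> same W s s'"
  "x \<in> W \<Longrightarrow> same W s (rset x r s') \<longleftrightarrow> same W s s'"
  "x \<in> W \<Longrightarrow> same W s (iput x i v s') \<longleftrightarrow> same W s s'"
  "x \<in> W \<Longrightarrow> same W s (rput x i r s') \<longleftrightarrow> same W s s'"
  by (unfold same_def, (simp, metis)+)

definition fit :: "nat \<Rightarrow> state \<Rightarrow> bool" where
  "fit M s \<longleftrightarrow> (\<forall>x. ireg s x < M) \<and> (\<forall>a i. iarr s a i < M)"

lemma fitD: "fit M s \<Longrightarrow> ireg s x < M" "fit M s \<Longrightarrow> iarr s a i < M"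
  by (auto simp: fit_def)

text \<open>
  If all cells are below \<open>M\<close>, an expression with at most eight leaves stays below \<open>M ^ 8\<close>; hence
  only the values of assignments have to be bounded in proofs.
\<close>

fun isize :: "iexp \<Rightarrow> nat" where
  "isize (Const c) = 1"
| "isize (IReg x) = 1"
| "isize (IArr a e) = 1"
| "isize (IOp f a b) = isize a + isize b"

fun iok :: "iexp \<Rightarrow> bool" where
  "iok (Const c) \<longleftrightarrow> c < 4"
| "iok (IReg x) \<longleftrightarrow> True"
| "iok (IArr a e) \<longleftrightarrow> iok e \<and> isize e \<le> 8"
| "iok (IOp f a b) \<longleftrightarrow> iok a \<and> iok b"

fun rok :: "rexp \<Rightarrow> bool" where
  "rok RZero \<longleftrightarrow> True"
| "rok (RReg x) \<longleftrightarrow> True"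
| "rok (RArr a e) \<longleftrightarrow> iok e \<and> isize e \<le> 8"
| "rok (RPlus a b) \<longleftrightarrow> rok a \<and> rok b"

fun bok :: "bexp \<Rightarrow> bool" where
  "bok (ILess a b) \<longleftrightarrow> iok a \<and> iok b \<and> isize a \<le> 8 \<and> isize b \<le> 8"
| "bok (IEq a b) \<longleftrightarrow> iok a \<and> iok b \<and> isize a \<le> 8 \<and> isize b \<le> 8"
| "bok (RLess a b) \<longleftrightarrow> rok a \<and> rok b"
| "bok (Not b) \<longleftrightarrow> bok b"
| "bok (And a b) \<longleftrightarrow> bok a \<and> bok b"

lemma isize_pos: "1 \<le> isize e"
  by (induction e) auto

text \<open>Exponents add under every operation: for products by monotonicity, and for sums because
  \<open>p + q \<le> p * q\<close> once both are at least 2. The other three operations never exceed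
  \<open>x\<close>.\<close>

lemma iop_val_less:
  assumes "x < M ^ a" "y < M ^ b" "1 \<le> a" "1 \<le> b" "(4::nat) \<le> M"
  shows "iop_val f x y < M ^ (a + b)"
proof -
  have ge: "M ^ 1 \<le> M ^ a" "M ^ 1 \<le> M ^ b"
    using assms power_increasing[of 1 a M] power_increasing[of 1 b M] by auto
  then have 2: "2 \<le> M ^ a" "2 \<le> M ^ b" using assms(5) by auto
  have sum: "M ^ a + M ^ b \<le> M ^ a * M ^ b"
  proof -
    obtain p q where "M ^ a = p + 2" "M ^ b = q + 2" using 2 by (metis add.commute le_iff_add)
    then show ?thesis by (simp add: algebra_simps)
  qed
  have "M ^ a < M ^ a * M ^ b" using 2 assms(5) by simp
  then have le: "z < M ^ (a + b)" if "z \<le> x" for z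
    using that assms(1) unfolding power_add by linarith
  show ?thesis
  proof (cases f)
    case Plus
    then show ?thesis using sum assms by (simp add: power_add)
  next
    case Times
    then show ?thesis using assms by (simp add: power_add mult_strict_mono)
  qed (use le div_le_dividend[of x y] mod_less_eq_dividend[of x y] in auto)
qed

lemma ival_less:
  assumes "fit M s" "4 \<le> M" shows "iok e \<Longrightarrow> ival s e < M ^ isize e"
proof (induction e)
  case (IOp f a b)
  then show ?case
    using iop_val_less[OF _ _ isize_pos isize_pos \<open>4 \<le> M\<close>] by simp
qed (use assms in \<open>auto simp: fit_def\<close>)

lemma ifits_if_iok:
  assumes "fit M s" "4 \<le> M" shows "iok e \<Longrightarrow> isize e \<le> 8 \<Longrightarrow> ifits (M ^ 8) s e"
proof (induction e)
  case (Const c)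
  have "M ^ 1 \<le> M ^ 8" using assms by (intro power_increasing) auto
  then show ?case using Const assms by simp
next
  case (IReg x)
  have "M ^ 1 \<le> M ^ 8" using assms by (intro power_increasing) auto
  moreover have "ireg s x < M" using assms by (simp add: fit_def)
  ultimately show ?case by simp
next
  case (IArr a e)
  have "M ^ 1 \<le> M ^ 8" using assms by (intro power_increasing) auto
  moreover have "iarr s a (ival s e) < M" using assms by (simp add: fit_def)
  ultimately show ?case using IArr by simp
next
  case (IOp f a b)
  have "ival s (IOp f a b) < M ^ isize (IOp f a b)"
    using ival_less[OF assms] IOp by blast
  also have "\<dots> \<le> M ^ 8" using IOp assms by (intro power_increasing) auto
  finally show ?case using IOp by simp
qed

lemma rfits_if_rok: "fit M s \<Longrightarrow> 4 \<le> M \<Longrightarrow> rok e \<Longrightarrow> rfits (M ^ 8) s e"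
  by (induction e) (auto simp: ifits_if_iok)

lemma bfits_if_bok: "fit M s \<Longrightarrow> 4 \<le> M \<Longrightarrow> bok b \<Longrightarrow> bfits (M ^ 8) s b"
  by (induction b) (auto simp: ifits_if_iok rfits_if_rok)

definition For :: "name \<Rightarrow> name \<Rightarrow> com \<Rightarrow> com" where
  "For i y c = ISet i (Const 0) ;; While (ILess (IReg i) (IReg y)) (c ;; ISet i (IReg i +\<^sub>i Const 1))"

lemma writes_For [simp]: "writes (For i y c) = insert i (writes c)"
  by (auto simp: For_def)

locale machine =
  fixes M :: nat
  assumes four_le_M: "4 \<le> M"
begin

text \<open>Total correctness. Preservation of \<open>fit\<close> and the frame
  \<open>same (writes c)\<close> are built in, so that specifications mention only what a program
  changes.\<close>

definition wp :: "com \<Rightarrow> state \<Rightarrow> (nat \<Rightarrow> state \<Rightarrow> bool) \<Rightarrow> bool" where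
  "wp c s Q \<longleftrightarrow> (fit M s \<longrightarrow>
     (\<exists>t s'. exec (M ^ 8) c s t s' \<and> fit M s' \<and> same (writes c) s s' \<and> Q t s'))"

lemma wp_weaken:
  assumes "wp c s Q'"
    and "\<And>t s'. fit M s' \<Longrightarrow> same (writes c) s s' \<Longrightarrow> Q' t s' \<Longrightarrow> Q t s'"
  shows "wp c s Q"
  using assms unfolding wp_def by blast

lemma wp_fit: "(fit M s \<Longrightarrow> wp c s Q) \<Longrightarrow> wp c s Q"
  unfolding wp_def by blast

lemma wp_Skip: "Q 1 s \<Longrightarrow> wp Skip s Q"
  unfolding wp_def using exec_Skip same_refl by blast

lemma wp_ISet:
  assumes "iok e" "isize e \<le> 8" "ival s e < M" "Q (icost e + 1) (iset x (ival s e) s)"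
  shows "wp (ISet x e) s Q"
  unfolding wp_def
proof (intro impI exI conjI)
  assume "fit M s"
  then show "exec (M ^ 8) (ISet x e) s (icost e + 1) (iset x (ival s e) s)"
    unfolding iset_def using assms ifits_if_iok four_le_M by (intro exec_ISet) auto
  show "fit M (iset x (ival s e) s)" using assms(3) \<open>fit M s\<close> by (simp add: fit_def)
qed (use assms in auto)

lemma wp_RSet:
  assumes "rok e" "Q (rcost e + 1) (rset x (rval s e) s)"
  shows "wp (RSet x e) s Q"
  unfolding wp_def
proof (intro impI exI conjI)
  assume "fit M s"
  then show "exec (M ^ 8) (RSet x e) s (rcost e + 1) (rset x (rval s e) s)"
    unfolding rset_def using assms rfits_if_rok four_le_M by (intro exec_RSet) auto
  show "fit M (rset x (rval s e) s)" using \<open>fit M s\<close> by (simp add: fit_def)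
qed (use assms in auto)

lemma wp_IStore:
  assumes "iok i" "isize i \<le> 8" "iok e" "isize e \<le> 8" "ival s e < M"
    "Q (icost i + icost e + 1) (iput a (ival s i) (ival s e) s)"
  shows "wp (IStore a i e) s Q"
  unfolding wp_def
proof (intro impI exI conjI)
  assume "fit M s"
  then show "exec (M ^ 8) (IStore a i e) s (icost i + icost e + 1) (iput a (ival s i) (ival s e) s)"
    unfolding iput_def using assms ifits_if_iok four_le_M by (intro exec_IStore) auto
  show "fit M (iput a (ival s i) (ival s e) s)" using assms(5) \<open>fit M s\<close> by (simp add: fit_def)
qed (use assms in auto)

lemma wp_RStore:
  assumes "iok i" "isize i \<le> 8" "rok e"
    "Q (icost i + rcost e + 1) (rput a (ival s i) (rval s e) s)"
  shows "wp (RStore a i e) s Q"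
  unfolding wp_def
proof (intro impI exI conjI)
  assume "fit M s"
  then show "exec (M ^ 8) (RStore a i e) s (icost i + rcost e + 1) (rput a (ival s i) (rval s e) s)"
    unfolding rput_def using assms ifits_if_iok rfits_if_rok four_le_M by (intro exec_RStore) auto
  show "fit M (rput a (ival s i) (rval s e) s)" using \<open>fit M s\<close> by (simp add: fit_def)
qed (use assms in auto)

lemma wp_Seq:
  assumes "wp c s (\<lambda>t1 s1. wp d s1 (\<lambda>t2. Q (t1 + t2)))"
  shows "wp (c ;; d) s Q"
  unfolding wp_def
proof
  assume "fit M s"
  then obtain t1 s1 where 1: "exec (M ^ 8) c s t1 s1" "fit M s1" "same (writes c) s s1"
      "wp d s1 (\<lambda>t2. Q (t1 + t2))"
    using assms unfolding wp_def by blast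
  then obtain t2 s2 where 2: "exec (M ^ 8) d s1 t2 s2" "fit M s2" "same (writes d) s1 s2"
      "Q (t1 + t2) s2"
    unfolding wp_def by blast
  show "\<exists>t s'. exec (M ^ 8) (c ;; d) s t s' \<and> fit M s' \<and> same (writes (c ;; d)) s s' \<and> Q t s'"
  proof (intro exI conjI)
    show "exec (M ^ 8) (c ;; d) s (t1 + t2) s2" using 1(1) 2(1) by (rule exec_Seq)
    show "same (writes (c ;; d)) s s2" using 1(3) 2(3) by (rule same_trans) auto
  qed (use 2 in auto)
qed

lemma wp_Cond:
  assumes "bok b" "bval s b \<Longrightarrow> wp c s (\<lambda>t. Q (bcost b + 1 + t))"
    "\<not> bval s b \<Longrightarrow> wp d s (\<lambda>t. Q (bcost b + 1 + t))"
  shows "wp (Cond b c d) s Q"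
  unfolding wp_def
proof
  assume fit: "fit M s"
  then have bf: "bfits (M ^ 8) s b" using bfits_if_bok four_le_M assms(1) by blast
  show "\<exists>t s'. exec (M ^ 8) (Cond b c d) s t s' \<and> fit M s' \<and> same (writes (Cond b c d)) s s' \<and> Q t s'"
  proof (cases "bval s b")
    case True
    with assms(2) fit obtain t s' where "exec (M ^ 8) c s t s'" "fit M s'" "same (writes c) s s'"
        "Q (bcost b + 1 + t) s'"
      unfolding wp_def by blast
    moreover from this(3) have "same (writes (Cond b c d)) s s'" by (rule same_mono) simp
    ultimately show ?thesis using exec_CondT[OF bf True] by blast
  next
    case False
    with assms(3) fit obtain t s' where "exec (M ^ 8) d s t s'" "fit M s'" "same (writes d) s s'"
        "Q (bcost b + 1 + t) s'"
      unfolding wp_def by blast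
    moreover from this(3) have "same (writes (Cond b c d)) s s'" by (rule same_mono) simp
    ultimately show ?thesis using exec_CondF[OF bf False] by blast
  qed
qed

lemmas wp_intros = wp_Seq wp_Skip wp_ISet wp_RSet wp_IStore wp_RStore wp_Cond

text \<open>The invariant \<open>I\<close> speaks about the state and the time elapsed so far.\<close>

lemma wp_While_timed:
  assumes b: "bok b" and init: "I s 0"
    and step: "\<And>s' t. I s' t \<Longrightarrow> bval s' b \<Longrightarrow> same (writes c) s s' \<Longrightarrow> fit M s' \<Longrightarrow>
      wp c s' (\<lambda>t1 s1. I s1 (t + (bcost b + 1) + t1) \<and> \<mu> s1 (t + (bcost b + 1) + t1) < (\<mu> s' t :: nat))"
    and fin: "\<And>s' t. I s' t \<Longrightarrow> \<not> bval s' b \<Longrightarrow> same (writes c) s s' \<Longrightarrow> fit M s' \<Longrightarrow>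
      Q (t + (bcost b + 1)) s'"
  shows "wp (While b c) s Q"
proof -
  have "I s1 t \<Longrightarrow> same (writes c) s s1 \<Longrightarrow> fit M s1 \<Longrightarrow>
    \<exists>t' s'. exec (M ^ 8) (While b c) s1 t' s' \<and> fit M s' \<and> same (writes c) s s' \<and> Q (t + t') s'" for s1 t
  proof (induction "\<mu> s1 t" arbitrary: s1 t rule: less_induct)
    case less
    have bf: "bfits (M ^ 8) s1 b" using bfits_if_bok four_le_M b less.prems by blast
    show ?case
    proof (cases "bval s1 b")
      case True
      then obtain t1 s2 where 1: "exec (M ^ 8) c s1 t1 s2" "fit M s2" "same (writes c) s1 s2"
          "I s2 (t + (bcost b + 1) + t1)" "\<mu> s2 (t + (bcost b + 1) + t1) < \<mu> s1 t"
        using step[OF less.prems(1) _ less.prems(2,3)] less.prems unfolding wp_def by blast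
      have "same (writes c) s s2" using less.prems(2) 1(3) by (rule same_trans) auto
      from less.hyps[OF 1(5,4) this 1(2)] obtain t' s' where
        2: "exec (M ^ 8) (While b c) s2 t' s'" "fit M s'" "same (writes c) s s'"
          "Q (t + (bcost b + 1) + t1 + t') s'" by blast
      have "exec (M ^ 8) (While b c) s1 (bcost b + 1 + t1 + t') s'"
        by (rule exec_WhileT[OF bf True 1(1) 2(1)])
      then show ?thesis using 2 by (metis add.assoc)
    next
      case False
      then show ?thesis using exec_WhileF[OF bf False] fin less.prems by blast
    qed
  qed
  from this[OF init same_refl] show ?thesis unfolding wp_def by simp
qed

lemmas wp_While = wp_While_timed[where \<mu> = "\<lambda>s t. \<mu> s" for \<mu>]

text \<open>Per iteration, \<open>8\<close> pays for the test and the increment; \<open>6\<close> is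
  the initial assignment and the failing test. The budgets \<open>T j\<close> vary because a single
  adjacency list may be long while all of them together have size \<open>O(m)\<close>.\<close>

lemma wp_For_sum:
  assumes i: "i \<notin> writes c" and y: "y \<notin> writes c" "i \<noteq> y" and N: "ireg s y = N"
    and init: "I 0 (iset i 0 s)"
    and step: "\<And>j s'. j < N \<Longrightarrow> I j s' \<Longrightarrow> ireg s' i = j \<Longrightarrow> ireg s' y = N \<Longrightarrow>
      same (insert i (writes c)) s s' \<Longrightarrow> fit M s' \<Longrightarrow>
      wp c s' (\<lambda>t1 s1. t1 \<le> T j \<and> I (Suc j) (iset i (Suc j) s1))"
    and fin: "\<And>s' t. I N s' \<Longrightarrow> t \<le> (\<Sum>j<N. T j) + 8 * N + 6 \<Longrightarrow>
      same (insert i (writes c)) s s' \<Longrightarrow> fit M s' \<Longrightarrow> Q t s'"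
  shows "wp (For i y c) s Q"
  unfolding For_def
proof (rule wp_fit, rule wp_Seq, rule wp_ISet)
  assume fit: "fit M s"
  show "ival s (Const 0) < M" using four_le_M by simp
  let ?I = "\<lambda>s' t. \<exists>j\<le>N. I j s' \<and> ireg s' i = j \<and> ireg s' y = N \<and> t \<le> (\<Sum>j<j. T j) + 8 * j"
  show "wp (While (ILess (IReg i) (IReg y)) (c ;; ISet i (IOp Plus (IReg i) (Const 1))))
     (iset i (ival s (Const 0)) s) (\<lambda>t2. Q (icost (Const 0) + 1 + t2))"
    unfolding ival.simps
  proof (rule wp_While[where I = ?I and \<mu> = "\<lambda>s. N - ireg s i"])
    show "\<exists>j\<le>N. I j (iset i 0 s) \<and> ireg (iset i 0 s) i = j \<and> ireg (iset i 0 s) y = N \<and>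
        0 \<le> (\<Sum>j<j. T j) + 8 * j"
      using init N y by auto
  next
    fix s' t assume "?I s' t" and b: "bval s' (ILess (IReg i) (IReg y))"
      and sm: "same (writes (c ;; ISet i (IOp Plus (IReg i) (Const 1)))) (iset i 0 s) s'" and f: "fit M s'"
    then obtain j where j: "j \<le> N" "I j s'" "ireg s' i = j" "ireg s' y = N" "t \<le> (\<Sum>j<j. T j) + 8 * j"
      by blast
    have lt: "j < N" using b j by simp
    have NM: "N < M" using N fit by (auto simp: fit_def)
    have "same (insert i (writes c)) s s'"
      by (rule same_trans[OF _ sm, of "{i}"]) auto
    then have w: "wp c s' (\<lambda>t1 s1. t1 \<le> T j \<and> I (Suc j) (iset i (Suc j) s1))"
      using step[OF lt j(2-4)] f by simp
    show "wp (c ;; ISet i (IOp Plus (IReg i) (Const 1))) s' (\<lambda>t1 s1.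
       ?I s1 (t + (bcost (ILess (IReg i) (IReg y)) + 1) + t1) \<and> N - ireg s1 i < N - ireg s' i)"
      apply (rule wp_Seq, rule wp_weaken[OF w])
      subgoal for t1 s1
        using lt NM j i y sameD(1)[of "writes c" s' s1]
        by (intro wp_ISet conjI exI[of _ "Suc j"]) auto
      done
  next
    fix s' t assume "?I s' t" and b: "\<not> bval s' (ILess (IReg i) (IReg y))"
      and sm: "same (writes (c ;; ISet i (IOp Plus (IReg i) (Const 1)))) (iset i 0 s) s'" and f: "fit M s'"
    then obtain j where j: "j \<le> N" "I j s'" "ireg s' i = j" "ireg s' y = N" "t \<le> (\<Sum>j<j. T j) + 8 * j"
      by blast
    have "j = N" using b j by simp
    moreover have "same (insert i (writes c)) s s'"
      by (rule same_trans[OF _ sm, of "{i}"]) auto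
    ultimately show "Q (icost (Const 0) + 1 + (t + (bcost (ILess (IReg i) (IReg y)) + 1))) s'"
      using j f by (intro fin) auto
  qed simp
qed simp_all

lemma wp_For:
  assumes "i \<notin> writes c" and "y \<notin> writes c" "i \<noteq> y" and "ireg s y = N"
    and "I 0 (iset i 0 s)"
    and "\<And>j s'. j < N \<Longrightarrow> I j s' \<Longrightarrow> ireg s' i = j \<Longrightarrow> ireg s' y = N \<Longrightarrow>
      same (insert i (writes c)) s s' \<Longrightarrow> fit M s' \<Longrightarrow>
      wp c s' (\<lambda>t1 s1. t1 \<le> T \<and> I (Suc j) (iset i (Suc j) s1))"
    and fin: "\<And>s' t. I N s' \<Longrightarrow> t \<le> N * (T + 8) + 6 \<Longrightarrow>
      same (insert i (writes c)) s s' \<Longrightarrow> fit M s' \<Longrightarrow> Q t s'"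
  shows "wp (For i y c) s Q"
  by (rule wp_For_sum[where T = "\<lambda>_. T" and I = I, OF assms(1-6)])
    (auto intro!: fin simp: algebra_simps)

end

section \<open>A tournament tree as priority queue\<close>

text \<open>
  The leaves of the implicit tree are the nodes \<open>N + q\<close> for \<open>q < N\<close>. A node holds \<open>q + 1\<close> for the
  element \<open>q\<close> of least key below it, and \<open>0\<close> if there is none.
\<close>

definition pick :: "(nat \<Rightarrow> real) \<Rightarrow> nat \<Rightarrow> nat \<Rightarrow> nat" where
  "pick key a b = (if b \<noteq> 0 \<and> (a = 0 \<or> key b < key a) then b else a)"

text \<open>The path to the root under halving, with \<open>j\<close> itself at its start and 0,
  which is no node of the tree, at its end.\<close>

definition anc :: "nat \<Rightarrow> nat set" where
  "anc j = {i. \<exists>e. i = j div 2 ^ e}"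

lemma anc_refl [simp]: "j \<in> anc j"
  unfolding anc_def by (auto intro: exI[of _ 0])

lemma anc_div2: "i \<in> anc j \<Longrightarrow> i div 2 \<in> anc j"
proof -
  assume "i \<in> anc j"
  then obtain e where "i = j div 2 ^ e" by (auto simp: anc_def)
  then have "i div 2 = j div 2 ^ Suc e" by (simp add: div_mult2_eq power_Suc2 del: power_Suc)
  then show ?thesis unfolding anc_def by blast
qed

lemma anc_0 [simp]: "anc 0 = {0}"
  by (auto simp: anc_def)

lemma anc_parent: "anc j = insert j (anc (j div 2))"
proof -
  have "j div 2 ^ e = j \<or> (\<exists>d. j div 2 ^ e = j div 2 div 2 ^ d)" for e
    by (cases e) (auto simp: div_mult2_eq)
  moreover have "\<exists>e. j div 2 div 2 ^ d = j div 2 ^ e" for d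
    by (rule exI[of _ "Suc d"]) (simp add: div_mult2_eq)
  ultimately show ?thesis using anc_refl[of j] unfolding anc_def by fastforce
qed

text \<open>The repair has climbed up to \<open>j\<close>: the nodes of \<open>anc j\<close> are
  exempt from the equation until it has passed them. \<open>key\<close> is indexed by the entries
  \<open>q + 1\<close>, not by \<open>q\<close>. Halving leads from every node to node 1 whatever
  \<open>N\<close> is, so there is no padding to a power of two.\<close>

definition tournament :: "nat \<Rightarrow> (nat \<Rightarrow> nat) \<Rightarrow> (nat \<Rightarrow> real) \<Rightarrow> nat set \<Rightarrow> nat \<Rightarrow> bool" where
  "tournament N tr key Q j \<longleftrightarrow> Q \<subseteq> {..<N} \<and> (\<forall>q<N. tr (N + q) = (if q \<in> Q then q + 1 else 0)) \<and>
     (\<forall>i. 0 < i \<longrightarrow> i < N \<longrightarrow> i \<notin> anc j \<longrightarrow> tr i = pick key (tr (2 * i)) (tr (2 * i + 1)))"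

text \<open>Only the ancestors of \<open>0\<close>, that is none, may be out of date.\<close>

abbreviation pq :: "nat \<Rightarrow> (nat \<Rightarrow> nat) \<Rightarrow> (nat \<Rightarrow> real) \<Rightarrow> nat set \<Rightarrow> bool" where
  "pq N tr key Q \<equiv> tournament N tr key Q 0"

lemma pq_node:
  assumes "pq N tr key Q" "0 < i" "i < N"
  shows "tr i = pick key (tr (2 * i)) (tr (2 * i + 1))"
  using assms by (auto simp: tournament_def)

lemma pq_leaf:
  assumes "pq N tr key Q" "N \<le> i" "i < 2 * N" "tr i \<noteq> 0"
  shows "tr i - 1 \<in> Q" "i = N + (tr i - 1)"
proof -
  have "tr (N + (i - N)) = (if i - N \<in> Q then i - N + 1 else 0)"
    using assms unfolding tournament_def by (metis add_diff_inverse_nat leD mult_2 nat_add_left_cancel_less)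
  then show "tr i - 1 \<in> Q" "i = N + (tr i - 1)" using assms by (auto split: if_splits)
qed

text \<open>Follow the winner from \<open>i\<close> down to its leaf. That \<open>i\<close> lies
  above this leaf is what localises updates: only nodes above the leaf of \<open>q\<close> can hold
  \<open>q + 1\<close>.\<close>

lemma pq_elem:
  assumes "pq N tr key Q" shows "0 < i \<Longrightarrow> i < 2 * N \<Longrightarrow> tr i \<noteq> 0 \<Longrightarrow> tr i - 1 \<in> Q \<and> i \<in> anc (N + (tr i - 1))"
proof (induction "2 * N - i" arbitrary: i rule: less_induct)
  case less
  show ?case
  proof (cases "i < N")
    case True
    then obtain c where c: "c = 2 * i \<or> c = 2 * i + 1" "tr i = tr c"
      using pq_node[OF assms less.prems(1)] unfolding pick_def by metis
    then have "c div 2 = i" "0 < c" "c < 2 * N" "2 * N - c < 2 * N - i" using True less.prems by auto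
    then show ?thesis using less.hyps[of c] less.prems(3) c(2) anc_div2[of c] by metis
  next
    case False
    then show ?thesis using pq_leaf[OF assms, of i] less.prems anc_refl[of i] by auto
  qed
qed

lemma pq_root:
  assumes "pq N tr key Q"
  shows "0 < i \<Longrightarrow> i < 2 * N \<Longrightarrow> tr i \<noteq> 0 \<Longrightarrow> tr 1 \<noteq> 0 \<and> key (tr 1) \<le> key (tr i)"
proof (induction i rule: less_induct)
  case (less i)
  show ?case
  proof (cases "i = 1")
    case False
    let ?p = "i div 2"
    have p: "?p < i" "0 < ?p" "?p < N" "?p < 2 * N" using False less.prems by auto
    have "i = 2 * ?p \<or> i = 2 * ?p + 1" by auto
    then have "tr ?p \<noteq> 0 \<and> key (tr ?p) \<le> key (tr i)"
      using pq_node[OF assms p(2,3)] less.prems(3) unfolding pick_def by (smt (verit) not_less)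
    then show ?thesis using less.IH[OF p(1,2,4)] by auto
  qed (use less in auto)
qed

lemma pq_min:
  assumes "pq N tr key Q" "0 < N" "tr 1 \<noteq> 0"
  shows "tr 1 - 1 \<in> Q" "q \<in> Q \<Longrightarrow> key (tr 1) \<le> key (q + 1)"
proof -
  show "tr 1 - 1 \<in> Q" using pq_elem[OF assms(1), of 1] assms by auto
  assume "q \<in> Q"
  then have "q < N" "tr (N + q) = q + 1" using assms(1) unfolding tournament_def by auto
  then show "key (tr 1) \<le> key (q + 1)" using pq_root[OF assms(1), of "N + q"] by auto
qed

lemma pq_empty:
  assumes "pq N tr key Q" "tr 1 = 0" shows "Q = {}"
proof (rule ccontr)
  assume "Q \<noteq> {}"
  then obtain q where "q \<in> Q" by blast
  then have "q < N" "tr (N + q) = q + 1" using assms(1) unfolding tournament_def by auto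
  then show False using pq_root[OF assms(1), of "N + q"] assms(2) by auto
qed

lemma tournament_change:
  assumes pq: "pq N tr key Q" and q: "q < N" and v: "v = 0 \<or> v = q + 1"
  shows "tournament N (tr(N + q := v)) (key(q + 1 := d)) (if v = 0 then Q - {q} else insert q Q) ((N + q)
      div 2)"
proof -
  have "(tr(N + q := v)) i = pick (key(q + 1 := d)) ((tr(N + q := v)) (2 * i)) ((tr(N + q := v)) (2 * i + 1))"
    if i: "0 < i" "i < N" "i \<notin> anc ((N + q) div 2)" for i
  proof -
    have ni: "i \<notin> anc (N + q)" using i anc_parent[of "N + q"] by auto
    \<comment> \<open>A child of \<open>i\<close> that held \<open>q + 1\<close>, or was the leaf of
      \<open>q\<close>, would put \<open>i\<close> itself above that leaf. So \<open>i\<close>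
      compares neither the changed entry nor the changed key.\<close>
    have c: "tr c \<noteq> q + 1 \<and> c \<noteq> N + q" if "c div 2 = i" "c < 2 * N" for c
    proof -
      have "c \<notin> anc (N + q)" using ni that anc_div2 by blast
      moreover have "0 < c" using that i by (cases c) auto
      ultimately show ?thesis using pq_elem[OF pq, of c] that by auto
    qed
    have "tr (2 * i) \<noteq> q + 1 \<and> 2 * i \<noteq> N + q" "tr (2 * i + 1) \<noteq> q + 1 \<and> 2 * i + 1 \<noteq> N + q"
      using c[of "2 * i"] c[of "2 * i + 1"] i by auto
    then show ?thesis using pq_node[OF pq i(1,2)] i by (auto simp: pick_def)
  qed
  then show ?thesis using pq q v unfolding tournament_def by auto
qed

lemma tournament_repair:
  assumes "tournament N tr key Q j" "0 < j" "j < N"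
  shows "tournament N (tr(j := pick key (tr (2 * j)) (tr (2 * j + 1)))) key Q (j div 2)"
proof -
  have "i \<notin> anc j \<or> i = j" "2 * i \<noteq> j" "2 * i + 1 \<noteq> j" if "i \<notin> anc (j div 2)" for i
    using that anc_parent[of j] by auto
  then show ?thesis using assms unfolding tournament_def by fastforce
qed

definition repair :: com where
  "repair =
     ISet ''pa'' (IArr ''tr'' (Const 2 *\<^sub>i IReg ''pj'')) ;;
     ISet ''pb'' (IArr ''tr'' (Const 2 *\<^sub>i IReg ''pj'' +\<^sub>i Const 1)) ;;
     Cond (And (Not (IEq (IReg ''pb'') (Const 0)))
           (BOr (IEq (IReg ''pa'') (Const 0))
             (RLess (RArr ''key'' (IReg ''pb'')) (RArr ''key'' (IReg ''pa'')))))
       (IStore ''tr'' (IReg ''pj'') (IReg ''pb''))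
       (IStore ''tr'' (IReg ''pj'') (IReg ''pa'')) ;;
     ISet ''pj'' (IReg ''pj'' div\<^sub>i Const 2)"

definition upd :: com where
  "upd =
     RStore ''key'' (IReg ''pi'' +\<^sub>i Const 1) (RReg ''pk'') ;;
     IStore ''tr'' (IReg ''N'' +\<^sub>i IReg ''pi'') (IReg ''pv'') ;;
     ISet ''pj'' ((IReg ''N'' +\<^sub>i IReg ''pi'') div\<^sub>i Const 2) ;;
     While (ILess (Const 0) (IReg ''pj'')) repair"

lemma writes_upd [simp]: "writes upd = {''key'', ''tr'', ''pj'', ''pa'', ''pb''}"
  by (auto simp: upd_def repair_def)

context machine
begin

lemma repair_spec:
  "wp repair s (\<lambda>t s'. t \<le> 40 \<and> ireg s' ''pj'' = ireg s ''pj'' div 2 \<and> rarr s' ''key'' = rarr s ''key'' \<and>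
    iarr s' ''tr'' = (iarr s ''tr'')(ireg s ''pj'' :=
      pick (rarr s ''key'') (iarr s ''tr'' (2 * ireg s ''pj'')) (iarr s ''tr'' (2 * ireg s ''pj'' + 1))))"
proof (rule wp_fit)
  assume "fit M s"
  note fit = fitD[OF this]
  show ?thesis
    unfolding repair_def using fit(1)[of "''pj''"]
    by (intro wp_intros; simp add: fit pick_def; linarith?; auto)
qed

text \<open>\<open>pv\<close> selects the operation: 0 deletes \<open>pi\<close>, and
  \<open>pi + 1\<close> inserts it or changes its key. Both overwrite the leaf and then
  climb.\<close>

lemma upd_spec:
  assumes pq: "pq N (iarr s ''tr'') (rarr s ''key'') Q" and N: "ireg s ''N'' = N" and L: "N \<le> 2 ^ L"
    and q: "ireg s ''pi'' < N" and v: "ireg s ''pv'' = 0 \<or> ireg s ''pv'' = ireg s ''pi'' + 1"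
  shows "wp upd s (\<lambda>t s'. t \<le> 50 * L + 50 \<and>
    pq N (iarr s' ''tr'') (rarr s' ''key'')
      (if ireg s ''pv'' = 0 then Q - {ireg s ''pi''} else insert (ireg s ''pi'') Q) \<and>
    rarr s' ''key'' = (rarr s ''key'')(ireg s ''pi'' + 1 := rreg s ''pk''))"
proof (rule wp_fit)
  assume fit: "fit M s"
  define q where "q = ireg s ''pi''"
  define key where "key = (rarr s ''key'')(q + 1 := rreg s ''pk'')"
  define Q' where "Q' = (if ireg s ''pv'' = 0 then Q - {q} else insert q Q)"
  \<comment> \<open>After \<open>e\<close> halvings the node is below \<open>2 ^ (L - e)\<close>, so
    the climb visits at most \<open>L\<close> nodes.\<close>
  let ?I = "\<lambda>s t. \<exists>e\<le>L. ireg s ''pj'' < 2 ^ (L - e) \<and> ireg s ''pj'' < N \<and> t \<le> 50 * e \<and>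
    tournament N (iarr s ''tr'') key Q' (ireg s ''pj'') \<and> rarr s ''key'' = key"
  have less: "(N + q) div 2 < N" using q by (simp add: q_def)
  have init: "?I (iset ''pj'' ((N + q) div 2) (iput ''tr'' (N + q) (ireg s ''pv'') (rput ''key'' (Suc q)
      (rreg s ''pk'') s))) 0"
    using tournament_change[OF pq q v, of "rreg s ''pk''"] less L
    by (intro exI[of _ 0]) (auto simp: q_def key_def Q'_def)
  have NM: "N < M" using fit N by (auto simp: fit_def)
  let ?s = "iset ''pj'' ((N + q) div 2) (iput ''tr'' (N + q) (ireg s ''pv'') (rput ''key'' (Suc q) (rreg
      s ''pk'') s))"
  have loop: "wp (While (ILess (Const 0) (IReg ''pj'')) repair) ?s
      (\<lambda>t s'. t \<le> 50 * L + 4 \<and> pq N (iarr s' ''tr'') key Q' \<and> rarr s' ''key'' = key)"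
  proof (rule wp_While[where I = ?I and \<mu> = "\<lambda>s. ireg s ''pj''"], goal_cases)
    case 2
    show ?case using init by simp
  next
    case (3 s' t)
    then obtain e where e: "e \<le> L" "ireg s' ''pj'' < 2 ^ (L - e)" "ireg s' ''pj'' < N" "t \<le> 50 * e"
      "tournament N (iarr s' ''tr'') key Q' (ireg s' ''pj'')" "rarr s' ''key'' = key" by blast
    have "e \<noteq> L" using e 3(2) by auto
    then have e': "Suc e \<le> L" "L - e = Suc (L - Suc e)" using e(1) by auto
    show ?case
    proof (rule wp_weaken[OF repair_spec], elim conjE, intro conjI exI[of _ "Suc e"], goal_cases)
      case (1 t1 s1) then show ?case using e' by simp
    next
      case (2 t1 s1) then show ?case using e e' by simp
    next
      case (3 t1 s1) then show ?case using e e' by simp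
    qed (use e 3(2) tournament_repair[OF e(5)] in auto)
  next
    case (4 s' t)
    then have "t \<le> 50 * L" "ireg s' ''pj'' = 0" by (auto intro: order_trans)
    then show ?case using 4(1) by auto
  qed simp
  show ?thesis
    unfolding upd_def
    apply (intro wp_intros; (simp add: fitD[OF fit] N split del: if_split flip: q_def)?)
    using NM less apply simp
    by (rule wp_weaken[OF loop]) (auto simp: key_def Q'_def q_def)
qed

end

section \<open>Sorted adjacency lists\<close>

lemma row_index:
  assumes "a * n + p = a' * n + p'" "p < n" "p' < n" shows "a = a' \<and> p = (p' :: nat)"
proof -
  have "(a * n + p) div n = a" "(a' * n + p') div n = a'" using assms(2,3) by auto
  then have "a = a'" using assms(1) by metis
  then show ?thesis using assms(1) by simp
qed

text \<open>Rows have stride \<open>n\<close>. That no two arcs of \<open>F\<close> share both ends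
  keeps a row within \<open>n\<close> entries, so that rows never overlap. Entries from
  \<open>cnt a\<close> on are junk.\<close>

definition arc_lists :: "nat \<Rightarrow> nat set \<Rightarrow> (nat \<Rightarrow> nat) \<Rightarrow> (nat \<Rightarrow> nat) \<Rightarrow> (nat \<Rightarrow> real) \<Rightarrow> (nat \<times> nat \<times> real)
    set \<Rightarrow> bool" where
  "arc_lists n A cnt tg wg F \<longleftrightarrow> F \<subseteq> A \<times> {..<n} \<times> UNIV \<and> inj_on (\<lambda>(a, b, c). (a, b)) F \<and>
     (\<forall>a\<in>A. bij_betw (\<lambda>p. (a, tg (a * n + p), wg (a * n + p))) {..<cnt a} {x \<in> F. fst x = a})"

lemma arc_lists_arc:
  assumes "arc_lists n A cnt tg wg F" "a \<in> A" "p < cnt a"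
  shows "(a, tg (a * n + p), wg (a * n + p)) \<in> F"
  using assms unfolding arc_lists_def bij_betw_def by fastforce

lemma arc_lists_find:
  assumes "arc_lists n A cnt tg wg F" "(a, b, c) \<in> F"
  shows "\<exists>p<cnt a. tg (a * n + p) = b \<and> wg (a * n + p) = c"
proof -
  have "a \<in> A" using assms unfolding arc_lists_def by auto
  then have "(\<lambda>p. (a, tg (a * n + p), wg (a * n + p))) ` {..<cnt a} = {x \<in> F. fst x = a}"
    using assms unfolding arc_lists_def bij_betw_def by blast
  moreover have "(a, b, c) \<in> {x \<in> F. fst x = a}" using assms by simp
  ultimately have "(a, b, c) \<in> (\<lambda>p. (a, tg (a * n + p), wg (a * n + p))) ` {..<cnt a}" by simp
  then show ?thesis by auto
qed

lemma arc_lists_unique: "arc_lists n A cnt tg wg F \<Longrightarrow> (a, b, c) \<in> F \<Longrightarrow> (a, b, c') \<in> F \<Longrightarrow> c = c'"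
  unfolding arc_lists_def inj_on_def by fastforce

lemma arc_lists_inj:
  assumes l: "arc_lists n A cnt tg wg F" and a: "a \<in> A" shows "inj_on (\<lambda>p. tg (a * n + p)) {..<cnt a}"
proof (rule inj_onI)
  fix p q assume p: "p \<in> {..<cnt a}" and q: "q \<in> {..<cnt a}" and eq: "tg (a * n + p) = tg (a * n + q)"
  have "(a, tg (a * n + p), wg (a * n + p)) \<in> F" "(a, tg (a * n + q), wg (a * n + q)) \<in> F"
    using arc_lists_arc[OF l a] p q by auto
  then have "(a, tg (a * n + p), wg (a * n + p)) = (a, tg (a * n + q), wg (a * n + q))"
    using arc_lists_unique[OF l] eq by force
  moreover have "inj_on (\<lambda>p. (a, tg (a * n + p), wg (a * n + p))) {..<cnt a}"
    using l a unfolding arc_lists_def bij_betw_def by blast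
  ultimately show "p = q" using p q unfolding inj_on_def by blast
qed

lemma arc_lists_range: "arc_lists n A cnt tg wg F \<Longrightarrow> a \<in> A \<Longrightarrow> p < cnt a \<Longrightarrow> tg (a * n + p) < n"
  using arc_lists_arc[of n A cnt tg wg F a p] unfolding arc_lists_def by auto

lemma arc_lists_count:
  assumes "arc_lists n A cnt tg wg F" "a \<in> A" shows "cnt a \<le> n"
proof -
  have "(\<lambda>p. tg (a * n + p)) ` {..<cnt a} \<subseteq> {..<n}" using arc_lists_range[OF assms] by auto
  from card_inj_on_le[OF arc_lists_inj[OF assms] this finite_lessThan] show ?thesis by simp
qed

lemma arc_lists_card:
  assumes "arc_lists n A cnt tg wg F" "a \<in> A" shows "cnt a = card {x \<in> F. fst x = a}"
  using bij_betw_same_card[of _ "{..<cnt a}" "{x \<in> F. fst x = a}"] assms unfolding arc_lists_def by fastforce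

text \<open>As \<open>b\<close> does not occur in row \<open>a\<close>, the targets there form a
  proper subset of \<open>{..<n}\<close>. Hence the slot at \<open>cnt a\<close> is still inside the
  row, and by \<open>row_index\<close> it overwrites no entry of another one.\<close>

lemma arc_lists_push:
  assumes l: "arc_lists n A cnt tg wg F" and a: "a \<in> A" and b: "b < n" and new: "\<And>c'. (a, b, c') \<notin> F"
  shows "cnt a < n"
    and "arc_lists n A (cnt(a := cnt a + 1)) (tg(a * n + cnt a := b)) (wg(a * n + cnt a := c)) (insert
        (a, b, c) F)"
proof -
  have "b \<notin> (\<lambda>p. tg (a * n + p)) ` {..<cnt a}" using arc_lists_arc[OF l a] new by auto
  then have "(\<lambda>p. tg (a * n + p)) ` {..<cnt a} \<subset> {..<n}" using arc_lists_range[OF l a] b by auto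
  from psubset_card_mono[OF finite_lessThan this]
  have "card ((\<lambda>p. tg (a * n + p)) ` {..<cnt a}) < n" by (simp only: card_lessThan)
  then show lt: "cnt a < n" using card_image[OF arc_lists_inj[OF l a]] by simp
  let ?t = "tg(a * n + cnt a := b)" and ?w = "wg(a * n + cnt a := c)"
  have "bij_betw (\<lambda>p. (a', ?t (a' * n + p), ?w (a' * n + p))) {..<(cnt(a := cnt a + 1)) a'}
      {x \<in> insert (a, b, c) F. fst x = a'}" if a': "a' \<in> A" for a'
  proof -
    have old: "bij_betw (\<lambda>p. (a', tg (a' * n + p), wg (a' * n + p))) {..<cnt a'} {x \<in> F. fst x = a'}"
      using l a' unfolding arc_lists_def by blast
    have keep: "a' * n + p \<noteq> a * n + cnt a" if "p < cnt a'" for p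
      using row_index[of a' n p a "cnt a"] that lt arc_lists_count[OF l a'] by auto
    then have old': "bij_betw (\<lambda>p. (a', ?t (a' * n + p), ?w (a' * n + p))) {..<cnt a'} {x \<in> F. fst x = a'}"
      by (intro bij_betw_cong[THEN iffD1, OF _ old]) auto
    show ?thesis
    proof (cases "a' = a")
      case True
      have "{..<(cnt(a := cnt a + 1)) a'} = insert (cnt a) {..<cnt a}" using True by auto
      moreover have "{x \<in> insert (a, b, c) F. fst x = a'} = insert (a, b, c) {x \<in> F. fst x = a'}"
        using True by auto
      moreover have "bij_betw (\<lambda>p. (a', ?t (a' * n + p), ?w (a' * n + p))) (insert (cnt a) {..<cnt a})
          (insert (a, b, c) {x \<in> F. fst x = a'})"
        using notIn_Un_bij_betw3[of "cnt a" "{..<cnt a}" "\<lambda>p. (a', ?t (a' * n + p), ?w (a' * n + p))"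
            "{x \<in> F. fst x = a'}"] old' True new by auto
      ultimately show ?thesis by simp
    next
      case False
      then have "{x \<in> insert (a, b, c) F. fst x = a'} = {x \<in> F. fst x = a'}" by auto
      then show ?thesis using old' False by simp
    qed
  qed
  moreover have "inj_on (\<lambda>(a, b, c). (a, b)) (insert (a, b, c) F)"
    using l new unfolding arc_lists_def by force
  ultimately show "arc_lists n A (cnt(a := cnt a + 1)) ?t ?w (insert (a, b, c) F)"
    using l a b unfolding arc_lists_def by blast
qed

section \<open>Filling the adjacency lists by heap sort\<close>

definition push :: "name \<Rightarrow> name \<Rightarrow> name \<Rightarrow> name \<Rightarrow> name \<Rightarrow> name \<Rightarrow> com" where
  "push cnt tg wg x y z =
     RStore wg (IReg x *\<^sub>i IReg ''n'' +\<^sub>i IArr cnt (IReg x)) (RReg z) ;;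
     IStore tg (IReg x *\<^sub>i IReg ''n'' +\<^sub>i IArr cnt (IReg x)) (IReg y) ;;
     IStore cnt (IReg x) (IArr cnt (IReg x) +\<^sub>i Const 1)"

lemma writes_push [simp]: "writes (push cnt tg wg x y z) = {cnt, tg, wg}"
  by (auto simp: push_def)

text \<open>Every vertex heads its own list, with weight \<open>0\<close>.\<close>

definition sorted_lists ::
    "nat \<Rightarrow> (nat \<Rightarrow> nat) \<Rightarrow> nat \<Rightarrow> (nat \<Rightarrow> nat) \<Rightarrow> (nat \<Rightarrow> nat) \<Rightarrow> (nat \<Rightarrow> real) \<Rightarrow> (nat \<times> nat \<times> real) set \<Rightarrow> bool" where
  "sorted_lists n vs nv dg ad aw F \<longleftrightarrow> arc_lists n {..<n} dg ad aw F \<and>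
     inj_on vs {..<nv} \<and> vs ` {..<nv} = {a. a < n \<and> dg a \<noteq> 0} \<and>
     (\<forall>a<n. dg a \<noteq> 0 \<longrightarrow> ad (a * n) = a \<and> aw (a * n) = 0) \<and>
     (\<forall>a<n. \<forall>p q. p \<le> q \<longrightarrow> q < dg a \<longrightarrow> aw (a * n + p) \<le> aw (a * n + q))"

lemma sorted_lists_push:
  assumes l: "sorted_lists n vs nv dg ad aw F" and a: "a < n" "dg a \<noteq> 0" and b: "b < n"
    and new: "\<And>c'. (a, b, c') \<notin> F" and c: "\<And>b' c'. (a, b', c') \<in> F \<Longrightarrow> c' \<le> c"
  shows "sorted_lists n vs nv (dg(a := dg a + 1)) (ad(a * n + dg a := b)) (aw(a * n + dg a := c))
    (insert (a, b, c) F)"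
proof -
  have l': "arc_lists n {..<n} dg ad aw F" using l by (simp add: sorted_lists_def)
  note push = arc_lists_push(1)[OF l' _ b new] arc_lists_push(2)[OF l' _ b new, where c = c]
  have lt: "dg a < n" using push a by simp
  have keep: "a' * n + p \<noteq> a * n + dg a" if "p < dg a'" "a' < n" for a' p
    using row_index[of a' n p a "dg a"] that lt arc_lists_count[OF l', of a'] by auto
  have "(aw(a * n + dg a := c)) (a' * n + p) \<le> (aw(a * n + dg a := c)) (a' * n + q)"
    if a': "a' < n" and pq: "p \<le> q" "q < (dg(a := dg a + 1)) a'" for a' p q
  proof (cases "q < dg a'")
    case True
    then show ?thesis using l keep[of q a'] keep[of p a'] a' pq unfolding sorted_lists_def by auto
  next
    case False
    then have "a' = a" "q = dg a" using pq by (auto split: if_splits)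
    moreover have "aw (a * n + p) \<le> c" if "p < dg a"
      using c[OF arc_lists_arc[OF l', of a p]] a that by simp
    ultimately show ?thesis using pq by (cases "p = q") auto
  qed
  moreover have "ad (a' * n) = a' \<and> aw (a' * n) = 0 \<and> a' * n \<noteq> a * n + dg a" if "a' < n" "dg a' \<noteq> 0" for a'
    using l keep[of 0 a'] that unfolding sorted_lists_def by auto
  moreover have "{a'. a' < n \<and> (dg(a := dg a + 1)) a' \<noteq> 0} = {a. a < n \<and> dg a \<noteq> 0}" using a by auto
  ultimately show ?thesis using l push(2) a unfolding sorted_lists_def by auto
qed

lemma sorted_lists_new:
  assumes l: "sorted_lists n vs nv dg ad aw F" and a: "a < n" "dg a = 0"
  shows "nv < n"
    and "sorted_lists n (vs(nv := a)) (nv + 1) (dg(a := dg a + 1)) (ad(a * n + dg a := a)) (aw(a * n + dg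
        a := 0))
    (insert (a, a, 0) F)"
proof -
  have l': "arc_lists n {..<n} dg ad aw F" and inj: "inj_on vs {..<nv}"
    and im: "vs ` {..<nv} = {a. a < n \<and> dg a \<noteq> 0}" using l by (auto simp: sorted_lists_def)
  have "vs ` {..<nv} \<subseteq> {..<n}" "a \<notin> vs ` {..<nv}" "a \<in> {..<n}" using im a by auto
  then have "vs ` {..<nv} \<subset> {..<n}" by blast
  from psubset_card_mono[OF finite_lessThan this] have "card (vs ` {..<nv}) < n"
    by (simp only: card_lessThan)
  then show "nv < n" using card_image[OF inj] by simp
  have new: "(a, b, c) \<notin> F" for b c using arc_lists_find[OF l', of a b c] a by auto
  note push = arc_lists_push(1)[OF l' _ a(1) new] arc_lists_push(2)[OF l' _ a(1) new, where c = 0]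
  have keep: "a' * n + p \<noteq> a * n + dg a" if "p < dg a'" "a' < n" for a' p
    using row_index[of a' n p a "dg a"] that push(1) arc_lists_count[OF l', of a'] a by auto
  have "(aw(a * n + dg a := 0)) (a' * n + p) \<le> (aw(a * n + dg a := 0)) (a' * n + q)"
    if a': "a' < n" and pq: "p \<le> q" "q < (dg(a := dg a + 1)) a'" for a' p q
  proof (cases "q < dg a'")
    case True
    then show ?thesis using l keep[of q a'] keep[of p a'] a' pq unfolding sorted_lists_def by auto
  next
    case False
    then have "a' = a" "q = 0" using pq a by (auto split: if_splits)
    then show ?thesis using pq by auto
  qed
  moreover have "ad (a' * n) = a' \<and> aw (a' * n) = 0 \<and> a' * n \<noteq> a * n + dg a" if "a' < n" "dg a' \<noteq> 0" for a'
    using l keep[of 0 a'] that unfolding sorted_lists_def by auto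
  moreover have "(vs(nv := a)) ` {..<nv + 1} = {a'. a' < n \<and> (dg(a := dg a + 1)) a' \<noteq> 0}"
  proof -
    have "(vs(nv := a)) ` {..<nv + 1} = insert a (vs ` {..<nv})" by (auto simp: lessThan_Suc)
    then show ?thesis using im a by auto
  qed
  moreover have "inj_on (vs(nv := a)) {..<nv + 1}"
  proof -
    have "a \<notin> vs ` {..<nv}" using im a by auto
    then have "inj_on (vs(nv := a)) (insert nv {..<nv})"
      using inj by (auto simp: inj_on_def)
    then show ?thesis by (simp add: lessThan_Suc)
  qed
  ultimately show "sorted_lists n (vs(nv := a)) (nv + 1) (dg(a := dg a + 1)) (ad(a * n + dg a := a))
      (aw(a * n + dg a := 0)) (insert (a, a, 0) F)"
    using push(2) a unfolding sorted_lists_def by auto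
qed

text \<open>A vertex enters \<open>vs\<close> when an edge first meets it, and its list is opened
  with the vertex itself. Isolated vertices thus cost nothing and keep degree 0.\<close>

definition touch :: "name \<Rightarrow> com" where
  "touch x = Cond (IEq (IArr ''deg'' (IReg x)) (Const 0))
     (IStore ''vs'' (IReg ''nv'') (IReg x) ;; ISet ''nv'' (IReg ''nv'' +\<^sub>i Const 1) ;; RSet ''z'' RZero ;;
      push ''deg'' ''adj'' ''awt'' x x ''z'') Skip"

lemma writes_touch [simp]: "writes (touch x) = {''vs'', ''nv'', ''z'', ''deg'', ''adj'', ''awt''}"
  by (auto simp: touch_def)

abbreviation adj_lists :: "nat \<Rightarrow> state \<Rightarrow> (nat \<times> nat \<times> real) set \<Rightarrow> bool" where
  "adj_lists n s F \<equiv> sorted_lists n (iarr s ''vs'') (ireg s ''nv'') (iarr s ''deg'') (iarr s ''adj'')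
      (rarr s ''awt'') F"

definition load :: com where
  "load = ISet ''pi'' (IReg ''i'') ;; ISet ''pv'' (IReg ''i'' +\<^sub>i Const 1) ;;
     RSet ''pk'' (RArr ''wt'' (IReg ''i'')) ;; upd"

definition drain :: com where
  "drain = ISet ''x'' (IArr ''tr'' (Const 1) -\<^sub>i Const 1) ;; ISet ''a'' (IArr ''src'' (IReg ''x'')) ;;
     ISet ''b'' (IArr ''tgt'' (IReg ''x'')) ;; RSet ''c'' (RArr ''wt'' (IReg ''x'')) ;;
     touch ''a'' ;; touch ''b'' ;;
     push ''deg'' ''adj'' ''awt'' ''a'' ''b'' ''c'' ;; push ''deg'' ''adj'' ''awt'' ''b'' ''a'' ''c'' ;;
     ISet ''pi'' (IReg ''x'') ;; ISet ''pv'' (Const 0) ;; RSet ''pk'' (RReg ''c'') ;; upd"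

lemma writes_load [simp]: "writes load = {''pi'', ''pv'', ''pk''} \<union> writes upd"
  and writes_drain [simp]: "writes drain = {''x'', ''a'', ''b'', ''c'', ''vs'', ''nv'', ''z'', ''deg'',
      ''adj'', ''awt'',
    ''pi'', ''pv'', ''pk''} \<union> writes upd"
  by (auto simp: load_def drain_def)

text \<open>One heap sort of the edges sorts all adjacency lists at once, since every edge is
  appended to the lists of its two ends in order of weight. It leaves the queue empty, ready for
  Dijkstra's algorithm.\<close>

definition sort :: com where
  "sort = For ''i'' ''m'' load ;; For ''i'' ''m'' drain"

lemma writes_sort [simp]: "writes sort = {''i''} \<union> writes load \<union> writes drain"
  by (auto simp: sort_def)

context machine
begin

lemma push_spec:
  assumes "cnt \<noteq> tg" "iarr s cnt (ireg s x) + 1 < M" "ireg s ''n'' = n"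
  shows "wp (push cnt tg wg x y z) s (\<lambda>t s'. t \<le> 30 \<and>
    iarr s' cnt = (iarr s cnt)(ireg s x := iarr s cnt (ireg s x) + 1) \<and>
    iarr s' tg = (iarr s tg)(ireg s x * n + iarr s cnt (ireg s x) := ireg s y) \<and>
    rarr s' wg = (rarr s wg)(ireg s x * n + iarr s cnt (ireg s x) := rreg s z))"
proof (rule wp_fit)
  assume "fit M s"
  note fit = fitD[OF this]
  show ?thesis
    unfolding push_def by (intro wp_intros) (use fit assms in auto)
qed

lemma touch_spec:
  assumes l: "adj_lists n s F" and n: "ireg s ''n'' = n" "n < M" and x: "ireg s x < n" "x \<noteq> ''nv''" "x \<noteq>
      ''z''"
  shows "wp (touch x) s (\<lambda>t s'. t \<le> 60 \<and> adj_lists n s' (insert (ireg s x, ireg s x, 0) F))"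
proof (cases "iarr s ''deg'' (ireg s x) = 0")
  case True
  note new = sorted_lists_new[OF l x(1) True]
  let ?s = "rset ''z'' 0 (iset ''nv'' (ireg s ''nv'' + 1) (iput ''vs'' (ireg s ''nv'') (ireg s x) s))"
  have p: "wp (push ''deg'' ''adj'' ''awt'' x x ''z'') ?s
     (\<lambda>t s'. t \<le> 30 \<and> adj_lists n s' (insert (ireg s x, ireg s x, 0) F))"
    apply (rule wp_weaken[OF push_spec[where n = n]])
    using n x True four_le_M apply simp_all[3]
    subgoal premises p for t s'
      using n x True new p sameD(3)[OF p(2), of "''vs''"] sameD(1)[OF p(2), of "''nv''"] by simp
    done
  show ?thesis unfolding touch_def
    apply (rule wp_fit, intro wp_intros; (simp add: True fitD)?)
    using new(1) n apply simp
    by (rule wp_weaken[OF p[simplified]]) auto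
next
  case False
  have "(ireg s x, ireg s x, 0) \<in> F"
    using l arc_lists_arc[of n "{..<n}" "iarr s ''deg''" "iarr s ''adj''" "rarr s ''awt''" F "ireg s x"
        0] False x
    by (auto simp: sorted_lists_def)
  then show ?thesis unfolding touch_def using False l
    by (intro wp_intros) (auto simp: insert_absorb)
qed

lemma push_sorted_spec:
  assumes l: "adj_lists n s F" and n: "ireg s ''n'' = n" "n < M" and x: "ireg s x < n" "ireg s y < n"
    and d: "(ireg s x, b, c) \<in> F" and new: "\<And>c. (ireg s x, ireg s y, c) \<notin> F"
    and le: "\<And>b c. (ireg s x, b, c) \<in> F \<Longrightarrow> c \<le> rreg s z"
  shows "wp (push ''deg'' ''adj'' ''awt'' x y z) s (\<lambda>t s'. t \<le> 30 \<and>
    adj_lists n s' (insert (ireg s x, ireg s y, rreg s z) F))"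
proof -
  have l': "arc_lists n {..<n} (iarr s ''deg'') (iarr s ''adj'') (rarr s ''awt'') F"
    using l by (simp add: sorted_lists_def)
  have nz: "iarr s ''deg'' (ireg s x) \<noteq> 0" using arc_lists_find[OF l' d] by auto
  have lt: "iarr s ''deg'' (ireg s x) < n" using arc_lists_push(1)[OF l' _ x(2) new] x by simp
  note p = sorted_lists_push[OF l x(1) nz x(2) new le]
  show ?thesis
    apply (rule wp_weaken[OF push_spec[where n = n]])
    using n lt apply simp_all[3]
    subgoal premises pr for t s'
      using pr p sameD(3)[OF pr(2), of "''vs''"] sameD(1)[OF pr(2), of "''nv''"] by simp
    done
qed

end

text \<open>The single tournament tree has capacity \<open>n * n\<close>: it holds edges while
  sorting and vertices later. \<open>L\<close> bounds its height and, up to one, the number of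
  phases of the greedy choice.\<close>

locale input_graph = machine +
  fixes n m k L :: nat and src tgt :: "nat \<Rightarrow> nat" and wt :: "nat \<Rightarrow> real"
  assumes n_pos: "0 < n" and n_M: "n ^ 3 + 4 \<le> M" and m_le: "m \<le> n * n" and n_L: "n * n \<le> 2 ^ L"
    and src_less: "\<And>i. i < m \<Longrightarrow> src i < n" and tgt_less: "\<And>i. i < m \<Longrightarrow> tgt i < n"
    and src_neq_tgt: "\<And>i. i < m \<Longrightarrow> src i \<noteq> tgt i"
    and edge_inj: "\<And>i j. i < m \<Longrightarrow> j < m \<Longrightarrow> {src i, tgt i} = {src j, tgt j} \<Longrightarrow> i = j"
    and wt_nonneg: "\<And>i. i < m \<Longrightarrow> 0 \<le> wt i"
begin

definition arc :: "nat \<Rightarrow> nat \<Rightarrow> real \<Rightarrow> bool" where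
  "arc a b c \<longleftrightarrow> (\<exists>i<m. c = wt i \<and> (a = src i \<and> b = tgt i \<or> a = tgt i \<and> b = src i))"

text \<open>The contents of all lists once the edges numbered by \<open>X\<close> are drained; the
  arcs \<open>(a, a, 0)\<close> are the heads.\<close>

definition part :: "nat set \<Rightarrow> (nat \<times> nat \<times> real) set" where
  "part X = {(a, b, c). \<exists>i\<in>X. c = wt i \<and> (a = src i \<and> b = tgt i \<or> a = tgt i \<and> b = src i)} \<union>
     (\<lambda>a. (a, a, 0)) ` (src ` X \<union> tgt ` X)"

definition input :: "state \<Rightarrow> bool" where
  "input s \<longleftrightarrow> ireg s ''n'' = n \<and> ireg s ''m'' = m \<and> ireg s ''k'' = k \<and> ireg s ''N'' = n * n \<and>
     iarr s ''src'' = src \<and> iarr s ''tgt'' = tgt \<and> rarr s ''wt'' = wt"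

lemma input_same:
  "same W s s' \<Longrightarrow> W \<inter> {''n'', ''m'', ''k'', ''N'', ''src'', ''tgt'', ''wt''} = {} \<Longrightarrow> input s \<Longrightarrow> input s'"
  unfolding input_def same_def by auto

lemma n_less_M: "n < M" and nn_less_M: "n * n + 1 < M"
proof -
  have "n * n \<le> n ^ 3" using n_pos by (auto simp: power3_eq_cube)
  moreover have "n \<le> n * n" by simp
  ultimately show "n < M" "n * n + 1 < M" using n_M by linarith+
qed

abbreviation keys :: "state \<Rightarrow> bool" where
  "keys s \<equiv> \<forall>i<m. rarr s ''key'' (i + 1) = wt i"

lemma load_spec:
  assumes s: "input s" "pq (n * n) (iarr s ''tr'') (rarr s ''key'') {..<j}" "ireg s ''i'' = j" "j < m"
    "\<forall>i<j. rarr s ''key'' (i + 1) = wt i"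
  shows "wp load s (\<lambda>t s'. t \<le> 50 * L + 60 \<and> pq (n * n) (iarr s' ''tr'') (rarr s' ''key'') {..<Suc j} \<and>
    (\<forall>i<Suc j. rarr s' ''key'' (i + 1) = wt i))"
proof -
  let ?s = "rset ''pk'' (wt j) (iset ''pv'' (j + 1) (iset ''pi'' j s))"
  have "wp upd ?s (\<lambda>t s'. t \<le> 50 * L + 50 \<and> pq (n * n) (iarr s' ''tr'') (rarr s' ''key'') {..<Suc j} \<and>
    (\<forall>i<Suc j. rarr s' ''key'' (i + 1) = wt i))"
    apply (rule wp_weaken[OF upd_spec[where N = "n * n" and L = L and Q = "{..<j}"]])
    using s m_le n_L by (auto simp: input_def lessThan_Suc less_Suc_eq)
  then show ?thesis
    unfolding load_def
    apply (intro wp_intros; simp)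
    using s nn_less_M m_le apply (auto simp: input_def)[2]
    using s by (auto simp: input_def elim!: wp_weaken)
qed

lemma part_insert:
  "part (insert i X) = insert (tgt i, src i, wt i) (insert (src i, tgt i, wt i)
     (insert (tgt i, tgt i, 0) (insert (src i, src i, 0) (part X))))"
  by (auto simp: part_def)

lemma part_weight: "(a, b, c) \<in> part X \<Longrightarrow> X \<subseteq> {..<m} \<Longrightarrow> \<forall>i\<in>X. wt i \<le> w \<Longrightarrow> 0 \<le> w \<Longrightarrow> c \<le> w"
  by (auto simp: part_def)

text \<open>Each unordered pair occurs once in the edge list and no edge is a loop, so neither a
  drained edge nor a head joins the ends of edge \<open>i\<close>.\<close>

lemma part_new:
  assumes "i < m" "X \<subseteq> {..<m}" "i \<notin> X"
  shows "(src i, tgt i, c) \<notin> part X" "(tgt i, src i, c) \<notin> part X"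
proof -
  have "(a, b, c) \<notin> part X" if ab: "{a, b} = {src i, tgt i}" for a b
  proof
    assume "(a, b, c) \<in> part X"
    then consider j where "j \<in> X" "{a, b} = {src j, tgt j}" | "a = b"
      unfolding part_def by (auto simp: insert_commute)
    then show False
    proof cases
      case 1
      then show False using edge_inj[of i j] assms ab by auto
    next
      case 2
      then show False using src_neq_tgt[OF assms(1)] ab by (metis doubleton_eq_iff)
    qed
  qed
  then show "(src i, tgt i, c) \<notin> part X" "(tgt i, src i, c) \<notin> part X" by (auto simp: insert_commute)
qed

lemma drain_spec:
  assumes s: "input s" "pq (n * n) (iarr s ''tr'') (rarr s ''key'') ({..<m} - X)" "keys s"
    and X: "X \<subseteq> {..<m}" "card X = j" "j < m" "\<forall>x\<in>X. \<forall>y\<in>{..<m} - X. wt x \<le> wt y"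
    and l: "adj_lists n s (part X)"
  shows "wp drain s (\<lambda>t s'. t \<le> 50 * L + 300 \<and>
      (\<exists>X. pq (n * n) (iarr s' ''tr'') (rarr s' ''key'') ({..<m} - X) \<and>
    keys s' \<and> X \<subseteq> {..<m} \<and> card X = Suc j \<and> (\<forall>x\<in>X. \<forall>y\<in>{..<m} - X. wt x \<le> wt y) \<and> adj_lists n s' (part X)))"
proof (rule wp_fit)
  assume "fit M s"
  note fit = fitD[OF this]
  define x where "x = iarr s ''tr'' 1 - 1"
  have root: "iarr s ''tr'' 1 \<noteq> 0"
  proof
    assume "iarr s ''tr'' 1 = 0"
    then have "{..<m} \<subseteq> X" using pq_empty[OF s(2)] by auto
    then show False using X card_mono[of X "{..<m}"] finite_subset[OF X(1)] by (metis card_lessThan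
        finite_lessThan subset_antisym nat_neq_iff)
  qed
  have x: "x < m" "x \<notin> X" "iarr s ''tr'' 1 = x + 1" and le: "\<And>y. y \<in> {..<m} - X \<Longrightarrow> wt x \<le> wt y"
    using pq_min[OF s(2) _ root] n_pos root s(3) by (auto simp: x_def)
  note v = src_less[OF x(1)] tgt_less[OF x(1)] src_neq_tgt[OF x(1)]
  note new = part_new[OF x(1) X(1) x(2)]
  let ?s1 = "rset ''c'' (wt x) (iset ''b'' (tgt x) (iset ''a'' (src x) (iset ''x'' x s)))"
  let ?F1 = "insert (src x, src x, 0) (part X)"
  let ?F2 = "insert (tgt x, tgt x, 0) ?F1"
  let ?F3 = "insert (src x, tgt x, wt x) ?F2"
  let ?F4 = "insert (tgt x, src x, wt x) ?F3"
  let ?r = "\<lambda>s'. ireg s' ''a'' = src x \<and> ireg s' ''b'' = tgt x \<and> rreg s' ''c'' = wt x \<and> ireg s' ''x'' = x \<and>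
     ireg s' ''n'' = n \<and> ireg s' ''N'' = n * n \<and> iarr s' ''tr'' = iarr s ''tr'' \<and>
         rarr s' ''key'' = rarr s ''key''"
  have F4: "?F4 = part (insert x X)" by (simp add: part_insert)
  \<comment> \<open>Drained edges are no heavier than the minimum \<open>x\<close>, and heads have
    weight 0. Appending edge \<open>x\<close> therefore keeps both lists sorted.\<close>
  have wle: "0 \<le> wt x" "\<And>a b c. (a, b, c) \<in> part X \<Longrightarrow> c \<le> wt x"
    using part_weight[of _ _ _ X "wt x"] X x wt_nonneg[OF x(1)] by auto
  have t1: "wp (touch ''a'') ?s1 (\<lambda>t s'. t \<le> 60 \<and> adj_lists n s' ?F1 \<and> ?r s')"
    apply (rule wp_weaken[OF touch_spec[where n = n and F = "part X"]])
    using l s(1) v n_less_M by (auto simp: input_def sameD)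
  have t2: "wp (touch ''b'') s' (\<lambda>t s'. t \<le> 60 \<and> adj_lists n s' ?F2 \<and> ?r s')"
    if "adj_lists n s' ?F1 \<and> ?r s'" for s'
    apply (rule wp_weaken[OF touch_spec[where n = n and F = ?F1]])
    using that v n_less_M by (auto simp: sameD)
  have t3: "wp (push ''deg'' ''adj'' ''awt'' ''a'' ''b'' ''c'') s' (\<lambda>t s'. t \<le> 30 \<and> adj_lists n s' ?F3 \<and>
      ?r s')"
    if h: "adj_lists n s' ?F2 \<and> ?r s'" for s'
    apply (rule wp_weaken[OF push_sorted_spec[where n = n and F = ?F2 and b = "src x" and c = 0]])
    using h v n_less_M new wle by (auto simp: sameD)
  have t4: "wp (push ''deg'' ''adj'' ''awt'' ''b'' ''a'' ''c'') s' (\<lambda>t s'. t \<le> 30 \<and> adj_lists n s' ?F4 \<and>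
      ?r s')"
    if h: "adj_lists n s' ?F3 \<and> ?r s'" for s'
    apply (rule wp_weaken[OF push_sorted_spec[where n = n and F = ?F3 and b = "tgt x" and c = 0]])
    using h v n_less_M new wle by (auto simp: sameD)
  let ?Q = "{..<m} - insert x X"
  have t5: "wp upd (rset ''pk'' (wt x) (iset ''pv'' 0 (iset ''pi'' x s'))) (\<lambda>t s'. t \<le> 50 * L + 50 \<and>
      pq (n * n) (iarr s' ''tr'') (rarr s' ''key'') ?Q \<and> adj_lists n s' ?F4 \<and> keys s')"
    if h: "adj_lists n s' ?F4 \<and> ?r s'" for s'
  proof -
    have "{..<m} - X - {x} = ?Q" by auto
    then show ?thesis
      apply (intro wp_weaken[OF upd_spec[where N = "n * n" and L = L and Q = "{..<m} - X"]])
      using h n_L x m_le s(2,3) by (auto simp: sameD)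
  qed
  have inv: "insert x X \<subseteq> {..<m}" "card (insert x X) = Suc j"
    "\<forall>a\<in>insert x X. \<forall>b\<in>{..<m} - insert x X. wt a \<le> wt b"
    using X x le finite_subset[OF X(1)] by auto
  note t = wp_weaken[OF t1] wp_weaken[OF t2] wp_weaken[OF t3] wp_weaken[OF t4] wp_weaken[OF t5]
  have trM: "iarr s ''tr'' (Suc 0) - Suc 0 = x" by (simp add: x_def)
  have xM: "x < M" using x(1) m_le nn_less_M by simp
  have in_s: "iarr s ''src'' = src" "iarr s ''tgt'' = tgt" "rarr s ''wt'' = wt" using s(1) by (auto simp:
      input_def)
  show ?thesis
    unfolding drain_def
    apply (intro wp_intros; (simp add: trM xM in_s)?)
    using v n_less_M apply simp_all[2]
    apply (rule t(1), intro wp_intros, rule t(2), blast, intro wp_intros, rule t(3), blast)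
    apply (intro wp_intros, rule t(4), blast)
    apply (intro wp_intros; (simp add: xM)?)
    using four_le_M apply simp
    apply (rule t(5), blast, elim conjE)
    apply (intro conjI exI[of _ "insert x X"])
    using inv F4 by simp_all
qed

lemma input_iset [simp]: "x \<notin> {''n'', ''m'', ''k'', ''N''} \<Longrightarrow> input (iset x v s) \<longleftrightarrow> input s"
  by (auto simp: input_def)

lemma load_all_spec:
  assumes s: "input s" "iarr s ''tr'' = (\<lambda>_. 0)"
  shows "wp (For ''i'' ''m'' load) s (\<lambda>t s'. t \<le> m * (50 * L + 68) + 6 \<and>
    pq (n * n) (iarr s' ''tr'') (rarr s' ''key'') {..<m} \<and> keys s')"
proof (rule wp_For[where N = m and T = "50 * L + 60" and
      I = "\<lambda>j s. input s \<and> pq (n * n) (iarr s ''tr'') (rarr s ''key'') {..<j} \<and>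
          (\<forall>i<j. rarr s ''key'' (i + 1) = wt i)"], goal_cases)
  case 5
  show ?case using s by (auto simp: tournament_def pick_def)
next
  case (6 j s')
  have "input s''" if "same (writes load) s' s''" for s'' using input_same[OF that] 6 by simp
  then show ?case
    using 6 by (intro wp_weaken[OF load_spec[of s' j]]) simp_all
qed (use s in \<open>simp_all add: input_def add.commute\<close>)

lemma drain_all_spec:
  assumes s: "input s" "pq (n * n) (iarr s ''tr'') (rarr s ''key'') {..<m}" "keys s"
    "iarr s ''deg'' = (\<lambda>_. 0)" "ireg s ''nv'' = 0"
  shows "wp (For ''i'' ''m'' drain) s (\<lambda>t s'. t \<le> m * (50 * L + 308) + 6 \<and> adj_lists n s' (part {..<m}) \<and>
    pq (n * n) (iarr s' ''tr'') (rarr s' ''key'') {})"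
proof (rule wp_For[where N = m and T = "50 * L + 300" and
      I = "\<lambda>j s. input s \<and> (\<exists>X. pq (n * n) (iarr s ''tr'') (rarr s ''key'') ({..<m} - X) \<and>
    keys s \<and> X \<subseteq> {..<m} \<and> card X = j \<and> (\<forall>x\<in>X. \<forall>y\<in>{..<m} - X. wt x \<le> wt y) \<and> adj_lists n s (part X))"],
        goal_cases)
  case 5
  have "arc_lists n {..<n} (iarr s ''deg'') (iarr s ''adj'') (rarr s ''awt'') {}"
    using s by (auto simp: arc_lists_def bij_betw_def)
  moreover have "part {} = {}" by (simp add: part_def)
  ultimately have "adj_lists n s (part {})"
    using s by (auto simp: sorted_lists_def)
  then show ?case using s by (auto intro!: exI[of _ "{}"])
next
  case (6 j s')
  then obtain X where X: "input s'" "pq (n * n) (iarr s' ''tr'') (rarr s' ''key'') ({..<m} - X)" "keys s'"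
      "X \<subseteq> {..<m}" "card X = j" "j < m" "\<forall>x\<in>X. \<forall>y\<in>{..<m} - X. wt x \<le> wt y" "adj_lists n s' (part X)" by blast
  have "input s''" if "same (writes drain) s' s''" for s'' using input_same[OF that] X(1) by simp
  then show ?case
    by (intro wp_weaken[OF drain_spec[OF X]]) simp
next
  case (7 s' t)
  then obtain X where "X \<subseteq> {..<m}" "card X = m" "adj_lists n s' (part X)"
    "pq (n * n) (iarr s' ''tr'') (rarr s' ''key'') ({..<m} - X)" by blast
  moreover from this have "X = {..<m}" using card_subset_eq[of "{..<m}" X] by simp
  ultimately show ?case using 7(2) by (simp add: add.commute)
qed (use s in \<open>auto simp: input_def\<close>)

lemma sort_spec:
  assumes s: "input s" "iarr s ''tr'' = (\<lambda>_. 0)" "iarr s ''deg'' = (\<lambda>_. 0)" "ireg s ''nv'' = 0"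
  shows "wp sort s (\<lambda>t s'. t \<le> m * (100 * L + 376) + 12 \<and> input s' \<and> adj_lists n s' (part {..<m}) \<and>
    pq (n * n) (iarr s' ''tr'') (rarr s' ''key'') {})"
  unfolding sort_def
proof (rule wp_Seq, rule wp_weaken[OF load_all_spec[OF s(1,2)]], goal_cases)
  case (1 t s')
  have s': "input s'" "iarr s' ''deg'' = (\<lambda>_. 0)" "ireg s' ''nv'' = 0"
    using input_same[OF 1(2)] sameD[OF 1(2)] s by auto
  show ?case
  proof (rule wp_weaken[OF drain_all_spec], goal_cases)
    case (6 t' s'')
    then show ?case using 1(3) input_same[OF 6(2)] s'(1) by (simp add: algebra_simps)
  qed (use s' 1(3) in auto)
qed

end

section \<open>Arcs to near neighbours\<close>

definition insert_near :: com where
  "insert_near = ISet ''a'' (IArr ''adj'' (IReg ''b'' *\<^sub>i IReg ''n'' +\<^sub>i IReg ''p'')) ;;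
     RSet ''c'' (RArr ''awt'' (IReg ''b'' *\<^sub>i IReg ''n'' +\<^sub>i IReg ''p'')) ;;
     push ''oc'' ''oa'' ''ow'' ''a'' ''b'' ''c''"

definition insert_row :: com where
  "insert_row = ISet ''b'' (IArr ''vs'' (IReg ''i'')) ;;
     Cond (ILess (IReg ''s'') (IArr ''deg'' (IReg ''b''))) (ISet ''h'' (IReg ''s''))
       (ISet ''h'' (IArr ''deg'' (IReg ''b''))) ;;
     For ''p'' ''h'' insert_near"

definition clear_near :: com where
  "clear_near = IStore ''oc'' (IArr ''vs'' (IReg ''i'')) (Const 0)"

text \<open>The rows are transposed: the near neighbours of \<open>b\<close> are a prefix of row
  \<open>b\<close>, but the hitting counts and Dijkstra's algorithm scan the arcs that leave
  \<open>a\<close>. Resetting the counters suffices to discard the lists of an earlier call.\<close>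

definition build :: com where
  "build = For ''i'' ''nv'' clear_near ;; For ''i'' ''nv'' insert_row"

lemma writes_insert_near [simp]: "writes insert_near = {''a'', ''c'', ''oc'', ''oa'', ''ow''}"
  and writes_insert_row [simp]: "writes insert_row = {''b'', ''h'', ''p'', ''a'', ''c'', ''oc'', ''oa'',
      ''ow''}"
  and writes_clear_near [simp]: "writes clear_near = {''oc''}"
  and writes_build [simp]: "writes build = {''i'', ''b'', ''h'', ''p'', ''a'', ''c'', ''oc'', ''oa'', ''ow''}"
  by (auto simp: insert_near_def insert_row_def clear_near_def build_def)

text \<open>The arrays left by sorting become parameters; the programs below do not write them, so
  that one predicate \<open>adjacent\<close> transports them between states.\<close>

locale adjacency = input_graph +
  fixes nv :: nat and vs dg ad :: "nat \<Rightarrow> nat" and aw :: "nat \<Rightarrow> real"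
  assumes sorted: "sorted_lists n vs nv dg ad aw (part {..<m})"
begin

definition V :: "nat set" where
  "V = vs ` {..<nv}"

lemma adj: "arc_lists n {..<n} dg ad aw (part {..<m})"
  using sorted by (simp add: sorted_lists_def)

lemma V_eq: "V = {a. a < n \<and> dg a \<noteq> 0}" and inj_vs: "inj_on vs {..<nv}"
  using sorted by (simp_all add: sorted_lists_def V_def)

lemma V_less: "a \<in> V \<Longrightarrow> a < n"
  by (simp add: V_eq)

lemma vs_V [simp]: "i < nv \<Longrightarrow> vs i \<in> V"
  by (simp add: V_def)

lemma finite_V [simp]: "finite V"
  by (simp add: V_def)

lemma card_V: "card V = nv"
  unfolding V_def using card_image[OF inj_vs] by simp

lemma nv_le: "nv \<le> n"
  using card_mono[of "{..<n}" V] V_less card_V by (auto simp: subset_iff)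

lemma arc_part: "(a, b, c) \<in> part {..<m} \<longleftrightarrow> arc a b c \<or> a = b \<and> c = 0 \<and> (a \<in> src ` {..<m} \<or> a \<in> tgt ` {..<m})"
  by (auto simp: part_def arc_def)

lemma arc_sym: "arc a b c \<Longrightarrow> arc b a c"
  by (auto simp: arc_def)

lemma arc_neq: "arc a b c \<Longrightarrow> a \<noteq> b"
  using src_neq_tgt by (auto simp: arc_def) metis

lemma arc_nonneg: "arc a b c \<Longrightarrow> 0 \<le> c"
  using wt_nonneg by (auto simp: arc_def)

lemma part_V: "(a, b, c) \<in> part {..<m} \<Longrightarrow> a \<in> V"
  using arc_lists_find[OF adj, of a b c] adj unfolding arc_lists_def V_eq by fastforce

lemma arc_V: assumes "arc a b c" shows "a \<in> V" "b \<in> V"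
  using part_V arc_part assms arc_sym[OF assms] by blast+

lemma V_ends: "V = src ` {..<m} \<union> tgt ` {..<m}"
proof
  show "V \<subseteq> src ` {..<m} \<union> tgt ` {..<m}"
  proof
    fix a assume "a \<in> V"
    then have "(a, ad (a * n + 0), aw (a * n + 0)) \<in> part {..<m}"
      using arc_lists_arc[OF adj, of a 0] by (simp add: V_eq)
    then show "a \<in> src ` {..<m} \<union> tgt ` {..<m}" by (auto simp: part_def)
  qed
  show "src ` {..<m} \<union> tgt ` {..<m} \<subseteq> V"
  proof
    fix a assume "a \<in> src ` {..<m} \<union> tgt ` {..<m}"
    then have "(a, a, 0) \<in> part {..<m}" by (auto simp: arc_part)
    then show "a \<in> V" by (rule part_V)
  qed
qed

lemma nv_le_m: "nv \<le> 2 * m"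
proof -
  have "card V \<le> card (src ` {..<m}) + card (tgt ` {..<m})"
    unfolding V_ends by (rule card_Un_le)
  also have "\<dots> \<le> m + m"
    using card_image_le[of "{..<m}" src] card_image_le[of "{..<m}" tgt] by (intro add_mono) auto
  finally show ?thesis by (simp add: card_V)
qed

lemma dg_le: "a < n \<Longrightarrow> dg a \<le> n"
  using arc_lists_count[OF adj] by simp

lemma dg_pos: "a \<in> V \<Longrightarrow> 0 < dg a"
  by (simp add: V_eq)

lemma self: "a \<in> V \<Longrightarrow> ad (a * n) = a" "a \<in> V \<Longrightarrow> aw (a * n) = 0"
  using sorted by (simp_all add: sorted_lists_def V_eq)

lemma ad_inj: "a \<in> V \<Longrightarrow> inj_on (\<lambda>p. ad (a * n + p)) {..<dg a}"
  using arc_lists_inj[OF adj, of a] V_less by simp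

lemma ad_eq: "a \<in> V \<Longrightarrow> p < dg a \<Longrightarrow> q < dg a \<Longrightarrow> ad (a * n + p) = ad (a * n + q) \<longleftrightarrow> p = q"
  using inj_on_eq_iff[OF ad_inj, of a p q] by simp

lemma aw_mono: "a \<in> V \<Longrightarrow> p \<le> q \<Longrightarrow> q < dg a \<Longrightarrow> aw (a * n + p) \<le> aw (a * n + q)"
  using sorted V_less by (simp add: sorted_lists_def)

lemma ad_arc:
  assumes "a \<in> V" "p < dg a"
  shows "arc a (ad (a * n + p)) (aw (a * n + p)) \<or> ad (a * n + p) = a \<and> aw (a * n + p) = 0"
  using arc_lists_arc[OF adj, of a p] assms V_less by (auto simp: arc_part)

lemma ad_V: "a \<in> V \<Longrightarrow> p < dg a \<Longrightarrow> ad (a * n + p) \<in> V"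
  using ad_arc[of a p] arc_V by metis

lemma ad_find: "arc a b c \<Longrightarrow> \<exists>p<dg a. ad (a * n + p) = b \<and> aw (a * n + p) = c"
  using arc_lists_find[OF adj, of a b c] by (simp add: arc_part)

lemma finite_part: "finite (part {..<m})"
proof -
  have "part {..<m} \<subseteq> (\<lambda>i. (src i, tgt i, wt i)) ` {..<m} \<union> (\<lambda>i. (tgt i, src i,
      wt i)) ` {..<m} \<union> (\<lambda>a. (a, a, 0)) ` V"
    by (auto simp: part_def V_ends)
  then show ?thesis by (rule finite_subset) simp
qed

text \<open>Two entries per edge, and one head for each of the at most \<open>2 * m\<close>
  non-isolated vertices.\<close>

lemma sum_dg: "(\<Sum>a\<in>V. dg a) \<le> 4 * m"
proof -
  let ?P = "(\<lambda>i. (src i, tgt i, wt i)) ` {..<m}" and ?Q = "(\<lambda>i. (tgt i, src i, wt i)) ` {..<m}"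
    and ?R = "(\<lambda>a. (a, a, 0::real)) ` V"
  have "(\<Sum>a\<in>V. dg a) = (\<Sum>a\<in>V. card {x \<in> part {..<m}. fst x = a})"
    using arc_lists_card[OF adj] V_less by (intro sum.cong) auto
  also have "\<dots> = card (\<Union>a\<in>V. {x \<in> part {..<m}. fst x = a})"
    using finite_part by (intro card_UN_disjoint[symmetric]) auto
  also have "\<dots> \<le> card (?P \<union> ?Q \<union> ?R)"
    by (intro card_mono) (auto simp: part_def V_ends)
  also have "\<dots> \<le> card (?P \<union> ?Q) + card ?R" by (rule card_Un_le)
  also have "\<dots> \<le> card ?P + card ?Q + card ?R" by (intro add_mono card_Un_le) auto
  also have "\<dots> \<le> m + m + nv"
    using card_image_le[of "{..<m}" "\<lambda>i. (src i, tgt i, wt i)"] card_image_le[of "{..<m}" "\<lambda>i. (tgt i,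
        src i, wt i)"]
      card_image_le[of V "\<lambda>a. (a, a, 0::real)"] card_V by (intro add_mono) auto
  also have "\<dots> \<le> 4 * m" using nv_le_m by simp
  finally show ?thesis .
qed

definition row :: "nat \<Rightarrow> nat \<Rightarrow> (nat \<times> nat \<times> real) set" where
  "row b h = (\<lambda>p. (ad (b * n + p), b, aw (b * n + p))) ` {..<h}"

text \<open>The arcs point into \<open>b\<close>, from its near neighbours; what is dropped is the
  tail of the sorted list of \<open>b\<close>. The set \<open>U\<close> grows with the rows that
  \<open>build\<close> has processed.\<close>

definition near :: "nat set \<Rightarrow> nat \<Rightarrow> (nat \<times> nat \<times> real) set" where
  "near U h = (\<Union>b\<in>U. row b (min h (dg b)))"

lemma near_iff: "(a, b, c) \<in> near U h \<longleftrightarrow> b \<in> U \<and> (\<exists>p<min h (dg b). ad (b * n + p) = a \<and> aw (b * n + p) = c)"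
  unfolding near_def row_def by (auto simp: image_iff) (metis lessThan_iff min_less_iff_conj)

lemma near_arc:
  assumes "(a, b, c) \<in> near V h" shows "a \<in> V" "b \<in> V" "arc a b c \<or> a = b \<and> c = 0"
  using assms ad_arc[of b] ad_V[of b] arc_sym unfolding near_iff by (auto, metis+)

lemma card_near: "card (near V h) = (\<Sum>b\<in>V. min h (dg b))"
proof -
  have "card (near V h) = (\<Sum>b\<in>V. card (row b (min h (dg b))))"
    unfolding near_def by (intro card_UN_disjoint) (auto simp: row_def)
  also have "\<dots> = (\<Sum>b\<in>V. min h (dg b))"
  proof (intro sum.cong refl)
    fix b assume "b \<in> V"
    then have "inj_on (\<lambda>p. (ad (b * n + p), b, aw (b * n + p))) {..<min h (dg b)}"
      using ad_inj unfolding inj_on_def by simp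
    from card_image[OF this] show "card (row b (min h (dg b))) = min h (dg b)" unfolding row_def by simp
  qed
  finally show ?thesis .
qed

text \<open>The second bound serves level 0, where \<open>h\<close> exceeds all degrees, and the
  sweeps over all lists; the first serves the later levels.\<close>

lemma card_near_le: "card (near V h) \<le> nv * h" "card (near V h) \<le> 4 * m"
proof -
  show "card (near V h) \<le> nv * h"
    using sum_bounded_above[of V "\<lambda>b. min h (dg b)" h] by (simp add: card_near card_V)
  have "card (near V h) \<le> (\<Sum>b\<in>V. dg b)" unfolding card_near by (intro sum_mono) simp
  then show "card (near V h) \<le> 4 * m" using sum_dg by simp
qed

lemma finite_near: "finite (near V h)"
  by (auto simp: near_def row_def)

definition adjacent :: "state \<Rightarrow> bool" where
  "adjacent s \<longleftrightarrow> input s \<and> ireg s ''nv'' = nv \<and> iarr s ''vs'' = vs \<and> iarr s ''deg'' = dg \<and>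
     iarr s ''adj'' = ad \<and> rarr s ''awt'' = aw"

lemma adjacent_same:
  "same W s s' \<Longrightarrow> W \<inter> {''n'', ''m'', ''k'', ''N'', ''src'', ''tgt'', ''wt'', ''nv'', ''vs'', ''deg'',
      ''adj'', ''awt''} = {} \<Longrightarrow>
   adjacent s \<Longrightarrow> adjacent s'"
  using input_same[of W s s'] unfolding adjacent_def same_def by auto

lemma adjacent_iset [simp]:
  "x \<notin> {''n'', ''m'', ''k'', ''N'', ''nv''} \<Longrightarrow> adjacent (iset x v s) \<longleftrightarrow> adjacent s"
  by (auto simp: adjacent_def)

lemma adjacent_rset [simp]: "adjacent (rset x r s) \<longleftrightarrow> adjacent s"
  by (auto simp: adjacent_def input_def)

lemma adjacentD:
  assumes "adjacent s"
  shows "ireg s ''n'' = n" "ireg s ''m'' = m" "ireg s ''k'' = k" "ireg s ''N'' = n * n" "ireg s ''nv'' = nv"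
    "iarr s ''vs'' = vs" "iarr s ''deg'' = dg" "iarr s ''adj'' = ad" "rarr s ''awt'' = aw" "input s"
  using assms by (auto simp: adjacent_def input_def)

abbreviation out_lists :: "state \<Rightarrow> (nat \<times> nat \<times> real) set \<Rightarrow> bool" where
  "out_lists s F \<equiv> arc_lists n V (iarr s ''oc'') (iarr s ''oa'') (rarr s ''ow'') F"

lemma sum_out:
  assumes "out_lists s (near V h)" shows "(\<Sum>a\<in>V. iarr s ''oc'' a) = card (near V h)"
proof -
  have "(\<Sum>a\<in>V. iarr s ''oc'' a) = (\<Sum>a\<in>V. card {x \<in> near V h. fst x = a})"
    using arc_lists_card[OF assms] by (intro sum.cong) auto
  also have "\<dots> = card (\<Union>a\<in>V. {x \<in> near V h. fst x = a})"
    using finite_near by (intro card_UN_disjoint[symmetric]) auto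
  also have "(\<Union>a\<in>V. {x \<in> near V h. fst x = a}) = near V h"
    using near_arc(1) by fastforce
  finally show ?thesis .
qed

lemma row_Suc: "row b (Suc p) = insert (ad (b * n + p), b, aw (b * n + p)) (row b p)"
  by (auto simp: row_def lessThan_Suc)

lemma insert_near_spec:
  assumes s: "adjacent s" "ireg s ''b'' = b" "ireg s ''p'' = p" and b: "b \<in> V" "p < dg b" "b \<notin> U"
    and o: "out_lists s (near U h \<union> row b p)"
  shows "wp insert_near s (\<lambda>t s'. t \<le> 60 \<and> out_lists s' (near U h \<union> row b (Suc p)))"
proof (rule wp_fit)
  assume "fit M s"
  note fit = fitD[OF this]
  note A = adjacentD[OF s(1)]
  let ?s = "rset ''c'' (aw (b * n + p)) (iset ''a'' (ad (b * n + p)) s)"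
  have "ad (b * n + p) \<noteq> ad (b * n + q)" if "q < p" for q
    using ad_eq[OF b(1), of p q] that b by simp
  then have new: "(ad (b * n + p), b, c) \<notin> near U h \<union> row b p" for c
    using b by (auto simp: near_iff row_def)
  note p = arc_lists_push[OF o ad_V[OF b(1,2)] V_less[OF b(1)] new]
  have "wp (push ''oc'' ''oa'' ''ow'' ''a'' ''b'' ''c'') ?s (\<lambda>t s'. t \<le> 30 \<and>
      out_lists s' (near U h \<union> row b (Suc p)))"
    by (rule wp_weaken[OF push_spec[where n = n]])
      (use s(2) A(1) p n_less_M in \<open>simp_all add: row_Suc\<close>)
  then show ?thesis
    unfolding insert_near_def
    apply (intro wp_intros; (simp add: A s)?)
    using fit(2)[of "''adj''" "b * n + p"] A apply simp
    by (erule wp_weaken) simp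
qed

lemma insert_row_spec:
  assumes s: "adjacent s" "ireg s ''i'' = i" "ireg s ''s'' = h" and i: "i < nv" and o: "out_lists s (near
      (vs ` {..<i}) h)"
  shows "wp insert_row s (\<lambda>t s'. t \<le> 80 * dg (vs i) + 30 \<and> out_lists s' (near (vs ` {..<Suc i}) h))"
proof (rule wp_fit)
  assume "fit M s"
  note fit = fitD[OF this]
  note A = adjacentD[OF s(1)]
  let ?b = "vs i" and ?h = "min h (dg (vs i))"
  have nb: "?b \<notin> vs ` {..<i}" using inj_on_eq_iff[OF inj_vs] i by auto
  have eq: "near (vs ` {..<Suc i}) h = near (vs ` {..<i}) h \<union> row ?b ?h"
    by (auto simp: near_def lessThan_Suc)
  have loop: "wp (For ''p'' ''h'' insert_near) (iset ''h'' ?h (iset ''b'' ?b s))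
      (\<lambda>t s'. t \<le> 68 * dg (vs i) + 6 \<and> out_lists s' (near (vs ` {..<Suc i}) h))"
  proof (rule wp_For[where N = "?h" and T = 60 and
        I = "\<lambda>j s. adjacent s \<and> ireg s ''b'' = ?b \<and> out_lists s (near (vs ` {..<i}) h \<union> row ?b j)"],
            goal_cases)
    case 5
    show ?case using s o by (simp add: row_def)
  next
    case (6 j s')
    have "adjacent s'' \<and> ireg s'' ''b'' = ?b" if "same (writes insert_near) s' s''" for s''
      using adjacent_same[OF that] sameD(1)[OF that, of "''b''"] 6 by simp
    with 6 i nb show ?case by (intro wp_weaken[OF insert_near_spec[where b = ?b]]) auto
  next
    case (7 s' t)
    then show ?case by (auto simp: eq)
  qed simp_all
  have M: "vs i < M" "dg (vs i) < M" "h < M"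
    using fit(2)[of "''vs''" i] fit(2)[of "''deg''" "vs i"] fit(1)[of "''s''"] A s by simp_all
  show ?thesis
    unfolding insert_row_def
    apply (intro wp_intros; (simp add: A s M)?)
    using loop by (auto simp: min_def not_less elim!: wp_weaken split: if_splits)
qed

lemma build_spec:
  assumes s: "adjacent s" "ireg s ''s'' = h"
  shows "wp build s (\<lambda>t s'. t \<le> 400 * m + 60 * nv + 20 \<and> out_lists s' (near V h) \<and> adjacent s')"
proof -
  have 1: "wp (For ''i'' ''nv'' clear_near) s (\<lambda>t s'. t \<le> 14 * nv + 6 \<and> (\<forall>a\<in>V. iarr s' ''oc'' a = 0))"
  proof (rule wp_For[where N = nv and T = 6 and I = "\<lambda>j s. iarr s ''vs'' = vs \<and>
      (\<forall>i<j. iarr s ''oc'' (vs i) = 0)"], goal_cases)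
    case (6 j s')
    then show ?case
      unfolding clear_near_def using four_le_M
      by (intro wp_intros) (auto simp: less_Suc_eq)
  next
    case (7 s' t)
    then show ?case by (auto simp: V_def)
  qed (use adjacentD[OF s(1)] in simp_all)
  have 2: "wp (For ''i'' ''nv'' insert_row) s' (\<lambda>t s'. t \<le> 320 * m + 40 * nv + 6 \<and> out_lists s' (near V h))"
    if s': "adjacent s'" "ireg s' ''s'' = h" "\<forall>a\<in>V. iarr s' ''oc'' a = 0" for s'
  proof (rule wp_For_sum[where N = nv and T = "\<lambda>i. 80 * dg (vs i) + 30" and
        I = "\<lambda>j s. adjacent s \<and> ireg s ''s'' = h \<and> out_lists s (near (vs ` {..<j}) h)"], goal_cases)
    case 5
    show ?case using s' by (auto simp: arc_lists_def near_def bij_betw_def)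
  next
    case (6 j s'')
    have "adjacent s''' \<and> ireg s''' ''s'' = h" if "same (writes insert_row) s'' s'''" for s'''
      using adjacent_same[OF that] sameD(1)[OF that, of "''s''"] 6 by simp
    with 6 show ?case by (intro wp_weaken[OF insert_row_spec]) auto
  next
    case (7 s'' t)
    have "(\<Sum>i<nv. 80 * dg (vs i) + 30) = 80 * (\<Sum>a\<in>V. dg a) + 30 * nv"
      unfolding V_def sum.reindex[OF inj_vs] by (simp add: sum.distrib sum_distrib_left)
    also have "\<dots> \<le> 320 * m + 30 * nv" using sum_dg by simp
    finally show ?case using 7 by (simp add: V_def)
  qed (use adjacentD[OF s'(1)] in simp_all)
  show ?thesis
    unfolding build_def
  proof (rule wp_Seq, rule wp_weaken[OF 1], goal_cases)
    case (1 t s')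
    have s': "adjacent s'" "ireg s' ''s'' = h" using adjacent_same[OF 1(2)] sameD(1)[OF 1(2),
        of "''s''"] s by auto
    show ?case
    proof (rule wp_weaken[OF 2[OF s']], goal_cases)
      case (2 t' s'')
      then show ?case using 1(3) adjacent_same[OF 2(2)] s' by auto
    qed (use 1 in simp)
  qed
qed

end

section \<open>Hitting sets\<close>

text \<open>A list shorter than \<open>s\<close> drops no entry, so that no detour into its vertex
  will be called for. The vertex becomes its own pivot and counts as hit. Pivots are stored plus
  one, with 0 for unhit.\<close>

definition init_hit :: com where
  "init_hit = ISet ''b'' (IArr ''vs'' (IReg ''i'')) ;;
     Cond (ILess (IArr ''deg'' (IReg ''b'')) (IReg ''s''))
       (IStore ''piv'' (IReg ''pb'' +\<^sub>i IReg ''b'') (IReg ''b'' +\<^sub>i Const 1) ;;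
        RStore ''pwt'' (IReg ''pb'' +\<^sub>i IReg ''b'') RZero) Skip"

definition mark :: com where
  "mark = ISet ''b'' (IArr ''oa'' (IReg ''a'' *\<^sub>i IReg ''n'' +\<^sub>i IReg ''p'')) ;;
     Cond (IEq (IArr ''piv'' (IReg ''pb'' +\<^sub>i IReg ''b'')) (Const 0))
       (IStore ''piv'' (IReg ''pb'' +\<^sub>i IReg ''b'') (IReg ''a'' +\<^sub>i Const 1) ;;
        RStore ''pwt'' (IReg ''pb'' +\<^sub>i IReg ''b'') (RArr ''ow'' (IReg ''a'' *\<^sub>i IReg ''n'' +\<^sub>i IReg
            ''p''))) Skip"

definition count :: com where
  "count = Cond (IEq (IArr ''piv'' (IReg ''pb'' +\<^sub>i IArr ''oa'' (IReg ''a'' *\<^sub>i IReg ''n'' +\<^sub>i IReg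
      ''p''))) (Const 0))
     (ISet ''x'' (IReg ''x'' +\<^sub>i Const 1)) Skip"

definition select :: com where
  "select = IStore ''D'' (IReg ''dn'') (IReg ''a'') ;; ISet ''dn'' (IReg ''dn'' +\<^sub>i Const 1) ;;
      For ''p'' ''g'' mark"

definition consider_vertex :: com where
  "consider_vertex = ISet ''a'' (IArr ''vs'' (IReg ''i'')) ;; ISet ''g'' (IArr ''oc'' (IReg ''a'')) ;;
      ISet ''x'' (Const 0) ;;
     For ''p'' ''g'' count ;; Cond (ILess (IReg ''x'') (IReg ''t'')) Skip select"

definition phase :: com where
  "phase = For ''i'' ''nv'' consider_vertex ;; ISet ''t'' (IReg ''t'' div\<^sub>i Const 2)"

text \<open>Thresholds replace the exact greedy maximum, up to a factor of two: each phase takes, in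
  one sweep, every vertex that hits at least \<open>t\<close> unhit ones, and then halves
  \<open>t\<close>.\<close>

definition hit :: com where
  "hit = For ''i'' ''nv'' init_hit ;; ISet ''dn'' (Const 0) ;; ISet ''t'' (IReg ''n'') ;;
     While (ILess (Const 0) (IReg ''t'')) phase"

lemma writes_init_hit [simp]: "writes init_hit = {''b'', ''piv'', ''pwt''}"
  and writes_mark [simp]: "writes mark = {''b'', ''piv'', ''pwt''}"
  and writes_count [simp]: "writes count = {''x''}"
  by (auto simp: init_hit_def mark_def count_def)

lemma writes_select [simp]: "writes select = {''b'', ''piv'', ''pwt'', ''D'', ''dn'', ''p''}"
  and writes_consider_vertex [simp]: "writes consider_vertex = {''a'', ''g'', ''x'', ''b'', ''piv'',
      ''pwt'', ''D'', ''dn'', ''p''}"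
  and writes_phase [simp]: "writes phase = {''i'', ''t'', ''a'', ''g'', ''x'', ''b'', ''piv'', ''pwt'',
      ''D'', ''dn'', ''p''}"
  and writes_hit [simp]: "writes hit = {''i'', ''t'', ''a'', ''g'', ''x'', ''b'', ''piv'', ''pwt'',
      ''D'', ''dn'', ''p''}"
  by (auto simp: select_def consider_vertex_def phase_def hit_def)

context adjacency
begin

lemma out_same:
  "same W s s' \<Longrightarrow> W \<inter> {''oc'', ''oa'', ''ow''} = {} \<Longrightarrow> out_lists s F \<Longrightarrow> out_lists s' F"
  using sameD[of W s s'] by simp

text \<open>What \<open>a\<close> would hit: the vertices that have \<open>a\<close> among their
  first \<open>h\<close> entries.\<close>

definition nbhd :: "nat \<Rightarrow> nat \<Rightarrow> nat set" where
  "nbhd h a = {b. \<exists>c. (a, b, c) \<in> near V h}"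

lemma nbhd_V: "nbhd h a \<subseteq> V"
  using near_arc(2) by (auto simp: nbhd_def)

lemma out_bij:
  assumes o: "out_lists s (near V h)" and a: "a \<in> V"
  shows "bij_betw (\<lambda>p. iarr s ''oa'' (a * n + p)) {..<iarr s ''oc'' a} (nbhd h a)"
  unfolding bij_betw_def
proof
  show "inj_on (\<lambda>p. iarr s ''oa'' (a * n + p)) {..<iarr s ''oc'' a}" by (rule arc_lists_inj[OF o a])
  show "(\<lambda>p. iarr s ''oa'' (a * n + p)) ` {..<iarr s ''oc'' a} = nbhd h a"
    using arc_lists_arc[OF o a] arc_lists_find[OF o,
        of a] unfolding nbhd_def by (auto simp: image_iff) (metis lessThan_iff)
qed

lemma self_nbhd: "b \<in> V \<Longrightarrow> 0 < h \<Longrightarrow> b \<in> nbhd h b"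
  using self[of b] dg_pos[of b] by (auto simp: nbhd_def near_iff intro!: exI[of _ 0])

text \<open>Pairs of a vertex \<open>b\<close> of \<open>U\<close> and a near neighbour
  \<open>a\<close> of it are counted from both sides; from \<open>b\<close> there are exactly
  \<open>h\<close>, as its list is full.\<close>

lemma double_count:
  assumes U: "U \<subseteq> V" and full: "\<forall>b\<in>U. h \<le> dg b"
  shows "card U * h = (\<Sum>a\<in>V. card (U \<inter> nbhd h a))"
proof -
  have "card {a \<in> V. b \<in> nbhd h a} = h" if b: "b \<in> U" for b
  proof -
    have bV: "b \<in> V" "min h (dg b) = h" using U full b by auto
    have "{a \<in> V. b \<in> nbhd h a} = (\<lambda>p. ad (b * n + p)) ` {..<h}"
      using ad_V[OF bV(1)] full b bV
      by (auto simp: nbhd_def near_iff image_iff) (metis order_less_le_trans)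
    moreover have "inj_on (\<lambda>p. ad (b * n + p)) {..<h}"
      using inj_on_subset[OF ad_inj[OF bV(1)]] full b by auto
    ultimately show ?thesis by (simp add: card_image)
  qed
  then have "(\<Sum>a\<in>V. card {b \<in> U. b \<in> nbhd h a}) = (\<Sum>b\<in>U. h)"
    by (intro sum_multicount_gen) (use finite_subset[OF U finite_V] in auto)
  then show ?thesis by (simp add: Int_def)
qed

definition unhit :: "nat \<Rightarrow> state \<Rightarrow> nat set" where
  "unhit pb s = {b \<in> V. iarr s ''piv'' (pb + b) = 0}"

text \<open>The second alternative is the short list. The last conjunct supplies the full lists that
  \<open>double_count\<close> asks for.\<close>

definition hits :: "nat \<Rightarrow> nat \<Rightarrow> nat set \<Rightarrow> state \<Rightarrow> bool" where
  "hits pb h D s \<longleftrightarrow> (\<forall>b\<in>V. iarr s ''piv'' (pb + b) \<noteq> 0 \<longrightarrow>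
     (iarr s ''piv'' (pb + b) - 1 \<in> D \<and> (iarr s ''piv'' (pb + b) - 1, b, rarr s ''pwt'' (pb + b)) \<in> near V h \<or>
      dg b < h \<and> iarr s ''piv'' (pb + b) = b + 1 \<and> rarr s ''pwt'' (pb + b) = 0)) \<and> unhit pb s \<subseteq> {b. h \<le> dg b}"

text \<open>Each level owns a block of \<open>n\<close> cells of \<open>piv\<close> and
  \<open>pwt\<close>. The pivots of the previous level are still read after the new ones have been
  chosen, so the choice has to stay within its block.\<close>

definition outside :: "nat \<Rightarrow> state \<Rightarrow> state \<Rightarrow> bool" where
  "outside pb s s' \<longleftrightarrow> (\<forall>i. i < pb \<or> pb + n \<le> i \<longrightarrow> iarr s' ''piv'' i = iarr s ''piv'' i \<and>
      rarr s' ''pwt'' i = rarr s ''pwt'' i)"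

lemma outside_refl [simp]: "outside pb s s"
  and outside_trans: "outside pb s s' \<Longrightarrow> outside pb s' s'' \<Longrightarrow> outside pb s s''"
  by (auto simp: outside_def)

lemma hit_iset [simp]:
  "unhit pb (iset x v s) = unhit pb s" "hits pb h D (iset x v s) \<longleftrightarrow> hits pb h D s"
  "outside pb s (iset x v s') \<longleftrightarrow> outside pb s s'" "outside pb (iset x v s) s' \<longleftrightarrow> outside pb s s'"
  by (simp_all add: unhit_def hits_def outside_def)

lemma finite_unhit [simp]: "finite (unhit pb s)"
  by (simp add: unhit_def)

lemma unhit_V: "unhit pb s \<subseteq> V"
  by (auto simp: unhit_def)

definition chosen :: "state \<Rightarrow> nat set" where
  "chosen s = iarr s ''D'' ` {..<ireg s ''dn''}"

lemma hits_mono: "hits pb h D s \<Longrightarrow> D \<subseteq> D' \<Longrightarrow> hits pb h D' s"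
  unfolding hits_def by blast

lemma init_hit_spec:
  assumes s: "adjacent s" "ireg s ''i'' = i" "ireg s ''s'' = h" "ireg s ''pb'' = pb" and i: "i < nv"
    and un: "\<forall>b<n. b \<notin> vs ` {..<i} \<longrightarrow> iarr s ''piv'' (pb + b) = 0"
    and ok: "\<forall>b\<in>vs ` {..<i}. if dg b < h then iarr s ''piv'' (pb + b) = b + 1 \<and>
        rarr s ''pwt'' (pb + b) = 0 else iarr s ''piv'' (pb + b) = 0"
  shows "wp init_hit s (\<lambda>t s'. t \<le> 40 \<and> outside pb s s' \<and> (\<forall>b<n. b \<notin> vs ` {..<Suc i} \<longrightarrow>
      iarr s' ''piv'' (pb + b) = 0) \<and>
    (\<forall>b\<in>vs ` {..<Suc i}. if dg b < h then iarr s' ''piv'' (pb + b) = b + 1 \<and>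
        rarr s' ''pwt'' (pb + b) = 0 else iarr s' ''piv'' (pb + b) = 0))"
proof (rule wp_fit)
  assume "fit M s"
  note A = adjacentD[OF s(1)]
  have b: "vs i < n" "Suc (vs i) < M" "vs i < M" using V_less[OF vs_V[OF i]] nn_less_M
      le_square[of n] by linarith+
  have nb: "vs i \<notin> vs ` {..<i}" using inj_on_eq_iff[OF inj_vs] i by auto
  have U: "vs ` {..<Suc i} = insert (vs i) (vs ` {..<i})" by (auto simp: lessThan_Suc)
  show ?thesis
    unfolding init_hit_def U
    apply (intro wp_intros; (simp add: A s b)?)
    using un ok b nb by (auto simp: outside_def)
qed

lemma mark_spec:
  assumes s: "adjacent s" "ireg s ''a'' = a" "ireg s ''p'' = p" "ireg s ''pb'' = pb" and a: "a \<in> V" "a \<in>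
      D" "p < iarr s ''oc'' a"
    and o: "out_lists s (near V h)" and h: "hits pb h D s"
  shows "wp mark s (\<lambda>t s'. t \<le> 50 \<and> outside pb s s' \<and> hits pb h D s' \<and>
      unhit pb s' = unhit pb s - {iarr s ''oa'' (a * n + p)})"
proof (rule wp_fit)
  assume "fit M s"
  note fit = fitD[OF this]
  note A = adjacentD[OF s(1)]
  define b where "b = iarr s ''oa'' (a * n + p)"
  have near: "(a, b, rarr s ''ow'' (a * n + p)) \<in> near V h" using arc_lists_arc[OF o a(1,3)] by (simp
      add: b_def)
  have b: "b \<in> V" "b < n" using near_arc(2)[OF near] V_less by auto
  have aM: "Suc a < M" "b < M" using V_less[OF a(1)] b nn_less_M le_square[of n] by linarith+
  show ?thesis
    unfolding mark_def
    apply (intro wp_intros; (simp add: A s aM flip: b_def)?)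
    subgoal
      using h b near a(2) by (auto simp: outside_def hits_def unhit_def)
    subgoal
      using h b by (auto simp: unhit_def)
    done
qed

lemma select_spec:
  assumes s: "adjacent s" "ireg s ''a'' = a" "ireg s ''pb'' = pb" "ireg s ''g'' = iarr s ''oc'' a" and a:
      "a \<in> V"
    and o: "out_lists s (near V h)" and h: "hits pb h (chosen s) s" and dn: "ireg s ''dn'' < n"
  shows "wp select s (\<lambda>t s'. t \<le> 58 * iarr s ''oc'' a + 20 \<and> outside pb s s' \<and> hits pb h (chosen s') s' \<and>
    chosen s' = insert a (chosen s) \<and> ireg s' ''dn'' = ireg s ''dn'' + 1 \<and>
        unhit pb s' = unhit pb s - nbhd h a)"
proof (rule wp_fit)
  assume "fit M s"
  note A = adjacentD[OF s(1)]
  have aM: "a < M" "Suc (ireg s ''dn'') < M" using V_less[OF a] dn nn_less_M le_square[of n] by linarith+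
  let ?s = "iset ''dn'' (Suc (ireg s ''dn'')) (iput ''D'' (ireg s ''dn'') a s)"
  have ch: "chosen ?s = insert a (chosen s)" by (auto simp: chosen_def lessThan_Suc)
  have loop: "wp (For ''p'' ''g'' mark) ?s (\<lambda>t s'. t \<le> 58 * iarr s ''oc'' a + 6 \<and> outside pb s s' \<and>
      hits pb h (insert a (chosen s)) s' \<and> unhit pb s' = unhit pb s - nbhd h a)"
  proof (rule wp_For[where N = "iarr s ''oc'' a" and T = 50 and
        I = "\<lambda>j s'. adjacent s' \<and> outside pb s s' \<and> hits pb h (insert a (chosen s)) s' \<and>
          unhit pb s' = unhit pb s - (\<lambda>p. iarr s ''oa'' (a * n + p)) ` {..<j}"], goal_cases)
    case 5
    have "adjacent ?s" using s(1) by (simp add: adjacent_def input_def)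
    moreover have "hits pb h (insert a (chosen s)) ?s \<longleftrightarrow> hits pb h (insert a (chosen s)) s"
      "unhit pb ?s = unhit pb s" "outside pb s ?s"
      by (simp_all add: hits_def unhit_def outside_def)
    ultimately show ?case using hits_mono[OF h, of "insert a (chosen s)"] by auto
  next
    case (6 j s')
    note S = sameD[OF 6(5)]
    have "adjacent s''" if "same (writes mark) s' s''" for s''
      using adjacent_same[OF that] 6 by simp
    moreover have "out_lists s' (near V h)" "iarr s' ''oc'' = iarr s ''oc''" "iarr s' ''oa'' = iarr s ''oa''"
      using S o by simp_all
    moreover have "ireg s' ''a'' = a" "ireg s' ''pb'' = pb" using S s by simp_all
    ultimately show ?case using a 6(1-3)
      apply (intro wp_weaken[OF mark_spec[where a = a and pb = pb and h = h and D = "insert a (chosen s)"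
          and p = j]])
      by (auto simp: lessThan_Suc intro: outside_trans)
  next
    case (7 s' t)
    then show ?case using out_bij[OF o a] by (simp add: bij_betw_def add.commute mult.commute)
  qed (use s in simp_all)
  show ?thesis
    unfolding select_def
    apply (intro wp_intros; (simp add: A s aM)?)
    apply (rule wp_weaken[OF loop])
    subgoal for t s'
      using sameD(1)[of _ _ s' "''dn''"] sameD(3)[of _ _ s' "''D''"] ch by (auto simp: chosen_def)
    done
qed

lemma count_spec:
  assumes s: "adjacent s" "ireg s ''i'' = i" "ireg s ''pb'' = pb" and i: "i < nv" and o: "out_lists s
      (near V h)"
  shows "wp (For ''p'' ''g'' count) (iset ''x'' 0 (iset ''g'' (iarr s ''oc'' (vs i)) (iset ''a'' (vs i) s)))
    (\<lambda>t s'. t \<le> 38 * iarr s ''oc'' (vs i) + 6 \<and> ireg s' ''x'' = card (unhit pb s \<inter> nbhd h (vs i)))"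
proof -
  let ?a = "vs i"
  let ?f = "\<lambda>p. iarr s ''oa'' (?a * n + p)" and ?N = "iarr s ''oc'' (vs i)"
  note A = adjacentD[OF s(1)]
  have a: "?a \<in> V" using i by simp
  note bij = out_bij[OF o a]
  show ?thesis
  proof (rule wp_For[where N = ?N and T = 30 and
      I = "\<lambda>j s'. ireg s' ''x'' = card {p. p < j \<and> ?f p \<in> unhit pb s}"], goal_cases)
    case (6 j s')
    note S = sameD[OF 6(5)]
    have e: "iarr s' ''piv'' = iarr s ''piv''" "iarr s' ''oa'' = iarr s ''oa''" using S(3) by simp_all
    have r: "ireg s' ''a'' = ?a" "ireg s' ''n'' = n" "ireg s' ''pb'' = pb" using S(1) s A by simp_all
    have V: "?f j \<in> V" using bij 6(1) nbhd_V unfolding bij_betw_def by blast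
    have "card {p. p < j \<and> ?f p \<in> unhit pb s} \<le> card {..<j}" by (intro card_mono) auto
    then have "card {p. p < j \<and> ?f p \<in> unhit pb s} < n" using 6(1) arc_lists_count[OF o a] by simp
    then have M: "card {p. p < j \<and> ?f p \<in> unhit pb s} + 1 < M"
      using nn_less_M le_square[of n] by linarith
    have "{p. p < Suc j \<and> ?f p \<in> unhit pb s} = (if ?f j \<in> unhit pb s then insert j {p. p < j \<and>
        ?f p \<in> unhit pb s}
       else {p. p < j \<and> ?f p \<in> unhit pb s})"
      by (auto simp: less_Suc_eq)
    then have c: "card {p. p < Suc j \<and> ?f p \<in> unhit pb s} =
       (if iarr s ''piv'' (pb + ?f j) = 0 then card {p. p < j \<and>
           ?f p \<in> unhit pb s} + 1 else card {p. p < j \<and> ?f p \<in> unhit pb s})"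
      using V by (simp add: unhit_def)
    show ?case
      unfolding count_def c
      using M by (intro wp_intros) (simp_all add: 6 e r)
  next
    case (7 s' t)
    have "bij_betw ?f {p. p < ?N \<and> ?f p \<in> unhit pb s} (unhit pb s \<inter> nbhd h ?a)"
      using bij unfolding bij_betw_def by (auto simp: inj_on_def)
    from bij_betw_same_card[OF this] show ?case using 7 by (simp add: add.commute mult.commute)
  qed auto
qed

text \<open>The last conjunct is a potential: every chosen vertex hits at least one vertex that was
  unhit. It bounds \<open>dn\<close> by \<open>nv\<close>, which limits the index into
  \<open>D\<close> and later the number of runs.\<close>

definition hitting :: "nat \<Rightarrow> nat \<Rightarrow> state \<Rightarrow> state \<Rightarrow> bool" where
  "hitting pb h s s' \<longleftrightarrow> outside pb s s' \<and> hits pb h (chosen s') s' \<and> chosen s' \<subseteq> V \<and>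
     ireg s' ''dn'' + card (unhit pb s') \<le> nv"

lemma hitting_iset [simp]:
  "x \<noteq> ''dn'' \<Longrightarrow> hitting pb h s (iset x v s') \<longleftrightarrow> hitting pb h s s'"
  by (simp add: hitting_def chosen_def)

text \<open>\<open>e\<close> is 0 or 1, according to whether the vertex is chosen; in this form the
  inequalities add up over a sweep. A vertex passed over hits fewer than \<open>\<tau>\<close>, and
  a chosen one has nothing left to hit.\<close>

lemma consider_spec:
  assumes s: "adjacent s" "ireg s ''i'' = i" "ireg s ''pb'' = pb" "ireg s ''t'' = \<tau>" "0 < \<tau>" and i: "i < nv"
    and o: "out_lists s (near V h)" and H: "hitting pb h s0 s"
  shows "wp consider_vertex s (\<lambda>t s'. t \<le> 96 * iarr s ''oc'' (vs i) + 60 \<and> hitting pb h s0 s' \<and>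
    unhit pb s' \<subseteq> unhit pb s \<and> card (unhit pb s' \<inter> nbhd h (vs i)) < \<tau> \<and>
    (\<exists>e. ireg s' ''dn'' = ireg s ''dn'' + e \<and> e * \<tau> + card (unhit pb s') \<le> card (unhit pb s)))"
proof (rule wp_fit)
  assume "fit M s"
  note fit = fitD[OF this]
  note A = adjacentD[OF s(1)]
  let ?a = "vs i"
  let ?c = "card (unhit pb s \<inter> nbhd h ?a)"
  let ?s = "iset ''x'' 0 (iset ''g'' (iarr s ''oc'' ?a) (iset ''a'' ?a s))"
  let ?Q = "\<lambda>s'. hitting pb h s0 s' \<and> unhit pb s' \<subseteq> unhit pb s \<and> card (unhit pb s' \<inter> nbhd h ?a) < \<tau> \<and>
    (\<exists>e. ireg s' ''dn'' = ireg s ''dn'' + e \<and> e * \<tau> + card (unhit pb s') \<le> card (unhit pb s))"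
  have a: "?a \<in> V" using i by simp
  have sel: "wp select s1 (\<lambda>t s'. t \<le> 58 * iarr s ''oc'' ?a + 20 \<and> ?Q s')"
    if sm: "same {''p'', ''x''} ?s s1" and c: "\<tau> \<le> ?c" for s1
  proof -
    note S = sameD[OF sm]
    have un: "unhit pb s1 = unhit pb s" and hi: "hits pb h (chosen s1) s1" and ch: "chosen s1 = chosen s"
      using S H by (simp_all add: unhit_def hits_def chosen_def hitting_def)
    have "adjacent s1" using adjacent_same[OF sm] s(1) by simp
    moreover have "out_lists s1 (near V h)" using S o by simp
    moreover have "ireg s1 ''dn'' < n"
      using H c s(5) card_mono[of "unhit pb s" "unhit pb s \<inter> nbhd h ?a"] S nv_le by (auto simp: hitting_def)
    ultimately show ?thesis
    proof (intro wp_weaken[OF select_spec[where a = ?a and pb = pb and h = h]], goal_cases)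
      case (9 t s')
      have "card (unhit pb s') + ?c = card (unhit pb s)"
        using 9 un card_Diff_subset_Int[of "unhit pb s" "nbhd h ?a"] card_mono[of "unhit pb s" "unhit pb
            s \<inter> nbhd h ?a"] by simp
      then have dec: "card (unhit pb s') + \<tau> \<le> card (unhit pb s)" using c by simp
      have "unhit pb s' \<inter> nbhd h ?a = {}" using 9 by auto
      then have "card (unhit pb s' \<inter> nbhd h ?a) < \<tau>" using s(5) by simp
      moreover have "outside pb s0 s'"
      proof -
        have "outside pb s s1" using S by (simp add: outside_def)
        then show ?thesis using H 9 outside_trans unfolding hitting_def by blast
      qed
      ultimately show ?case using 9 un ch H a dec S s(5) by (auto simp: hitting_def intro!: exI[of _ 1])
    qed (use S s hi a in simp_all)
  qed
  show ?thesis
    unfolding consider_vertex_def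
    apply (intro wp_intros; (simp add: A s)?)
    using fit(2)[of "''vs''" i] A apply simp
    using fit(2)[of "''oc''" ?a] apply simp
    using four_le_M apply simp
    apply (rule wp_weaken[OF count_spec[OF s(1,2,3) i o]])
    apply (intro wp_Cond)
      apply simp
    subgoal premises p for t s'
    proof -
      note S = sameD[OF p(2)]
      have "unhit pb s' = unhit pb s" "hits pb h (chosen s') s' \<longleftrightarrow> hits pb h (chosen s) s" "chosen s' =
          chosen s"
        "outside pb s0 s' \<longleftrightarrow> outside pb s0 s"
        using S by (simp_all add: unhit_def hits_def chosen_def outside_def)
      then have "?Q s'" using p(3,4) S H s by (auto simp: hitting_def intro!: exI[of _ 0])
      then show ?thesis using p(3) by (intro wp_Skip) auto
    qed
    subgoal premises p for t s'
      apply (rule wp_weaken[OF sel])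
      using p sameD(1)[OF p(2), of "''t''"] s by auto
    done
qed

text \<open>With \<open>e\<close> choices and \<open>U\<close> unhit at the start,
  \<open>e * \<tau> \<le> card U\<close>, while double counting gives
  \<open>card U * h \<le> nv * (2 * \<tau>)\<close>. Hence \<open>e * h \<le> 2 * nv\<close> in each
  phase.\<close>

lemma phase_spec:
  assumes s: "adjacent s" "ireg s ''pb'' = pb" "ireg s ''t'' = \<tau>" "0 < \<tau>"
    and o: "out_lists s (near V h)" and H: "hitting pb h s0 s" and c: "\<forall>a\<in>V. card (unhit pb s \<inter> nbhd h a)
        \<le> 2 * \<tau>"
  shows "wp phase s (\<lambda>t s'. t \<le> 384 * m + 68 * nv + 20 \<and> hitting pb h s0 s' \<and> ireg s' ''t'' = \<tau> div 2 \<and>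
    (\<forall>a\<in>V. card (unhit pb s' \<inter> nbhd h a) \<le> 2 * (\<tau> div 2)) \<and>
    ireg s' ''dn'' * h \<le> ireg s ''dn'' * h + 2 * nv)"
proof -
  note A = adjacentD[OF s(1)]
  have loop: "wp (For ''i'' ''nv'' consider_vertex) s (\<lambda>t s'. t \<le> 384 * m + 68 * nv + 6 \<and> hitting pb h s0 s' \<and>
    (\<forall>a\<in>V. card (unhit pb s' \<inter> nbhd h a) < \<tau>) \<and>
    (\<exists>e. ireg s' ''dn'' = ireg s ''dn'' + e \<and> e * \<tau> + card (unhit pb s') \<le> card (unhit pb s)))"
  proof (rule wp_For_sum[where N = nv and T = "\<lambda>i. 96 * iarr s ''oc'' (vs i) + 60" and
        I = "\<lambda>j s'. hitting pb h s0 s' \<and> (\<forall>i<j. card (unhit pb s' \<inter> nbhd h (vs i)) < \<tau>) \<and>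
    (\<exists>e. ireg s' ''dn'' = ireg s ''dn'' + e \<and> e * \<tau> + card (unhit pb s') \<le> card (unhit pb s))"], goal_cases)
    case 5
    show ?case using H by simp
  next
    case (6 j s')
    note S = sameD[OF 6(5)]
    have s': "adjacent s'" "out_lists s' (near V h)" "ireg s' ''pb'' = pb" "ireg s' ''t'' = \<tau>" "iarr s'
        ''oc'' = iarr s ''oc''"
      using adjacent_same[OF 6(5)] s out_same[OF 6(5)] o S by simp_all
    from 6(2) obtain e where e: "ireg s' ''dn'' = ireg s ''dn'' + e" "e * \<tau> + card (unhit pb s') \<le> card
        (unhit pb s)"
      by blast
    have H': "hitting pb h s0 s'" using 6(2) by blast
    show ?case
    proof (rule wp_weaken[OF consider_spec[OF s'(1) 6(3) s'(3,4) s(4) 6(1) s'(2) H']], goal_cases)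
      case (1 t s'')
      note 2 = 1
      then obtain e' where e': "ireg s'' ''dn'' = ireg s' ''dn'' + e'" "e' * \<tau> + card (unhit pb s'') \<le>
          card (unhit pb s')"
        by blast
      have "card (unhit pb s'' \<inter> nbhd h a) < \<tau>" if "card (unhit pb s' \<inter> nbhd h a) < \<tau>" for a
      proof -
        have "unhit pb s'' \<inter> nbhd h a \<subseteq> unhit pb s' \<inter> nbhd h a" using 2 by auto
        from card_mono[OF _ this] show ?thesis using that by simp
      qed
      then have "\<forall>i<Suc j. card (unhit pb s'' \<inter> nbhd h (vs i)) < \<tau>" using 6(2) 2(3) by (auto simp:
          less_Suc_eq)
      moreover have "\<exists>e. ireg s'' ''dn'' = ireg s ''dn'' + e \<and>
          e * \<tau> + card (unhit pb s'') \<le> card (unhit pb s)"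
        using e e' by (intro exI[of _ "e + e'"]) (auto simp: algebra_simps)
      ultimately show ?case using 2 s' by simp
    qed
  next
    case (7 s' t)
    have "(\<Sum>i<nv. 96 * iarr s ''oc'' (vs i) + 60) = 96 * (\<Sum>a\<in>V. iarr s ''oc'' a) + 60 * nv"
      unfolding V_def sum.reindex[OF inj_vs] by (simp add: sum.distrib sum_distrib_left)
    also have "\<dots> \<le> 384 * m + 60 * nv" using sum_out[OF o] card_near_le(2)[of h] by simp
    finally show ?case using 7 by (auto simp: V_def)
  qed (use A in simp_all)
  show ?thesis
    unfolding phase_def
  proof (rule wp_Seq, rule wp_weaken[OF loop], goal_cases)
    case (1 t s')
    have \<tau>: "ireg s' ''t'' = \<tau>" using sameD(1)[OF 1(2), of "''t''"] s by simp
    have \<tau>M: "\<tau> div 2 < M" using fitD(1)[OF 1(1), of "''t''"] \<tau> by auto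
    from 1(3) obtain e where e: "ireg s' ''dn'' = ireg s ''dn'' + e" "e * \<tau> + card (unhit pb s') \<le> card
        (unhit pb s)" by blast
    have "e * \<tau> * h \<le> card (unhit pb s) * h" using e(2) by (intro mult_right_mono) auto
    also have "\<dots> = (\<Sum>a\<in>V. card (unhit pb s \<inter> nbhd h a))"
      using H unhit_V by (intro double_count) (auto simp: hitting_def hits_def)
    also have "\<dots> \<le> of_nat (card V) * (2 * \<tau>)" using c by (intro sum_bounded_above) simp
    also have "\<dots> = 2 * nv * \<tau>" by (simp add: card_V)
    finally have "(e * h) * \<tau> \<le> (2 * nv) * \<tau>" by (simp add: ac_simps)
    then have "e * h \<le> 2 * nv" using s(4) by simp
    then have dn: "ireg s' ''dn'' * h \<le> ireg s ''dn'' * h + 2 * nv" using e(1) by (simp add: algebra_simps)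
    have cc: "card (unhit pb s' \<inter> nbhd h a) \<le> 2 * (\<tau> div 2)" if "a \<in> V" for a
    proof -
      have "card (unhit pb s' \<inter> nbhd h a) < \<tau>" using 1(3) that by blast
      \<comment> \<open>For odd \<open>\<tau>\<close> the strict inequality matters: it leaves at
        most \<open>\<tau> - 1 = 2 * (\<tau> div 2)\<close>.\<close>
      then show ?thesis by presburger
    qed
    show ?case using 1(3) \<tau>M \<tau> dn cc by (intro wp_ISet) auto
  qed
qed

lemma hit_spec:
  assumes s: "adjacent s" "ireg s ''pb'' = pb" "ireg s ''s'' = h" "0 < h"
    and o: "out_lists s (near V h)" and z: "\<forall>b<n. iarr s ''piv'' (pb + b) = 0"
  shows "wp hit s (\<lambda>t s'. t \<le> (L + 1) * (384 * m + 68 * nv + 30) + 48 * nv + 20 \<and> hitting pb h s s' \<and>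
    unhit pb s' = {} \<and> ireg s' ''dn'' * h \<le> 2 * nv * (L + 1))"
proof -
  note A = adjacentD[OF s(1)]
  have init: "wp (For ''i'' ''nv'' init_hit) s (\<lambda>t s'. t \<le> 48 * nv + 6 \<and> outside pb s s' \<and>
    hits pb h {} s')"
  proof (rule wp_For[where N = nv and T = 40 and I = "\<lambda>j s'. outside pb s s' \<and> (\<forall>b<n. b \<notin> vs ` {..<j} \<longrightarrow>
      iarr s' ''piv'' (pb + b) = 0) \<and>
    (\<forall>b\<in>vs ` {..<j}. if dg b < h then iarr s' ''piv'' (pb + b) = b + 1 \<and>
        rarr s' ''pwt'' (pb + b) = 0 else iarr s' ''piv'' (pb + b) = 0)"], goal_cases)
    case 5
    show ?case using z by simp
  next
    case (6 j s')
    note S = sameD[OF 6(5)]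
    show ?case
      apply (rule wp_weaken[OF init_hit_spec[where i = j and h = h and pb = pb]])
      using adjacent_same[OF 6(5)] S s 6(1-4) apply simp_all[7]
      using 6(2) by (auto intro: outside_trans)
  next
    case (7 s' t)
    then have "\<forall>b\<in>V. if dg b < h then iarr s' ''piv'' (pb + b) = b + 1 \<and>
        rarr s' ''pwt'' (pb + b) = 0 else iarr s' ''piv'' (pb + b) = 0"
      unfolding V_def by blast
    then have "hits pb h {} s'" unfolding hits_def unhit_def by (auto split: if_splits)
    then show ?case using 7 by (simp add: add.commute mult.commute)
  qed (use A in simp_all)
  let ?P = "384 * m + 68 * nv + 30"
  \<comment> \<open>\<open>t\<close> starts at \<open>n < 2 ^ (L + 1)\<close> and is halved, which
    allows \<open>L + 1\<close> phases, each adding at most \<open>2 * nv\<close> to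
    \<open>dn * h\<close>.\<close>
  let ?I = "\<lambda>s' t. \<exists>e\<le>L + 1. t \<le> e * ?P \<and> ireg s' ''t'' < 2 ^ (L + 1 - e) \<and> hitting pb h s s' \<and>
      ireg s' ''dn'' * h \<le> 2 * nv * e \<and> (\<forall>a\<in>V. card (unhit pb s' \<inter> nbhd h a) \<le> 2 * ireg s' ''t'')"
  have loop: "wp (While (ILess (Const 0) (IReg ''t'')) phase) s1 (\<lambda>t s'. t \<le> (L + 1) * ?P + 4 \<and>
      hitting pb h s s' \<and>
    unhit pb s' = {} \<and> ireg s' ''dn'' * h \<le> 2 * nv * (L + 1))"
    if s1: "adjacent s1" "out_lists s1 (near V h)" "ireg s1 ''pb'' = pb" "hits pb h {} s1" "outside pb s
        s1" "ireg s1 ''dn'' = 0" "ireg s1 ''t'' = n" for s1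
  proof (rule wp_While[where I = ?I and \<mu> = "\<lambda>s. ireg s ''t''"], goal_cases)
    case 2
    have "n \<le> n * n" by simp
    also have "\<dots> < 2 ^ (L + 1)" using n_L by (simp add: order_le_less_trans)
    finally have "n < 2 ^ (L + 1)" .
    moreover have "hitting pb h s s1"
      using s1 card_mono[OF finite_V unhit_V] hits_mono[OF s1(4)] by (simp add: hitting_def chosen_def card_V)
    moreover have "card (unhit pb s1 \<inter> nbhd h a) \<le> 2 * n" for a
      using card_mono[of V "unhit pb s1 \<inter> nbhd h a"] unhit_V card_V nv_le by fastforce
    ultimately show ?case using s1 by (intro exI[of _ 0]) simp
  next
    case (3 s' t)
    then obtain e where e: "e \<le> L + 1" "t \<le> e * ?P" "ireg s' ''t'' < 2 ^ (L + 1 - e)" "hitting pb h s s'"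
      "ireg s' ''dn'' * h \<le> 2 * nv * e" "\<forall>a\<in>V. card (unhit pb s' \<inter> nbhd h a) \<le> 2 * ireg s' ''t''" by blast
    have pos: "0 < ireg s' ''t''" using 3(2) by simp
    then have "e \<noteq> L + 1" using e(3) by auto
    then have e': "Suc e \<le> L + 1" "L + 1 - e = Suc (L + 1 - Suc e)" using e(1) by auto
    have s': "adjacent s'" "ireg s' ''pb'' = pb" "out_lists s' (near V h)"
      using adjacent_same[OF 3(3)] sameD(1)[OF 3(3), of "''pb''"] out_same[OF 3(3) _ s1(2)] s1 by simp_all
    show ?case
      apply (rule wp_weaken[OF phase_spec[OF s'(1,2) refl pos s'(3) e(4,6)]])
      apply (intro conjI exI[of _ "Suc e"])
      using e e' pos by auto
  next
    case (4 s' t)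
    then obtain e where e: "e \<le> L + 1" "t \<le> e * ?P" "hitting pb h s s'"
      "ireg s' ''dn'' * h \<le> 2 * nv * e" "\<forall>a\<in>V. card (unhit pb s' \<inter> nbhd h a) \<le> 2 * ireg s' ''t''" by blast
    \<comment> \<open>At threshold 0 no vertex hits anything unhit, whereas an unhit vertex would be
      hit by itself.\<close>
    have "unhit pb s' \<inter> nbhd h a = {}" if "a \<in> V" for a
      using 4(2) e(5) that finite_subset[OF _ finite_unhit] by fastforce
    then have "unhit pb s' = {}" using self_nbhd s(4) unhit_V by blast
    moreover have "2 * nv * e \<le> 2 * nv * (L + 1)" "e * ?P \<le> (L + 1) * ?P" using e(1) by (intro mult_mono;
        simp)+
    ultimately show ?case using e by auto
  qed simp
  show ?thesis
    unfolding hit_def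
  proof (rule wp_Seq, rule wp_weaken[OF init], goal_cases)
    case (1 t s')
    note S = sameD[OF 1(2)]
    have a: "adjacent s'" "out_lists s' (near V h)" using adjacent_same[OF 1(2)] s out_same[OF 1(2) _ o]
        by simp_all
    show ?case
      apply (intro wp_intros; simp?)
      using four_le_M apply simp
      using adjacentD[OF a(1)] n_less_M apply simp
      apply (rule wp_weaken[OF loop])
      using a S s 1(3) adjacentD[OF a(1)] by simp_all
  qed
qed

end

section \<open>Sample sizes\<close>

definition powstep :: com where
  "powstep = ISet ''x'' (IReg ''x'' *\<^sub>i IReg ''r'') ;;
      IStore ''sz'' (IReg ''k'' -\<^sub>i Const 1 -\<^sub>i IReg ''i'') (IReg ''x'')"

definition grow :: com where
  "grow = ISet ''r'' (IReg ''r'' +\<^sub>i Const 1) ;; ISet ''x'' (Const 1) ;;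
      IStore ''sz'' (IReg ''k'') (Const 1) ;;
     For ''i'' ''k'' powstep ;;
     Cond (ILess (IReg ''x'' *\<^sub>i IReg ''nv'') (IReg ''m'')) (ISet ''go'' (Const 1)) (ISet ''go'' (Const 0))"

text \<open>A linear search is affordable: at most \<open>n\<close> rounds of \<open>O(k)\<close>
  steps, and \<open>n\<close> is within the time bound. The size at level 0 is \<open>n + 1\<close>
  because a list, with its head, may have \<open>n\<close> entries.\<close>

definition ratio :: com where
  "ratio = ISet ''r'' (Const 0) ;; ISet ''go'' (Const 1) ;; While (ILess (Const 0) (IReg ''go'')) grow ;;
     IStore ''sz'' (Const 0) (IReg ''n'' +\<^sub>i Const 1)"

lemma writes_powstep [simp]: "writes powstep = {''x'', ''sz''}"
  and writes_grow [simp]: "writes grow = {''r'', ''x'', ''sz'', ''i'', ''go''}"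
  and writes_ratio [simp]: "writes ratio = {''r'', ''x'', ''sz'', ''i'', ''go''}"
  by (auto simp: powstep_def grow_def ratio_def)

locale levels = adjacency +
  assumes k_ge: "2 \<le> k" and pow_M: "2 ^ k * (n * n) < M"
begin

text \<open>Every integer below the ratio looked for passes the test of the loop.\<close>

lemma ratio_bound:
  assumes "r ^ k * nv < m" "0 < r" shows "r < n" "(r + 1) ^ k < M"
proof -
  have "nv \<noteq> 0"
  proof
    assume "nv = 0"
    then have "V = {}" using card_V card_0_eq[OF finite_V] by simp
    then show False using assms(1) by (auto simp: V_ends)
  qed
  then have "r ^ k \<le> r ^ k * nv" by simp
  then have rk: "r ^ k < n * n" using assms(1) m_le by linarith
  \<comment> \<open>With \<open>k \<ge> 2\<close>, every \<open>r\<close> that fails the test is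
    below \<open>n\<close>, which limits the number of rounds.\<close>
  have "r ^ 2 \<le> r ^ k" using assms k_ge by (intro power_increasing) auto
  then have "r ^ 2 < n ^ 2" using rk by (simp add: power2_eq_square)
  then show "r < n" by (rule power_less_imp_less_base) simp
  \<comment> \<open>The round after a failing \<open>r\<close> computes powers of
    \<open>r + 1\<close>. Replacing \<open>r + 1\<close> by \<open>2 * r\<close> costs a factor
    \<open>2 ^ k\<close>, which is polynomial in \<open>n\<close> for
    \<open>k = O(log n)\<close>.\<close>
  have "(r + 1) ^ k \<le> (2 * r) ^ k" using assms by (intro power_mono) auto
  also have "\<dots> \<le> 2 ^ k * (n * n)" using rk by (simp add: power_mult_distrib)
  finally show "(r + 1) ^ k < M" using pow_M by simp
qed

lemma grow_spec:
  assumes s: "adjacent s" "ireg s ''r'' = r" and r: "r = 0 \<or> r ^ k * nv < m"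
  shows "wp grow s (\<lambda>t s'. t \<le> 30 * k + 40 \<and> ireg s' ''r'' = Suc r \<and>
    (ireg s' ''go'' = 0 \<longleftrightarrow> m \<le> Suc r ^ k * nv) \<and> (\<forall>i\<le>k. iarr s' ''sz'' (k - i) = Suc r ^ i))"
proof (rule wp_fit)
  assume "fit M s"
  note fit = fitD[OF this]
  note A = adjacentD[OF s(1)]
  have rM: "Suc r ^ j < M" if "j \<le> k" for j
  proof -
    have "Suc r ^ j \<le> Suc r ^ k" using that by (intro power_increasing) auto
    moreover have "Suc r ^ k < M"
      using r ratio_bound(2)[of r] four_le_M by (cases "r = 0") auto
    ultimately show ?thesis by simp
  qed
  have loop: "wp (For ''i'' ''k'' powstep) s1 (\<lambda>t s'. t \<le> 26 * k + 6 \<and> ireg s' ''x'' = Suc r ^ k \<and>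
      (\<forall>i\<le>k. iarr s' ''sz'' (k - i) = Suc r ^ i))"
    if s1: "ireg s1 ''k'' = k" "ireg s1 ''r'' = Suc r" "ireg s1 ''x'' = 1" "iarr s1 ''sz'' k = 1" for s1
  proof (rule wp_For[where N = k and T = 18 and
        I = "\<lambda>j s. ireg s ''x'' = Suc r ^ j \<and> (\<forall>i\<le>j. iarr s ''sz'' (k - i) = Suc r ^ i)"], goal_cases)
    case 5
    show ?case using s1 by simp
  next
    case (6 j s')
    have r': "ireg s' ''r'' = Suc r" using sameD(1)[OF 6(5), of "''r''"] s1 by simp
    have "Suc r ^ j * Suc r < M" using rM[of "Suc j"] 6(1) by (simp add: mult.commute)
    moreover have "k - Suc 0 - j = k - Suc j" by simp
    moreover have "k - i \<noteq> k - Suc j" if "i \<le> j" for i using that 6(1) by simp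
    ultimately show ?case
      unfolding powstep_def using 6(1-4) r'
      by (intro wp_intros) (auto simp: le_Suc_eq mult.commute)
  next
    case (7 s' t)
    then show ?case by (simp add: add.commute mult.commute)
  qed (use s1 in simp_all)
  show ?thesis
    unfolding grow_def
    apply (intro wp_intros; (simp add: s)?)
    using rM[of 1] k_ge apply simp
    using four_le_M apply simp
    using four_le_M apply simp
    apply (rule wp_weaken[OF loop])
    using A s apply simp_all[4]
    subgoal premises p for t s'
    proof -
      have "ireg s' ''nv'' = nv" "ireg s' ''m'' = m" "ireg s' ''r'' = Suc r" using sameD(1)[OF p(2)] A s
          by simp_all
      then show ?thesis using p(3) four_le_M by (intro wp_intros) (auto simp: not_less)
    qed
    done
qed

lemma ratio_spec:
  assumes s: "adjacent s"
  shows "wp ratio s (\<lambda>t s'. t \<le> n * (30 * k + 44) + 20 \<and>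
    (\<exists>r>0. m \<le> r ^ k * nv \<and> (r = 1 \<or> (r - 1) ^ k * nv < m) \<and> iarr s' ''sz'' 0 = n + 1 \<and>
      (\<forall>l\<in>{1..k}. iarr s' ''sz'' l = r ^ (k - l))))"
proof -
  note A = adjacentD[OF s]
  let ?I = "\<lambda>s' t. \<exists>r\<le>n. ireg s' ''r'' = r \<and> t \<le> r * (30 * k + 44) \<and> (r = 0 \<or> (r - 1) ^ k * nv < m \<or> r = 1) \<and>
     (ireg s' ''go'' = 0 \<longrightarrow> 0 < r \<and> m \<le> r ^ k * nv \<and> (\<forall>i\<le>k. iarr s' ''sz'' (k - i) = r ^ i)) \<and>
     (ireg s' ''go'' \<noteq> 0 \<longrightarrow> r = 0 \<or> r ^ k * nv < m)"
  let ?s = "iset ''go'' 1 (iset ''r'' 0 s)"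
  have loop: "wp (While (ILess (Const 0) (IReg ''go'')) grow) ?s (\<lambda>t s'. t \<le> n * (30 * k + 44) + 4 \<and>
    (\<exists>r>0. m \<le> r ^ k * nv \<and> (r = 1 \<or> (r - 1) ^ k * nv < m) \<and> (\<forall>i\<le>k. iarr s' ''sz'' (k - i) = r ^ i)))"
  proof (rule wp_While[where I = ?I and \<mu> = "\<lambda>s. if ireg s ''go'' = 0 then 0 else n + 1 - ireg s ''r''"],
      goal_cases)
    case 2
    show ?case by simp
  next
    case (3 s' t)
    then obtain r where r: "r \<le> n" "ireg s' ''r'' = r" "t \<le> r * (30 * k + 44)" "r = 0 \<or>
        r ^ k * nv < m" by auto
    have lt: "r < n" using r(4) ratio_bound(1)[of r] n_pos by (cases "r = 0") auto
    have s': "adjacent s'" using adjacent_same[OF 3(3)] s by simp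
    show ?case
      apply (rule wp_weaken[OF grow_spec[OF s' r(2,4)]])
      using r lt 3(2) by (auto simp: not_le)
  next
    case (4 s' t)
    then obtain r where r: "r \<le> n" "t \<le> r * (30 * k + 44)" "r = 0 \<or> (r - 1) ^ k * nv < m \<or> r = 1"
      "0 < r" "m \<le> r ^ k * nv" "\<forall>i\<le>k. iarr s' ''sz'' (k - i) = r ^ i" by auto
    have "r * (30 * k + 44) \<le> n * (30 * k + 44)" using r(1) by (rule mult_right_mono) simp
    with r(2) have "t \<le> n * (30 * k + 44)" by (rule order_trans)
    then show ?case using r(3-6) by auto
  qed simp
  show ?thesis
    unfolding ratio_def
    apply (intro wp_intros; simp?)
    using four_le_M apply simp
    using four_le_M apply simp
    apply (rule wp_weaken[OF loop[unfolded One_nat_def]])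
    subgoal premises p for t s'
    proof -
      from p(3) obtain r where r: "0 < r" "m \<le> r ^ k * nv" "r = 1 \<or> (r - 1) ^ k * nv < m"
        "\<forall>i\<le>k. iarr s' ''sz'' (k - i) = r ^ i" by auto
      have "iarr s' ''sz'' l = r ^ (k - l)" if "l \<in> {1..k}" for l
        using r(4) that by (metis atLeastAtMost_iff diff_diff_cancel diff_le_self)
      moreover have "Suc n < M" using nn_less_M le_square[of n] by linarith
      ultimately show ?thesis using p(3) r A sameD(1)[OF p(2), of "''n''"]
        by (intro wp_IStore) (auto intro!: exI[of _ r])
    qed
    done
qed

end

section \<open>Dijkstra's algorithm on the near arcs\<close>

context input_graph
begin

text \<open>Only the length and a bound \<open>W\<close> on the weights are kept, not the arcs. A
  bound instead of the maximum makes walks with the same \<open>W\<close> closed under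
  concatenation.\<close>

inductive walk :: "real \<Rightarrow> nat \<Rightarrow> nat \<Rightarrow> real \<Rightarrow> bool" for W x where
  walk_nil: "walk W x x 0"
| walk_snoc: "walk W x a c \<Longrightarrow> arc a b d \<Longrightarrow> d \<le> W \<Longrightarrow> walk W x b (c + d)"

lemma walk_trans: "walk W y z d \<Longrightarrow> walk W x y c \<Longrightarrow> walk W x z (c + d)"
  by (induction rule: walk.induct) (auto simp: add.assoc[symmetric] intro: walk.intros)

lemma walk_mono: "walk W x y c \<Longrightarrow> W \<le> W' \<Longrightarrow> walk W' x y c"
  by (induction rule: walk.induct) (auto intro: walk.intros)

lemma walk_arc: "arc a b d \<Longrightarrow> d \<le> W \<Longrightarrow> walk W a b d"
  using walk_snoc[OF walk_nil, of a b d W] by simp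

end

context adjacency
begin

lemma walk_rev: "walk W x y c \<Longrightarrow> walk W y x c"
proof (induction rule: walk.induct)
  case walk_nil
  show ?case by (rule walk.walk_nil)
next
  case (walk_snoc a c b d)
  have "walk W b a d" using walk_arc arc_sym walk_snoc by blast
  from walk_trans[OF walk_snoc.IH this] show ?case by (simp add: add.commute)
qed

lemma walk_V: "walk W x y c \<Longrightarrow> x = y \<and> c = 0 \<or> x \<in> V \<and> y \<in> V"
  by (induction rule: walk.induct) (auto dest: arc_V)

definition fin :: "state \<Rightarrow> nat \<Rightarrow> nat \<Rightarrow> bool" where
  "fin s a b \<longleftrightarrow> iarr s ''finite'' (a * n + b) \<noteq> 0"

definition est :: "state \<Rightarrow> nat \<Rightarrow> nat \<Rightarrow> real" where
  "est s a b = rarr s ''est'' (a * n + b)"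

definition bounded :: "state \<Rightarrow> nat \<Rightarrow> nat \<Rightarrow> real \<Rightarrow> bool" where
  "bounded s a b c \<longleftrightarrow> fin s a b \<and> est s a b \<le> c"

text \<open>All levels work on one matrix whose estimates only decrease, so an upper bound proved
  once persists.\<close>

definition improve :: "state \<Rightarrow> state \<Rightarrow> bool" where
  "improve s s' \<longleftrightarrow> (\<forall>i. iarr s ''finite'' i \<noteq> 0 \<longrightarrow> iarr s' ''finite'' i \<noteq> 0 \<and>
      rarr s' ''est'' i \<le> rarr s ''est'' i)"

definition sound :: "state \<Rightarrow> bool" where
  "sound s \<longleftrightarrow> (\<forall>a<n. \<forall>b<n. fin s a b \<longrightarrow> (\<exists>W. walk W a b (est s a b)))"

text \<open>\<open>X\<close> holds the settled vertices, and \<open>s0\<close> is the state before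
  the run. Estimates are not claimed to be distances, as they start from detour values; what counts
  is that settled ones are at most queued ones and that all are lengths of walks.\<close>

definition queue :: "nat \<Rightarrow> state \<Rightarrow> nat set \<Rightarrow> nat set \<Rightarrow> state \<Rightarrow> bool" where
  "queue u s0 Q X s \<longleftrightarrow> pq (n * n) (iarr s ''tr'') (rarr s ''key'') Q \<and> Q \<subseteq> V \<and> X \<subseteq> V \<and> Q \<inter> X = {} \<and>
     (\<forall>b\<in>Q. fin s u b \<and> rarr s ''key'' (b + 1) = est s u b) \<and> (\<forall>x\<in>X. fin s u x) \<and>
     (\<forall>x\<in>X. \<forall>b\<in>Q. est s u x \<le> est s u b) \<and> sound s \<and> improve s0 s"

lemma bounded_improve: "bounded s a b c \<Longrightarrow> improve s s' \<Longrightarrow> c \<le> d \<Longrightarrow> bounded s' a b d"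
  unfolding bounded_def improve_def fin_def est_def by (meson order_trans)
lemma improve_refl [simp]: "improve s s"
  and improve_trans: "improve s s' \<Longrightarrow> improve s' s'' \<Longrightarrow> improve s s''"
  unfolding improve_def by (simp, meson order_trans)

lemma est_cong:
  assumes "iarr s' ''finite'' = iarr s ''finite''" "rarr s' ''est'' = rarr s ''est''"
  shows "fin s' = fin s" "est s' = est s" "bounded s' = bounded s" "sound s' \<longleftrightarrow> sound s"
    "improve s0 s' \<longleftrightarrow> improve s0 s" "improve s' s0 \<longleftrightarrow> improve s s0"
proof -
  show 1: "fin s' = fin s" "est s' = est s" using assms by (auto simp: fin_def est_def fun_eq_iff)
  show "bounded s' = bounded s" "sound s' \<longleftrightarrow> sound s" using 1 by (auto simp: bounded_def sound_def fun_eq_iff)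
  show "improve s0 s' \<longleftrightarrow> improve s0 s" "improve s' s0 \<longleftrightarrow> improve s s0" using assms by (auto simp: improve_def)
qed

lemma queue_cong:
  assumes "iarr s' ''finite'' = iarr s ''finite''" "rarr s' ''est'' = rarr s ''est''"
    "iarr s' ''tr'' = iarr s ''tr''" "rarr s' ''key'' = rarr s ''key''"
  shows "queue u s0 Q X s' \<longleftrightarrow> queue u s0 Q X s"
  using est_cong[OF assms(1,2)] assms by (simp add: queue_def)

lemma est_iset [simp]:
  "fin (iset x v s) = fin s" "est (iset x v s) = est s" "bounded (iset x v s) = bounded s"
  "improve s0 (iset x v s) \<longleftrightarrow> improve s0 s" "improve (iset x v s) s0 \<longleftrightarrow> improve s s0"
  "queue u s0 Q X (iset x v s) \<longleftrightarrow> queue u s0 Q X s"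
  "fin (rset x r s) = fin s" "est (rset x r s) = est s" "bounded (rset x r s) = bounded s"
  "improve s0 (rset x r s) \<longleftrightarrow> improve s0 s" "improve (rset x r s) s0 \<longleftrightarrow> improve s s0"
  "queue u s0 Q X (rset x r s) \<longleftrightarrow> queue u s0 Q X s"
  using est_cong[of "iset x v s" s] queue_cong[of "iset x v s" s] est_cong[of "rset x r s" s]
      queue_cong[of "rset x r s" s]
  by auto

end

definition enqueue :: com where
  "enqueue = ISet ''pi'' (IReg ''b'') ;; RSet ''pk'' (RArr ''est'' (IReg ''u'' *\<^sub>i IReg ''n'' +\<^sub>i IReg
      ''b'')) ;;
     ISet ''pv'' (IReg ''b'' +\<^sub>i Const 1) ;; upd"

definition relax :: com where
  "relax = Cond (BOr (IEq (IArr ''finite'' (IReg ''u'' *\<^sub>i IReg ''n'' +\<^sub>i IReg ''b'')) (Const 0))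
       (RLess (RReg ''d'') (RArr ''est'' (IReg ''u'' *\<^sub>i IReg ''n'' +\<^sub>i IReg ''b''))))
     (IStore ''finite'' (IReg ''u'' *\<^sub>i IReg ''n'' +\<^sub>i IReg ''b'') (Const 1) ;;
      RStore ''est'' (IReg ''u'' *\<^sub>i IReg ''n'' +\<^sub>i IReg ''b'') (RReg ''d'') ;; enqueue)
     Skip"

text \<open>The detour value is read in the row of the pivot, column \<open>u\<close>: that is where
  the previous level left its estimates, and the graph is undirected. Vertices with a finite
  estimate from earlier levels are queued as well.\<close>

definition init_vertex :: com where
  "init_vertex = ISet ''b'' (IArr ''vs'' (IReg ''i'')) ;;
     ISet ''x'' (IArr ''piv'' (IReg ''qb'' +\<^sub>i IReg ''b'') -\<^sub>i Const 1) ;;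
     Cond (IEq (IArr ''finite'' (IReg ''x'' *\<^sub>i IReg ''n'' +\<^sub>i IReg ''u'')) (Const 0)) Skip
       (RSet ''d'' (RPlus (RArr ''est'' (IReg ''x'' *\<^sub>i IReg ''n'' +\<^sub>i IReg ''u'')) (RArr ''pwt'' (IReg
           ''qb'' +\<^sub>i IReg ''b''))) ;;
        relax) ;;
     Cond (IEq (IArr ''finite'' (IReg ''u'' *\<^sub>i IReg ''n'' +\<^sub>i IReg ''b'')) (Const 0)) Skip enqueue"

definition scan_arc :: com where
  "scan_arc = ISet ''b'' (IArr ''oa'' (IReg ''a'' *\<^sub>i IReg ''n'' +\<^sub>i IReg ''p'')) ;;
     RSet ''d'' (RPlus (RArr ''est'' (IReg ''u'' *\<^sub>i IReg ''n'' +\<^sub>i IReg ''a'')) (RArr ''ow'' (IReg ''a''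
         *\<^sub>i IReg ''n'' +\<^sub>i IReg ''p''))) ;;
     relax"

definition settle :: com where
  "settle = ISet ''a'' (IArr ''tr'' (Const 1) -\<^sub>i Const 1) ;; ISet ''pi'' (IReg ''a'') ;;
      ISet ''pv'' (Const 0) ;; upd ;;
     ISet ''g'' (IArr ''oc'' (IReg ''a'')) ;; For ''p'' ''g'' scan_arc"

definition dijkstra :: com where
  "dijkstra = For ''i'' ''nv'' init_vertex ;; While (ILess (Const 0) (IArr ''tr'' (Const 1))) settle"

lemma writes_enqueue [simp]: "writes enqueue = {''pi'', ''pk'', ''pv'', ''key'', ''tr'', ''pj'', ''pa'',
    ''pb''}"
  by (auto simp: enqueue_def)

lemma writes_relax [simp]: "writes relax = {''pi'', ''pk'', ''pv'', ''key'', ''tr'', ''pj'', ''pa'',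
    ''pb'', ''finite'', ''est''}"
  by (auto simp: relax_def)

lemma writes_init_vertex [simp]: "writes init_vertex = {''b'', ''x'', ''d'', ''pi'', ''pk'', ''pv'',
    ''key'', ''tr'', ''pj'', ''pa'', ''pb'', ''finite'', ''est''}"
  and writes_scan_arc [simp]: "writes scan_arc = {''b'', ''d'', ''pi'', ''pk'', ''pv'', ''key'', ''tr'',
      ''pj'', ''pa'', ''pb'', ''finite'', ''est''}"
  by (auto simp: init_vertex_def scan_arc_def)

lemma writes_settle [simp]: "writes settle = {''a'', ''g'', ''p'', ''b'', ''d'', ''pi'', ''pk'', ''pv'',
    ''key'', ''tr'', ''pj'', ''pa'', ''pb'', ''finite'', ''est''}"
  by (auto simp: settle_def)

lemma writes_dijkstra [simp]: "writes dijkstra = {''i'', ''x'', ''a'', ''g'', ''p'', ''b'', ''d'',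
    ''pi'', ''pk'', ''pv'', ''key'', ''tr'', ''pj'', ''pa'', ''pb'', ''finite'', ''est''}"
  by (auto simp: dijkstra_def)

context adjacency
begin

lemma enqueue_spec:
  assumes s: "adjacent s" "ireg s ''u'' = u" "ireg s ''b'' = b" and b: "b \<in> V"
    and Q: "pq (n * n) (iarr s ''tr'') (rarr s ''key'') Q"
  shows "wp enqueue s (\<lambda>t s'. t \<le> 50 * L + 70 \<and> pq (n * n) (iarr s' ''tr'') (rarr s' ''key'') (insert b Q) \<and>
    rarr s' ''key'' = (rarr s ''key'')(b + 1 := est s u b))"
proof -
  note A = adjacentD[OF s(1)]
  have b': "b < n" "b < n * n" "Suc b < M" using V_less[OF b] nn_less_M le_square[of n] by linarith+
  show ?thesis
    unfolding enqueue_def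
    apply (intro wp_intros; (simp add: A s b')?)
    using b' apply simp
    apply (rule wp_weaken[OF upd_spec[where N = "n * n" and L = L and Q = Q]])
    using Q A s b' n_L by (auto simp: est_def)
qed

lemma queue_enqueue:
  assumes q: "queue u s0 Q X s" and b: "b \<in> V" "b \<notin> X" "fin s u b" "\<forall>x\<in>X. est s u x \<le> est s u b"
    and eq: "iarr s' ''finite'' = iarr s ''finite''" "rarr s' ''est'' = rarr s ''est''"
    and pq: "pq (n * n) (iarr s' ''tr'') (rarr s' ''key'') (insert b Q)"
    and key: "rarr s' ''key'' = (rarr s ''key'')(b + 1 := est s u b)"
  shows "queue u s0 (insert b Q) X s'"
  using q b pq unfolding queue_def est_cong[OF eq] by (auto simp: key)

lemma relax_spec:
  assumes s: "adjacent s" "ireg s ''u'' = u" "ireg s ''b'' = b" "rreg s ''d'' = d" and b: "b \<in> V" and u: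
      "u < n"
    and q: "queue u s0 Q X s" and ge: "\<forall>x\<in>X. est s u x \<le> d" and w: "walk W u b d"
  shows "wp relax s (\<lambda>t s'. t \<le> 50 * L + 110 \<and> improve s s' \<and> bounded s' u b d \<and>
    (\<forall>x\<in>X. est s' u x = est s u x) \<and>
    (\<exists>Q'. Q \<subseteq> Q' \<and> queue u s0 Q' X s' \<and> (\<forall>b'. fin s' u b' \<longrightarrow> fin s u b' \<or> b' \<in> Q')))"
proof (cases "bounded s u b d")
  case True
  then show ?thesis
    unfolding relax_def using s adjacentD[OF s(1)] q
    by (intro wp_intros) (auto simp: bounded_def fin_def est_def)
next
  case False
  note A = adjacentD[OF s(1)]
  have bn: "b < n" using V_less[OF b] .
  \<comment> \<open>A settled \<open>b\<close> would already have an estimate of at most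
    \<open>d\<close>; hence relaxing never changes a settled estimate.\<close>
  have bX: "b \<notin> X" using False ge q by (auto simp: bounded_def queue_def)
  define s1 where "s1 = rput ''est'' (u * n + b) d (iput ''finite'' (u * n + b) 1 s)"
  have fin1: "fin s1 a' b' \<longleftrightarrow> (a' = u \<and> b' = b) \<or> fin s a' b'" if "b' < n" for a' b'
    using that bn row_index[of a' n b' u b] by (auto simp: fin_def s1_def)
  have est1: "est s1 a' b' = (if a' = u \<and> b' = b then d else est s a' b')" if "b' < n" for a' b'
    using that bn row_index[of a' n b' u b] by (auto simp: est_def s1_def)
  have im: "improve s s1" using False by (auto simp: improve_def s1_def bounded_def fin_def est_def)
  have so: "sound s1" using q w fin1 est1 u by (auto simp: queue_def sound_def)
  have QV: "x < n" if "x \<in> Q \<union> X" for x using q that V_less by (auto simp: queue_def)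
  have eX: "\<forall>x\<in>X. est s1 u x = est s u x" using est1 QV bX by auto
  have q': "queue u s0 (insert b Q) X s'" if
      eq: "iarr s' ''finite'' = iarr s1 ''finite''" "rarr s' ''est'' = rarr s1 ''est''"
    and pq: "pq (n * n) (iarr s' ''tr'') (rarr s' ''key'') (insert b Q)"
    and key: "rarr s' ''key'' = (rarr s ''key'')(b + 1 := d)" for s'
  proof -
    have "\<forall>c\<in>insert b Q. fin s1 u c \<and> rarr s' ''key'' (c + 1) = est s1 u c"
      using q fin1 est1 QV bn by (auto simp: queue_def key)
    moreover have "\<forall>x\<in>X. \<forall>c\<in>insert b Q. est s1 u x \<le> est s1 u c"
      using q eX est1 QV bn ge by (auto simp: queue_def)
    ultimately show ?thesis
      using q pq so improve_trans[OF _ im] b bX fin1 QV unfolding queue_def est_cong[OF eq] by auto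
  qed
  have e: "wp enqueue s1 (\<lambda>t s'. t \<le> 50 * L + 70 \<and> iarr s' ''finite'' = iarr s1 ''finite'' \<and>
      rarr s' ''est'' = rarr s1 ''est'' \<and>
      queue u s0 (insert b Q) X s')"
  proof (rule wp_weaken[OF enqueue_spec[where u = u and b = b and Q = Q]], goal_cases)
    case (6 t s')
    note S = sameD[OF 6(2)]
    have "est s1 u b = d" using est1 bn by simp
    then have key: "rarr s' ''key'' = (rarr s ''key'')(b + 1 := d)" using 6(3) by (simp add: s1_def)
    have eq: "iarr s' ''finite'' = iarr s1 ''finite''" "rarr s' ''est'' = rarr s1 ''est''" using S by simp_all
    show ?case using q'[OF eq _ key] 6(3) eq by blast
  qed (use s b q in \<open>simp_all add: s1_def adjacent_def input_def queue_def\<close>)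
  have cond: "bval s (BOr (IEq (IArr ''finite'' (IOp Plus (IOp Times (IReg ''u'') (IReg ''n'')) (IReg
      ''b''))) (Const 0))
       (RLess (RReg ''d'') (RArr ''est'' (IOp Plus (IOp Times (IReg ''u'') (IReg ''n'')) (IReg ''b'')))))"
    using False A s by (auto simp: bounded_def fin_def est_def)
  have main: "wp enqueue (rput ''est'' (u * n + b) d (iput ''finite'' (u * n + b) (Suc 0) s)) (\<lambda>t s'. t \<le>
      50 * L + 70 \<and> improve s s' \<and> bounded s' u b d \<and>
    (\<forall>x\<in>X. est s' u x = est s u x) \<and>
    (\<exists>Q'. Q \<subseteq> Q' \<and> queue u s0 Q' X s' \<and> (\<forall>b'. fin s' u b' \<longrightarrow> fin s u b' \<or> b' \<in> Q')))"
    unfolding s1_def[symmetric, unfolded One_nat_def]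
  proof (rule wp_weaken[OF e], goal_cases)
    case (1 t s')
    then have eq: "iarr s' ''finite'' = iarr s1 ''finite''" "rarr s' ''est'' = rarr s1 ''est''" by auto
    have "fin s1 u b' \<longrightarrow> fin s u b' \<or> b' \<in> insert b Q" for b'
      by (auto simp: fin_def s1_def)
    moreover have "bounded s1 u b d" using fin1 est1 bn by (simp add: bounded_def)
    ultimately show ?case using 1 im eX unfolding est_cong[OF eq] by blast
  qed
  show ?thesis
    unfolding relax_def
    apply (rule wp_Cond, simp)
    subgoal
      apply (intro wp_intros; (simp add: A s)?)
      using four_le_M apply simp
      by (rule wp_weaken[OF main]) simp
    subgoal using cond by simp
    done
qed

lemma init_vertex_spec:
  assumes s: "adjacent s" "ireg s ''u'' = u" "ireg s ''i'' = i" "ireg s ''qb'' = qb" and u: "u \<in> V" and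
      i: "i < nv"
    and q: "queue u s0 Q {} s" and piv: "iarr s ''piv'' (qb + vs i) - 1 \<in> V"
      "walk W (iarr s ''piv'' (qb + vs i) - 1) (vs i) (rarr s ''pwt'' (qb + vs i))"
  shows "wp init_vertex s (\<lambda>t s'. t \<le> 100 * L + 250 \<and> improve s s' \<and>
    (\<forall>c. bounded s0 (iarr s ''piv'' (qb + vs i) - 1) u c \<longrightarrow>
        bounded s' u (vs i) (c + rarr s ''pwt'' (qb + vs i))) \<and>
    (\<exists>Q'. Q \<subseteq> Q' \<and> queue u s0 Q' {} s' \<and> (\<forall>b'. fin s' u b' \<longrightarrow> fin s u b' \<and> b' \<noteq> vs i \<or> b' \<in> Q')))"
proof (rule wp_fit)
  assume "fit M s"
  note fit = fitD[OF this]
  note A = adjacentD[OF s(1)]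
  let ?b = "vs i"
  define x where "x = iarr s ''piv'' (qb + ?b) - 1"
  define w where "w = rarr s ''pwt'' (qb + ?b)"
  have x: "x \<in> V" "walk W x ?b w" using piv by (simp_all add: x_def w_def)
  have xS: "iarr s ''piv'' (qb + ?b) - Suc 0 = x" by (simp add: x_def)
  have lt: "u < n" "x < n" using V_less u x(1) by auto
  let ?s1 = "iset ''x'' x (iset ''b'' ?b s)"
  let ?C = "Cond (IEq (IArr ''finite'' (IReg ''x'' *\<^sub>i IReg ''n'' +\<^sub>i IReg ''u'')) (Const 0)) Skip
       (RSet ''d'' (RPlus (RArr ''est'' (IReg ''x'' *\<^sub>i IReg ''n'' +\<^sub>i IReg ''u'')) (RArr ''pwt'' (IReg
           ''qb'' +\<^sub>i IReg ''b''))) ;;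
        relax)"
  let ?P = "\<lambda>s'. improve s s' \<and> (\<forall>c. bounded s0 x u c \<longrightarrow> bounded s' u ?b (c + w)) \<and>
    (\<exists>Q'. Q \<subseteq> Q' \<and> queue u s0 Q' {} s' \<and> (\<forall>b'. fin s' u b' \<longrightarrow> fin s u b' \<or> b' \<in> Q'))"
  have im: "improve s0 s" and so: "sound s" using q by (auto simp: queue_def)
  have 1: "wp ?C ?s1 (\<lambda>t s'. t \<le> 50 * L + 150 \<and> ?P s')"
  proof (cases "fin s x u")
    case True
    then obtain W' where W': "walk W' x u (est s x u)" using so lt by (auto simp: sound_def)
    \<comment> \<open>The stored walk leads from \<open>x\<close> to \<open>u\<close>; reversed, it
      is continued from \<open>x\<close> to \<open>?b\<close>.\<close>
    have "walk (max W' W) u ?b (est s x u + w)"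
      by (rule walk_trans[OF walk_mono[OF x(2)] walk_mono[OF walk_rev[OF W']]]) auto
    moreover have "est s x u + w \<le> c + w" if "bounded s0 x u c" for c
      using bounded_improve[OF that im order_refl] by (simp add: bounded_def)
    then have "bounded s' u ?b (c + w)" if "bounded s' u ?b (est s x u + w)" "bounded s0 x u c" for s' c
      using bounded_improve[OF that(1) improve_refl] that(2) by blast
    ultimately have "wp relax (rset ''d'' (est s x u + w) ?s1) (\<lambda>t s'. t \<le> 50 * L + 110 \<and> ?P s')"
      apply (intro wp_weaken[OF relax_spec[where u = u and b = ?b and X = "{}" and d = "est s x u + w"]])
      using s q u i lt apply simp_all[9]
      by simp
    then show ?thesis
      apply (intro wp_intros; (simp add: A s)?)
      subgoal using True by (simp add: fin_def)
      by (simp add: est_def flip: w_def) (erule wp_weaken, simp)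
  next
    case False
    have "\<not> bounded s0 x u c" for c
      using False bounded_improve[OF _ im order_refl, of x u c] by (auto simp: bounded_def)
    then show ?thesis using False q
      by (intro wp_intros) (auto simp: A s fin_def)
  qed
  show ?thesis
    unfolding init_vertex_def x_def[symmetric] w_def[symmetric]
    apply (intro wp_Seq wp_ISet; (simp add: A s xS)?)
    using fit(2)[of "''vs''" i] A apply simp
    using fit(2)[of "''piv''" "qb + vs i"] xS apply simp
    apply (rule wp_weaken[OF 1])
    subgoal premises p for t s'
    proof -
      note S = sameD[OF p(2)]
      have s': "adjacent s'" "ireg s' ''u'' = u" "ireg s' ''b'' = ?b"
        using adjacent_same[OF p(2)] S s by simp_all
      note A' = adjacentD[OF s'(1)]
      from p(3) obtain Q' where Q': "Q \<subseteq> Q'" "queue u s0 Q' {} s'" "\<forall>b'. fin s' u b' \<longrightarrow> fin s u b' \<or>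
          b' \<in> Q'" by blast
      show ?thesis
      proof (rule wp_Cond, simp, goal_cases)
        case 1
        then have "\<not> fin s' u ?b" using s' A' by (simp add: fin_def)
        then show ?case using p(3) Q' by (intro wp_Skip) auto
      next
        case 2
        then have f: "fin s' u ?b" using s' A' by (simp add: fin_def)
        show ?case
        proof (rule wp_weaken[OF enqueue_spec[OF s' vs_V[OF i] Q'(2)[unfolded queue_def,
            THEN conjunct1]]], goal_cases)
          case (1 t' s'')
          note 2 = 1
          have eq: "iarr s'' ''finite'' = iarr s' ''finite''" "rarr s'' ''est'' = rarr s' ''est''"
            using sameD[OF 2(2)] by simp_all
          have "queue u s0 (insert ?b Q') {} s''"
            using 2(3) by (intro queue_enqueue[OF Q'(2) _ _ f _ eq]) (auto simp: i)
          then show ?case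
            using p(3) Q' 2(3) unfolding est_cong[OF eq] by (intro conjI exI[of _ "insert ?b Q'"]) auto
        qed
      qed
    qed
    done
qed

lemma init_all_spec:
  assumes s: "adjacent s" "ireg s ''u'' = u" "ireg s ''qb'' = qb" and u: "u \<in> V"
    and q: "queue u s {} {} s"
    and piv: "\<forall>b\<in>V. iarr s ''piv'' (qb + b) - 1 \<in> V \<and>
        (\<exists>W. walk W (iarr s ''piv'' (qb + b) - 1) b (rarr s ''pwt'' (qb + b)))"
  shows "wp (For ''i'' ''nv'' init_vertex) s (\<lambda>t s'. t \<le> nv * (258 + 100 * L) + 6 \<and>
    (\<forall>b\<in>V. \<forall>c. bounded s (iarr s ''piv'' (qb + b) - 1) u c \<longrightarrow> bounded s' u b (c + rarr s ''pwt'' (qb + b))) \<and>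
    (\<exists>Q. queue u s Q {} s' \<and> (\<forall>b\<in>V. fin s' u b \<longrightarrow> b \<in> Q)))"
proof (rule wp_For[where N = nv and T = "100 * L + 250" and I = "\<lambda>j s'. adjacent s' \<and>
    (\<forall>i<j. \<forall>c. bounded s (iarr s ''piv'' (qb + vs i) - 1) u c \<longrightarrow>
        bounded s' u (vs i) (c + rarr s ''pwt'' (qb + vs i))) \<and>
    (\<exists>Q. queue u s Q {} s' \<and> (\<forall>i<j. fin s' u (vs i) \<longrightarrow> vs i \<in> Q))"], goal_cases)
  case 5
  show ?case using s q by auto
next
  case (6 j s')
  note S = sameD[OF 6(5)]
  have e: "iarr s' ''piv'' = iarr s ''piv''" "rarr s' ''pwt'' = rarr s ''pwt''" "ireg s' ''u'' = u" "ireg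
      s' ''qb'' = qb"
    using S s by simp_all
  from 6(2) obtain Q where Q: "queue u s Q {} s'" "\<forall>i<j. fin s' u (vs i) \<longrightarrow> vs i \<in> Q" by blast
  note pj = bspec[OF piv vs_V[OF 6(1)]]
  then obtain W where W: "walk W (iarr s ''piv'' (qb + vs j) - 1) (vs j) (rarr s ''pwt'' (qb + vs j))" by
      blast
  have "iarr s ''piv'' (qb + vs j) - 1 \<in> V" using pj by blast
  note spec = init_vertex_spec[OF _ e(3) 6(3) e(4) u 6(1) Q(1), unfolded e, OF _ this W]
  show ?case
  proof (rule wp_weaken[OF spec], goal_cases)
    case 1
    show ?case using 6(2) by simp
  next
    case (2 t s'')
    have "adjacent s''" using adjacent_same[OF 2(2)] 6(2) by simp
    moreover have "bounded s'' u (vs i) (c + rarr s ''pwt'' (qb + vs i))"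
      if "i < Suc j" "bounded s (iarr s ''piv'' (qb + vs i) - 1) u c" for i c
    proof (cases "i = j")
      case True
      then show ?thesis using 2(3) that by simp
    next
      case False
      then have "bounded s' u (vs i) (c + rarr s ''pwt'' (qb + vs i))" using 6(2) that by (simp add:
          less_Suc_eq)
      from bounded_improve[OF this _ order_refl] show ?thesis using 2(3) by blast
    qed
    moreover from 2(3) obtain Q' where "Q \<subseteq> Q'" "queue u s Q' {} s''"
      "\<forall>b'. fin s'' u b' \<longrightarrow> fin s' u b' \<and> b' \<noteq> vs j \<or> b' \<in> Q'" by blast
    moreover from this have "\<forall>i<Suc j. fin s'' u (vs i) \<longrightarrow> vs i \<in> Q'" using Q(2) by (auto simp: less_Suc_eq)
    ultimately show ?case using 2(3) by auto
  qed
next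
  case (7 s' t)
  then obtain Q where "queue u s Q {} s'" "\<forall>i<nv. fin s' u (vs i) \<longrightarrow> vs i \<in> Q" by blast
  then show ?case using 7(1,2) unfolding V_def by (auto simp: add.commute mult.commute)
qed (use adjacentD[OF s(1)] in simp_all)

text \<open>Apart from the initial values, this is all that the surplus bound takes from Dijkstra's
  algorithm.\<close>

definition relaxed :: "nat \<Rightarrow> nat \<Rightarrow> nat set \<Rightarrow> state \<Rightarrow> bool" where
  "relaxed h u X s \<longleftrightarrow> (\<forall>x\<in>X. \<forall>b c. (x, b, c) \<in> near V h \<longrightarrow> bounded s u b (est s u x + c))"

definition reached :: "nat \<Rightarrow> nat set \<Rightarrow> nat set \<Rightarrow> state \<Rightarrow> bool" where
  "reached u Q X s \<longleftrightarrow> (\<forall>b\<in>V. fin s u b \<longrightarrow> b \<in> X \<union> Q)"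

lemma relaxed_iset [simp]: "relaxed h u X (iset x v s) \<longleftrightarrow> relaxed h u X s" "reached u Q X (iset x v s) \<longleftrightarrow>
    reached u Q X s"
  by (simp_all add: relaxed_def reached_def)

lemma scan_spec:
  assumes s: "adjacent s" "ireg s ''u'' = u" "ireg s ''a'' = a" "ireg s ''g'' = iarr s ''oc'' a"
    and u: "u < n" and a: "a \<in> X" and o: "out_lists s (near V h)"
    and q: "queue u s0 Q X s" and ge: "\<forall>x\<in>X. est s u x \<le> est s u a" and r: "reached u Q X s"
  shows "wp (For ''p'' ''g'' scan_arc) s (\<lambda>t s'. t \<le> iarr s ''oc'' a * (50 * L + 148) + 6 \<and> improve s s' \<and>
     (\<forall>x\<in>X. est s' u x = est s u x) \<and> (\<forall>b c. (a, b, c) \<in> near V h \<longrightarrow> bounded s' u b (est s u a + c)) \<and>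
     (\<exists>Q. queue u s0 Q X s' \<and> reached u Q X s'))"
proof -
  have aV: "a \<in> V" "a < n" using q a V_less by (auto simp: queue_def)
  let ?b = "\<lambda>p. iarr s ''oa'' (a * n + p)" and ?c = "\<lambda>p. rarr s ''ow'' (a * n + p)"
  show ?thesis
  proof (rule wp_For[where N = "iarr s ''oc'' a" and T = "50 * L + 140" and I = "\<lambda>j s'. adjacent s' \<and>
      improve s s' \<and>
     (\<forall>x\<in>X. est s' u x = est s u x) \<and> (\<forall>p<j. bounded s' u (?b p) (est s u a + ?c p)) \<and>
     (\<exists>Q. queue u s0 Q X s' \<and> reached u Q X s')"], goal_cases)
    case 5
    show ?case using s q r by auto
  next
    case (6 j s')
    note S = sameD[OF 6(5)]
    have e: "iarr s' ''oa'' = iarr s ''oa''" "rarr s' ''ow'' = rarr s ''ow''" "ireg s' ''u'' = u" "ireg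
        s' ''a'' = a"
      using S s by simp_all
    from 6(2) obtain Q where Q: "queue u s0 Q X s'" "reached u Q X s'" by blast
    have ea: "est s' u a = est s u a" using 6(2) a by blast
    note arc = arc_lists_arc[OF o aV(1) 6(1)]
    have "arc a (?b j) (?c j) \<or> a = ?b j \<and> ?c j = 0" "?b j \<in> V" using near_arc[OF arc] by auto
    then have w: "walk (max 0 (?c j)) a (?b j) (?c j)" "0 \<le> ?c j"
      using walk_arc[of a "?b j" "?c j" "max 0 (?c j)"] arc_nonneg walk_nil[of 0 a] by auto
    have f: "fin s' u a" "sound s'" using Q(1) a by (auto simp: queue_def)
    then obtain W where W: "walk W u a (est s u a)" using u aV(2) ea by (force simp: sound_def)
    have w': "walk (max W (max 0 (?c j))) u (?b j) (est s u a + ?c j)"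
      by (rule walk_trans[OF walk_mono[OF w(1)] walk_mono[OF W]]) auto
    have A: "adjacent s'" using 6(2) by blast
    have ge': "\<forall>x\<in>X. est s' u x \<le> est s u a + ?c j" using 6(2) ge w(2) by force
    let ?s = "rset ''d'' (est s u a + ?c j) (iset ''b'' (?b j) s')"
    have rel: "wp relax ?s (\<lambda>t s''. t \<le> 50 * L + 110 \<and> adjacent s'' \<and> improve s s'' \<and>
     (\<forall>x\<in>X. est s'' u x = est s u x) \<and> (\<forall>p<Suc j. bounded s'' u (?b p) (est s u a + ?c p)) \<and>
     (\<exists>Q. queue u s0 Q X s'' \<and> reached u Q X s''))"
    proof (rule wp_weaken[OF relax_spec[where u = u and b = "?b j" and d = "est s u a + ?c j" and Q = Q
        and X = X and ?s0.0 = s0 and W = "max W (max 0 (?c j))"]], goal_cases)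
      case (10 t s'')
      have "adjacent s''" using adjacent_same[OF 10(2)] A by simp
      moreover have "improve s' s''" using 10(3) by simp
      moreover have "improve s s''" using 6(2) \<open>improve s' s''\<close> improve_trans by blast
      moreover have "\<forall>x\<in>X. est s'' u x = est s u x" using 10(3) 6(2) by simp
      moreover have "bounded s'' u (?b p) (est s u a + ?c p)" if "p < Suc j" for p
        using that 10(3) 6(2) bounded_improve[OF _ \<open>improve s' s''\<close> order_refl] by (cases "p = j") auto
      moreover from 10(3) obtain Q' where "Q \<subseteq> Q'" "queue u s0 Q' X s''" "\<forall>b'. fin s'' u b' \<longrightarrow>
          fin s' u b' \<or> b' \<in> Q'"
        by auto
      moreover from this have "reached u Q' X s''" using Q(2) by (auto simp: reached_def)
      ultimately show ?case using 10(3) by blast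
    qed (use A e Q ge' w' u near_arc[OF arc] in simp_all)
    show ?case
      unfolding scan_arc_def
      apply (intro wp_intros; (simp add: adjacentD[OF A] e 6(3))?)
      using fitD(2)[OF 6(6), of "''oa''" "a * n + j"] e apply simp
      apply (rule wp_weaken)
       apply (rule rel[folded ea, unfolded est_def])
      by (simp flip: est_def add: ea)
  next
    case (7 s' t)
    have "bounded s' u b (est s u a + c)" if "(a, b, c) \<in> near V h" for b c
      using arc_lists_find[OF o that] 7(1) by auto
    then show ?case using 7(1,2) by (simp add: add.commute mult.commute)
  qed (use s in simp_all)
qed

text \<open>The cost is charged to the out-degree of \<open>a\<close>, which is new in
  \<open>X\<close>, so that over a run the charges sum to the number of near arcs and vertices. The
  20 steps subtracted pay for the test of the loop.\<close>

lemma settle_spec: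
  assumes s: "adjacent s" "ireg s ''u'' = u" and u: "u < n" and o: "out_lists s (near V h)"
    and q: "queue u s0 Q X s" and r: "reached u Q X s" and rel: "relaxed h u X s" and ne: "iarr s ''tr''
        1 \<noteq> 0"
  shows "wp settle s (\<lambda>t s'. improve s s' \<and> (\<exists>a Q'. a \<in> V - X \<and>
      t \<le> (50 * L + 150) * (iarr s ''oc'' a + 1) - 20 \<and>
    queue u s0 Q' (insert a X) s' \<and> reached u Q' (insert a X) s' \<and> relaxed h u (insert a X) s'))"
proof (rule wp_fit)
  assume "fit M s"
  note fit = fitD[OF this]
  note A = adjacentD[OF s(1)]
  define a where "a = iarr s ''tr'' 1 - 1"
  have pq: "pq (n * n) (iarr s ''tr'') (rarr s ''key'') Q" using q by (simp add: queue_def)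
  have tr: "iarr s ''tr'' 1 = a + 1" using ne by (simp add: a_def)
  have aQ: "a \<in> Q" using pq_min(1)[OF pq _ ne] n_pos by (simp add: a_def)
  have aV: "a \<in> V" "a \<notin> X" "fin s u a" "a < n" using q aQ V_less by (auto simp: queue_def)
  have ann: "a < n * n" using aV(4) le_square[of n] by linarith
  have min: "est s u a \<le> est s u b" if "b \<in> Q" for b
    using pq_min(2)[OF pq _ ne that] n_pos q aQ that tr by (auto simp: queue_def)
  let ?s = "iset ''pv'' 0 (iset ''pi'' a (iset ''a'' a s))"
  let ?X = "insert a X"
  have del: "wp upd ?s (\<lambda>t s'. t \<le> 50 * L + 50 \<and> queue u s0 (Q - {a}) ?X s' \<and> (fin s' = fin s \<and>
      est s' = est s \<and> bounded s' = bounded s))"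
  proof (rule wp_weaken[OF upd_spec[where N = "n * n" and L = L and Q = Q]], goal_cases)
    case (6 t s')
    have eq: "iarr s' ''finite'' = iarr s ''finite''" "rarr s' ''est'' = rarr s ''est''" using sameD[OF
        6(2)] by simp_all
    show ?case using 6(3) q aV min unfolding queue_def est_cong[OF eq] by auto
  qed (use pq A ann n_L in simp_all)
  show ?thesis
    unfolding settle_def
    apply (intro wp_Seq wp_ISet; simp?)
    using fit(2)[of "''tr''" 1] apply simp
    using fit(2)[of "''tr''" 1] apply simp
    using four_le_M apply simp
    apply (rule wp_weaken)
     apply (rule del[unfolded a_def One_nat_def])
    apply (fold One_nat_def, fold a_def)
    subgoal premises p for t s'
    proof -
      note S = sameD[OF p(2)]
      have s': "adjacent s'" "ireg s' ''u'' = u" "ireg s' ''a'' = a" "iarr s' ''oc'' = iarr s ''oc''"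
          "out_lists s' (near V h)"
        using adjacent_same[OF p(2)] S s o by simp_all
      have eq: "fin s' = fin s" "est s' = est s" "bounded s' = bounded s" and q': "queue u s0 (Q - {a})
          ?X s'" using p(3) by auto
      let ?s' = "iset ''g'' (iarr s ''oc'' a) s'"
      have im: "improve s s'" using S by (simp add: improve_def)
      have ge: "\<forall>x\<in>?X. est s u x \<le> est s u a" using q aQ by (auto simp: queue_def)
      have reach: "reached u (Q - {a}) ?X s'" using r by (auto simp: reached_def eq)
      have sc: "wp (For ''p'' ''g'' scan_arc) ?s' (\<lambda>t s''. t \<le> iarr s ''oc'' a * (50 * L + 148) + 6 \<and>
          improve s' s'' \<and>
         (\<forall>x\<in>?X. est s'' u x = est s u x) \<and> (\<forall>b c. (a, b, c) \<in> near V h \<longrightarrow> bounded s'' u b (est s u a + c)) \<and>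
         (\<exists>Q. queue u s0 Q ?X s'' \<and> reached u Q ?X s''))"
        apply (rule wp_weaken[OF scan_spec[where a = a and h = h and u = u and X = ?X and Q = "Q - {a}"
            and ?s0.0 = s0]])
        using s' u q' ge reach by (simp_all add: eq)
      show ?thesis
        apply (intro wp_Seq wp_ISet; (simp add: s')?)
        using fit(2)[of "''oc''" a] apply simp
        apply (rule wp_weaken[OF sc])
        subgoal premises pr for t2 s''
        proof -
          have im2: "improve s s''" using im improve_trans pr(3) by blast
          have "relaxed h u ?X s''"
            unfolding relaxed_def using pr(3) rel bounded_improve[OF _ im2 order_refl] by (auto simp:
                relaxed_def)
          then show ?thesis using pr(3) p(3) im2 aV by (auto intro!: exI[of _ a] simp: algebra_simps)
        qed
        done
    qed
    done
qed

end

section \<open>One level\<close>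

context adjacency
begin

lemma dijkstra_spec:
  assumes s: "adjacent s" "ireg s ''u'' = u" "ireg s ''qb'' = qb" and u: "u \<in> V" and o: "out_lists s
      (near V h)"
    and q: "pq (n * n) (iarr s ''tr'') (rarr s ''key'') {}" "sound s"
    and piv: "\<forall>b\<in>V. iarr s ''piv'' (qb + b) - 1 \<in> V \<and>
        (\<exists>W. walk W (iarr s ''piv'' (qb + b) - 1) b (rarr s ''pwt'' (qb + b)))"
  shows "wp dijkstra s (\<lambda>t s'. t \<le> (card (near V h) + nv) * (50 * L + 150) + nv * (258 + 100 * L) + 20 \<and>
    improve s s' \<and> pq (n * n) (iarr s' ''tr'') (rarr s' ''key'') {} \<and> sound s' \<and>
    (\<forall>b\<in>V. \<forall>c. bounded s (iarr s ''piv'' (qb + b) - 1) u c \<longrightarrow> bounded s' u b (c + rarr s ''pwt'' (qb + b))) \<and>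
    relaxed h u {x \<in> V. fin s' u x} s')"
proof -
  have q0: "queue u s {} {} s" using q by (simp add: queue_def)
  have un: "u < n" using V_less u .
  let ?T = "\<lambda>x. (50 * L + 150) * (iarr s ''oc'' x + 1)"
  let ?K = "(\<Sum>x\<in>V. ?T x) + 1"
  have sumT: "(\<Sum>x\<in>V. ?T x) = (card (near V h) + nv) * (50 * L + 150)"
    unfolding sum_distrib_left[symmetric] sum.distrib sum_out[OF o] by (simp add: card_V)
  have loop: "wp (While (ILess (Const 0) (IArr ''tr'' (Const 1))) settle) s1 (\<lambda>t s'. t \<le> (\<Sum>x\<in>V. ?T x) + 5 \<and>
      improve s1 s' \<and> (\<exists>X. queue u s {} X s' \<and> reached u {} X s' \<and> relaxed h u X s'))"
    if s1: "adjacent s1" "ireg s1 ''u'' = u" "out_lists s1 (near V h)" "queue u s Q {} s1" "\<forall>b\<in>V. fin s1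
        u b \<longrightarrow> b \<in> Q"
      "iarr s1 ''oc'' = iarr s ''oc''" for s1 Q
  \<comment> \<open>The invariant bounds the time by charges of distinct vertices, and every round
    takes time; the unspent budget \<open>?K - t\<close> is therefore a termination measure.\<close>
  proof (rule wp_While_timed[where \<mu> = "\<lambda>s t. ?K - t" and I = "\<lambda>s' t. improve s1 s' \<and>
      (\<exists>Q X. queue u s Q X s' \<and> reached u Q X s' \<and> relaxed h u X s' \<and> t \<le> (\<Sum>x\<in>X. ?T x))"], goal_cases)
    case 2
    show ?case using s1 by (auto simp: reached_def relaxed_def)
  next
    case (3 s' t)
    note S = sameD[OF 3(3)]
    from 3(1) obtain Q X where QX: "queue u s Q X s'" "reached u Q X s'" "relaxed h u X s'" "t \<le> (\<Sum>x\<in>X.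
        ?T x)" by blast
    have s': "adjacent s'" "ireg s' ''u'' = u" "out_lists s' (near V h)" "iarr s' ''oc'' = iarr s ''oc''"
      using adjacent_same[OF 3(3)] S s1 by simp_all
    have X: "X \<subseteq> V" "finite X" using QX(1) finite_subset[OF _ finite_V] by (auto simp: queue_def)
    have tK: "t < ?K" using QX(4) sum_mono2[OF finite_V X(1), of ?T] by linarith
    show ?case
    proof (rule wp_weaken[OF settle_spec[OF s'(1,2) un s'(3) QX(1,2,3)]], goal_cases)
      case 1
      show ?case using 3(2) by simp
    next
      case (2 t1 s'')
      then obtain a Q' where a: "a \<in> V - X" "t1 \<le> ?T a - 20" "queue u s Q' (insert a X) s''"
        "reached u Q' (insert a X) s''" "relaxed h u (insert a X) s''" unfolding s'(4) by blast
      have "?T a \<ge> 20" by simp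
      moreover have "(\<Sum>x\<in>insert a X. ?T x) = ?T a + (\<Sum>x\<in>X. ?T x)" using a(1) X(2) by simp
      ultimately have "t + (4 + 1) + t1 \<le> (\<Sum>x\<in>insert a X. ?T x)"
        using a(2) QX(4) by linarith
      moreover have "improve s1 s''" using 3(1) 2(3) improve_trans by blast
      ultimately have "improve s1 s'' \<and> (\<exists>Q X. queue u s Q X s'' \<and> reached u Q X s'' \<and> relaxed h u X s'' \<and>
          t + (4 + 1) + t1 \<le> (\<Sum>x\<in>X. ?T x))"
        using a(3-5) by blast
      moreover have "?K - (t + (4 + 1) + t1) < ?K - t" using tK by (intro diff_less_mono2) auto
      moreover have "bcost (ILess (Const 0) (IArr ''tr'' (Const 1))) = 4" by simp
      ultimately show ?case by metis
    qed
  next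
    case (4 s' t)
    from 4(1) obtain Q X where QX: "queue u s Q X s'" "reached u Q X s'" "relaxed h u X s'" "t \<le> (\<Sum>x\<in>X.
        ?T x)" by blast
    have "Q = {}" using QX(1) 4(2) pq_empty[of "n * n" "iarr s' ''tr''" "rarr s' ''key''" Q] by (simp
        add: queue_def)
    moreover have "t \<le> (\<Sum>x\<in>V. ?T x)" using QX(1,4) sum_mono2[OF finite_V, of X ?T] by (auto simp: queue_def)
    ultimately show ?case using QX 4(1) by auto
  qed simp
  show ?thesis
    unfolding dijkstra_def
  proof (rule wp_Seq, rule wp_weaken[OF init_all_spec[OF s u q0 piv]], goal_cases)
    case (1 t s1)
    then obtain Q where Q: "queue u s Q {} s1" "\<forall>b\<in>V. fin s1 u b \<longrightarrow> b \<in> Q" by blast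
    note S = sameD[OF 1(2)]
    have s1: "adjacent s1" "ireg s1 ''u'' = u" "out_lists s1 (near V h)" "iarr s1 ''oc'' = iarr s ''oc''"
      using adjacent_same[OF 1(2)] S s o by simp_all
    show ?case
    proof (rule wp_weaken[OF loop[OF s1(1-3) Q s1(4)]], goal_cases)
      case (1 t' s')
      then obtain X where X: "queue u s {} X s'" "reached u {} X s'" "relaxed h u X s'" by blast
      \<comment> \<open>With an empty queue, \<open>reached\<close> puts every vertex of finite
        estimate into \<open>X\<close>.\<close>
      have "relaxed h u {x \<in> V. fin s' u x} s'" using X(2,3) by (auto simp: relaxed_def reached_def)
      moreover have "bounded s' u b (c + rarr s ''pwt'' (qb + b))" if "b \<in> V" "bounded s (iarr s ''piv''
          (qb + b) - 1) u c" for b c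
        using bounded_improve[OF _ _ order_refl] \<open>t \<le> _ \<and> _\<close> 1(3) that by blast
      ultimately show ?case using 1(3) \<open>t \<le> _ \<and> _\<close> X(1) unfolding sumT by (auto simp: queue_def)
    qed
  qed
qed

text \<open>The claim covers every walk and every bound \<open>W\<close> on its weights. Thus it
  applies to the detour walks met in the induction, and in the end to any shortest path
  \<open>p\<close> with \<open>W = max_weight w p\<close>.\<close>

definition good :: "nat \<Rightarrow> nat \<Rightarrow> state \<Rightarrow> bool" where
  "good j u s \<longleftrightarrow> (\<forall>W v c. 0 \<le> W \<longrightarrow> walk W u v c \<longrightarrow> bounded s u v (c + 2 * real j * W))"

lemma good_improve: "good j u s \<Longrightarrow> improve s s' \<Longrightarrow> good j u s'"
  unfolding good_def using bounded_improve by blast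

lemma good_iset [simp]: "good j u (iset x v s) \<longleftrightarrow> good j u s"
  by (simp add: good_def)

text \<open>Entries from position \<open>h\<close> on are the dropped ones. If there are any, the
  arc to the pivot is no heavier than each of them, and the pivot has been treated with surplus
  index \<open>J - 1\<close>; for \<open>J = 0\<close> the condition forbids dropped entries. For
  \<open>h = 1\<close> the pivots are the vertices themselves. Two states occur because pivots are
  chosen before the runs that make their estimates good.\<close>

definition pivots :: "nat \<Rightarrow> nat \<Rightarrow> nat \<Rightarrow> state \<Rightarrow> state \<Rightarrow> bool" where
  "pivots qb h J s0 s \<longleftrightarrow> (\<forall>b\<in>V. let x = iarr s0 ''piv'' (qb + b) - 1; w = rarr s0 ''pwt'' (qb + b) in
     x \<in> V \<and> (arc x b w \<or> x = b \<and> w = 0) \<and> (h = 1 \<longrightarrow> x = b) \<and>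
     (\<forall>p<dg b. h \<le> p \<longrightarrow> w \<le> aw (b * n + p) \<and> 0 < J \<and> good (J - 1) x s))"

lemma pivots_walk:
  assumes "pivots qb h J s0 s" "b \<in> V"
  shows "iarr s0 ''piv'' (qb + b) - 1 \<in> V"
    and "\<exists>W. walk W (iarr s0 ''piv'' (qb + b) - 1) b (rarr s0 ''pwt'' (qb + b))"
proof -
  show "iarr s0 ''piv'' (qb + b) - 1 \<in> V" using assms by (auto simp: pivots_def Let_def)
  have "arc (iarr s0 ''piv'' (qb + b) - 1) b (rarr s0 ''pwt'' (qb + b)) \<or>
    iarr s0 ''piv'' (qb + b) - 1 = b \<and> rarr s0 ''pwt'' (qb + b) = 0"
    using assms by (auto simp: pivots_def Let_def)
  then show "\<exists>W. walk W (iarr s0 ''piv'' (qb + b) - 1) b (rarr s0 ''pwt'' (qb + b))"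
    using walk_arc[OF _ order_refl] walk_nil by metis
qed

text \<open>
  The induction follows a walk from \<open>u\<close>. Its arcs to near neighbours are relaxed. At any other arc
  into \<open>b\<close>, of weight at most \<open>W\<close>, the detour through the pivot of \<open>b\<close> costs at most \<open>2 W\<close>.
\<close>

lemma surplus:
  assumes piv: "pivots qb h J s s" and im: "improve s s'" and uu: "bounded s u u 0"
    and p: "\<forall>b\<in>V. \<forall>c. bounded s (iarr s ''piv'' (qb + b) - 1) u c \<longrightarrow>
        bounded s' u b (c + rarr s ''pwt'' (qb + b))"
    and r: "relaxed h u {x \<in> V. fin s' u x} s'"
  shows "good J u s'"
  unfolding good_def
proof (intro allI impI)
  fix W v c assume W: "0 \<le> (W::real)" and "walk W u v c"
  from this(2) show "bounded s' u v (c + 2 * real J * W)"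
  proof (induction rule: walk.induct)
    case walk_nil
    show ?case using bounded_improve[OF uu im] W by simp
  next
    case (walk_snoc a c b d)
    have ab: "a \<in> V" "b \<in> V" "arc b a d" using arc_V[OF walk_snoc(2)] arc_sym[OF walk_snoc(2)] by auto
    obtain p' where p': "p' < dg b" "ad (b * n + p') = a" "aw (b * n + p') = d" using ad_find[OF ab(3)]
        by blast
    show ?case
    proof (cases "p' < h")
      case True
      then have "(a, b, d) \<in> near V h" using p' ab by (auto simp: near_iff)
      moreover have "fin s' u a" using walk_snoc.IH by (simp add: bounded_def)
      ultimately have "bounded s' u b (est s' u a + d)" using r ab by (auto simp: relaxed_def)
      moreover have "est s' u a + d \<le> c + d + 2 * real J * W" using walk_snoc.IH by (simp add: bounded_def)
      ultimately show ?thesis using bounded_improve[OF _ improve_refl] by blast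
    next
      case False
      define x where "x = iarr s ''piv'' (qb + b) - 1"
      define w where "w = rarr s ''pwt'' (qb + b)"
      have x: "arc x b w \<or> x = b \<and> w = 0" "w \<le> d" "0 < J" "good (J - 1) x s"
        using piv ab(2) p' False unfolding pivots_def Let_def x_def w_def by auto
      have "w \<le> W" using x(2) walk_snoc(3) by simp
      then have "walk W x b w" using x(1) walk_arc walk_nil by blast
      \<comment> \<open>The pivot offers an estimate from \<open>x\<close> to \<open>u\<close>, so
        the walk up to and including the last arc is turned around and preceded by the arc from
        \<open>x\<close> to \<open>b\<close>.\<close>
      moreover have "walk W b u (c + d)" using walk_rev[OF walk.walk_snoc[OF walk_snoc(1-3)]] .
      ultimately have "walk W x u (w + (c + d))" using walk_trans by blast
      then have "bounded s x u (w + (c + d) + 2 * real (J - 1) * W)" using x(4) W by (simp add: good_def)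
      then have "bounded s' u b (w + (c + d) + 2 * real (J - 1) * W + w)" using p ab(2) unfolding x_def
          w_def by blast
      \<comment> \<open>The arc between \<open>x\<close> and \<open>b\<close> is traversed twice,
        which adds \<open>2 * w \<le> 2 * W\<close> to the surplus of index
        \<open>J - 1\<close>.\<close>
      moreover have "w + (c + d) + 2 * real (J - 1) * W + w \<le> c + d + 2 * real J * W"
        using \<open>w \<le> W\<close> x(3) by (simp add: of_nat_diff algebra_simps)
      ultimately show ?thesis using bounded_improve[OF _ improve_refl] by blast
    qed
  qed
qed

text \<open>A pivot among the first \<open>h\<close> entries of the sorted list precedes every entry
  from \<open>h\<close> on, so its weight is no larger. A short list has no such entries. For
  \<open>h = 1\<close> the only candidate is the head \<open>b\<close>.\<close>

lemma hits_pivots: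
  assumes h: "hits pb h D s0" "unhit pb s0 = {}" and D: "D \<subseteq> V" "\<forall>x\<in>D. good J x s"
  shows "pivots pb h (Suc J) s0 s"
  unfolding pivots_def Let_def
proof (intro ballI conjI)
  fix b assume b: "b \<in> V"
  let ?x = "iarr s0 ''piv'' (pb + b) - 1" and ?w = "rarr s0 ''pwt'' (pb + b)"
  have "iarr s0 ''piv'' (pb + b) \<noteq> 0" using h(2) b by (auto simp: unhit_def)
  then have "?x \<in> D \<and> (?x, b, ?w) \<in> near V h \<or> dg b < h \<and> ?x = b \<and> ?w = 0"
    using h(1) b by (auto simp: hits_def)
  then have *: "?x \<in> V \<and> (arc ?x b ?w \<or> ?x = b \<and> ?w = 0) \<and> (h = 1 \<longrightarrow> ?x = b) \<and>
    (\<forall>p<dg b. h \<le> p \<longrightarrow> ?w \<le> aw (b * n + p) \<and> good J ?x s)"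
  proof
    assume n: "?x \<in> D \<and> (?x, b, ?w) \<in> near V h"
    then obtain p where p: "p < min h (dg b)" "aw (b * n + p) = ?w" "ad (b * n + p) = ?x" by (auto simp:
        near_iff)
    have "h = 1 \<longrightarrow> ?x = b" using p self(1)[OF b] by auto
    moreover
    have "?w \<le> aw (b * n + p')" if "p' < dg b" "h \<le> p'" for p'
      using aw_mono[OF b, of p p'] p that by simp
    ultimately show ?thesis using n D near_arc[of ?x b ?w h] by auto
  next
    assume "dg b < h \<and> ?x = b \<and> ?w = 0"
    then show ?thesis using b by auto
  qed
  then show "?x \<in> V" "arc ?x b ?w \<or> ?x = b \<and> ?w = 0" "h = 1 \<longrightarrow> ?x = b" by auto
  from * show "\<forall>p<dg b. h \<le> p \<longrightarrow> ?w \<le> aw (b * n + p) \<and> 0 < Suc J \<and> good (Suc J - 1) ?x s" by simp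
qed

end

section \<open>The program of one level\<close>

definition run :: com where
  "run = ISet ''u'' (IArr ''D'' (IReg ''j'')) ;; dijkstra"

text \<open>The lists are built twice: hitting needs the near neighbours of the next size, whereas
  the runs scan those of the current size. New pivots go to block \<open>l + 1\<close>, and the runs
  read block \<open>l\<close>.\<close>

definition level :: com where
  "level = ISet ''pb'' ((IReg ''l'' +\<^sub>i Const 1) *\<^sub>i IReg ''n'') ;; ISet ''qb'' (IReg ''l'' *\<^sub>i IReg ''n'') ;;
     ISet ''s'' (IArr ''sz'' (IReg ''l'' +\<^sub>i Const 1)) ;; build ;; hit ;;
     ISet ''s'' (IArr ''sz'' (IReg ''l'')) ;; build ;; For ''j'' ''dn'' run"

lemma writes_run [simp]: "writes run = insert ''u'' (writes dijkstra)"
  by (auto simp: run_def)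

lemma writes_level [simp]: "writes level = {''pb'', ''qb'', ''s'', ''j'',
    ''u''} \<union> writes build \<union> writes hit \<union> writes dijkstra"
  by (auto simp: level_def)

context adjacency
begin

definition ready :: "state \<Rightarrow> bool" where
  "ready s \<longleftrightarrow> adjacent s \<and> pq (n * n) (iarr s ''tr'') (rarr s ''key'') {} \<and> sound s \<and> (\<forall>u<n. bounded s u u 0)"

lemma ready_same:
  assumes "same W s s'" "W \<inter> {''n'', ''m'', ''k'', ''N'', ''src'', ''tgt'', ''wt'', ''nv'', ''vs'',
      ''deg'', ''adj'', ''awt'',
    ''tr'', ''key'', ''finite'', ''est''} = {}" "ready s"
  shows "ready s'"
proof -
  note S = sameD[OF assms(1)]
  have eq: "iarr s' ''finite'' = iarr s ''finite''" "rarr s' ''est'' = rarr s ''est''"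
    "iarr s' ''tr'' = iarr s ''tr''" "rarr s' ''key'' = rarr s ''key''"
    using S[of "''finite''"] S[of "''est''"] S[of "''tr''"] S[of "''key''"] assms(2) by auto
  have "adjacent s'" using adjacent_same[OF assms(1)] assms(2,3) by (auto simp: ready_def)
  then show ?thesis using assms(3) eq by (simp add: ready_def est_cong[OF eq(1,2)])
qed

lemma ready_iset [simp]: "x \<notin> {''n'', ''m'', ''k'', ''N'', ''nv''} \<Longrightarrow> ready (iset x v s) \<longleftrightarrow> ready s"
  using est_cong[of "iset x v s" s] by (simp add: ready_def)

lemma runs_spec:
  assumes s: "ready s" "ireg s ''qb'' = qb" and o: "out_lists s (near V h)"
    and D: "chosen s \<subseteq> V" and piv: "pivots qb h J s s"
  shows "wp (For ''j'' ''dn'' run) s (\<lambda>t s'. t \<le> ireg s ''dn'' * ((card (near V h) + nv) * (50 * L + 150)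
      + nv * (258 + 100 * L) + 40) + 6 \<and>
    ready s' \<and> improve s s' \<and> (\<forall>x\<in>chosen s. good J x s'))"
proof (rule wp_For[where N = "ireg s ''dn''" and T = "(card (near V h) + nv) * (50 * L + 150) + nv * (258
    + 100 * L) + 32" and
    I = "\<lambda>j s'. ready s' \<and> improve s s' \<and> (\<forall>i<j. good J (iarr s ''D'' i) s')"], goal_cases)
  case 5
  show ?case using s by simp
next
  case (6 j s')
  note S = sameD[OF 6(5)]
  let ?u = "iarr s ''D'' j"
  have u: "?u \<in> V" using D 6(1) by (auto simp: chosen_def)
  have e: "ireg s' ''qb'' = qb" "iarr s' ''D'' = iarr s ''D''" "out_lists s' (near V h)" "iarr s' ''piv''
      = iarr s ''piv''"
     "rarr s' ''pwt'' = rarr s ''pwt''"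
    using S s o by simp_all
  \<comment> \<open>Earlier runs of this level only improve estimates, so those of the pivots remain
    good.\<close>
  have piv': "pivots qb h J s' s'"
    using piv good_improve[of _ _ s s'] 6(2) unfolding pivots_def e by (auto simp: Let_def)
  let ?s = "iset ''u'' ?u s'"
  have im: "improve s s'" and rd: "ready s'" using 6(2) by auto
  have "wp dijkstra ?s (\<lambda>t s''. t \<le> (card (near V h) + nv) * (50 * L + 150) + nv * (258 + 100 * L) + 20 \<and>
      ready s'' \<and> improve s' s'' \<and> good J ?u s'')"
  proof (rule wp_weaken[OF dijkstra_spec[where u = ?u and qb = qb and h = h]], goal_cases)
    case 7
    show ?case using rd est_cong[of ?s s'] by (simp add: ready_def)
  next
    case 8
    show ?case using pivots_walk[OF piv'] by simp
  next
    case (9 t s'')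
    have im': "improve s' s''" using 9(3) by simp
    have b0: "\<forall>v<n. bounded s' v v 0" using rd by (simp add: ready_def)
    have "good J ?u s''"
    proof (rule surplus[OF piv' im'])
      show "bounded s' ?u ?u 0" using b0 V_less[OF u] by blast
    qed (use 9(3) in simp_all)
    moreover have "ready s''"
      using rd 9(3) adjacent_same[OF 9(2)] bounded_improve[OF _ im' order_refl] by (simp add: ready_def)
    ultimately show ?case using 9(3) im' by blast
  qed (use rd u e in \<open>simp_all add: ready_def\<close>)
  then show ?case
    unfolding run_def
    apply (intro wp_Seq wp_ISet; (simp add: e 6(3))?)
    using fitD(2)[OF 6(6), of "''D''" j] e apply simp
    apply (erule wp_weaken)
    subgoal for t s''
      using 6(2) improve_trans[OF im, of s''] good_improve[of J _ s' s''] by (auto simp: less_Suc_eq)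
    done
next
  case (7 s' t)
  then show ?case by (auto simp: chosen_def add.commute mult.commute)
qed simp_all

end

section \<open>The invariant and the cost of a level\<close>

context levels
begin

text \<open>The state after \<open>j\<close> levels. The last conjunct keeps the pivot blocks of
  later levels blank, as \<open>hit\<close> requires.\<close>

definition leveled :: "nat \<Rightarrow> nat \<Rightarrow> state \<Rightarrow> bool" where
  "leveled r j s \<longleftrightarrow> ready s \<and> iarr s ''sz'' 0 = n + 1 \<and> (\<forall>l\<in>{1..k}. iarr s ''sz'' l = r ^ (k - l)) \<and>
     pivots (j * n) (iarr s ''sz'' j) j s s \<and> (\<forall>i \<ge> (j + 1) * n. iarr s ''piv'' i = 0)"

lemma leveled_iset [simp]: "x \<notin> {''n'', ''m'', ''k'', ''N'', ''nv''} \<Longrightarrow>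
    leveled r j (iset x v s) \<longleftrightarrow> leveled r j s"
  by (simp add: leveled_def pivots_def)

text \<open>With sizes in geometric progression, the number of runs, at most
  \<open>2 nv (L + 1) / r ^ (k - Suc j)\<close>, times the number of arcs, at most
  \<open>4 nv r ^ (k - j)\<close>, does not depend on the level. For \<open>j = 0\<close> the arc
  bound comes from \<open>4 * m\<close> and \<open>m \<le> r ^ k * nv\<close>.\<close>

lemma work_bound:
  assumes r: "0 < r" "m \<le> r ^ k * nv" and j: "j < k"
    and h: "h = (if j = 0 then n + 1 else r ^ (k - j))" and d: "d * r ^ (k - Suc j) \<le> 2 * nv * (L + 1)"
  shows "d * card (near V h) \<le> 8 * (r * nv ^ 2) * (L + 1)"
proof -
  have k: "k - j = Suc (k - Suc j)" using j by simp
  have "card (near V h) \<le> 4 * (nv * r * r ^ (k - Suc j))"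
  proof (cases "j = 0")
    case True
    have "card (near V h) \<le> 4 * m" by (rule card_near_le)
    also have "\<dots> \<le> 4 * (r ^ k * nv)" using r by simp
    also have "r ^ k = r * r ^ (k - Suc j)" using k True by (metis diff_zero power_Suc)
    finally show ?thesis by (simp add: ac_simps)
  next
    case False
    have "card (near V h) \<le> nv * h" by (rule card_near_le)
    also have "\<dots> = nv * r * r ^ (k - Suc j)" using False k h by simp
    finally show ?thesis by simp
  qed
  then have "d * card (near V h) \<le> d * (4 * (nv * r * r ^ (k - Suc j)))" by (rule mult_left_mono) simp
  also have "\<dots> = 4 * nv * r * (d * r ^ (k - Suc j))" by simp
  also have "\<dots> \<le> 4 * nv * r * (2 * nv * (L + 1))" using d by (rule mult_left_mono) simp
  finally show ?thesis by (simp add: power2_eq_square algebra_simps)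
qed

text \<open>Two builds, one hitting set, and \<open>d\<close> runs on \<open>c\<close> arcs. The
  queue contributes one factor \<open>L + 1\<close> and the size of the hitting set another; the
  rest is absorbed through \<open>nv \<le> 2 * m\<close> and
  \<open>d * nv \<le> r * nv ^ 2\<close>.\<close>

lemma level_time:
  assumes r: "0 < r" and d: "d \<le> nv" and w: "d * c \<le> 8 * (r * nv ^ 2) * (L + 1)"
    and t: "t \<le> 2 * (400 * m + 60 * nv + 20) + ((L + 1) * (384 * m + 68 * nv + 30) + 48 * nv + 20) +
      (d * ((c + nv) * (50 * L + 150) + nv * (258 + 100 * L) + 40) + 6) + 60"
  shows "t \<le> 4000 * (L + 1) ^ 2 * (r * nv ^ 2 + m + 1)"
proof -
  define Z where "Z = L + 1"
  define A where "A = r * nv ^ 2"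
  have Z: "1 \<le> Z" "50 * L + 150 \<le> 150 * Z" "258 + 100 * L \<le> 258 * Z" by (simp_all add: Z_def)
  have "d * nv \<le> nv * nv" using d by simp
  also have "\<dots> \<le> A" using r by (simp add: A_def power2_eq_square)
  finally have dn: "d * nv \<le> A" .
  have "d * ((c + nv) * (50 * L + 150) + nv * (258 + 100 * L) + 40)
      \<le> d * ((c + nv) * (150 * Z) + nv * (258 * Z) + 40)"
    using Z by (intro mult_left_mono add_mono) auto
  also have "\<dots> = (d * c) * (150 * Z) + (d * nv) * (408 * Z) + d * 40" by (simp add: algebra_simps)
  also have "\<dots> \<le> (8 * A * Z) * (150 * Z) + A * (408 * Z) + nv * 40"
    using w dn d by (intro add_mono mult_right_mono) (auto simp: A_def Z_def)
  finally have 1: "d * ((c + nv) * (50 * L + 150) + nv * (258 + 100 * L) + 40)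
      \<le> 1200 * (A * Z ^ 2) + 408 * (A * Z) + 40 * nv" by (simp add: power2_eq_square algebra_simps)
  have ZZ: "Z \<le> Z ^ 2" "1 \<le> Z ^ 2" using Z by (auto simp: power2_eq_square)
  have 2: "A * Z \<le> A * Z ^ 2" "m \<le> m * Z ^ 2" "m * Z \<le> m * Z ^ 2" "Z \<le> Z ^ 2" "1 \<le> Z ^ 2" using ZZ by auto
  have nv: "nv \<le> 2 * m" by (rule nv_le_m)
  have "(L + 1) * (384 * m + 68 * nv + 30) \<le> Z * (384 * m + 68 * (2 * m) + 30)"
    unfolding Z_def using nv by (intro mult_left_mono add_mono) auto
  also have "\<dots> = 520 * (m * Z) + 30 * Z" by (simp add: algebra_simps)
  finally have 3: "(L + 1) * (384 * m + 68 * nv + 30) \<le> 520 * (m * Z) + 30 * Z" .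
  have 4: "2 * (400 * m + 60 * nv + 20) \<le> 800 * m + 120 * nv + 40" by simp
  have "t \<le> (800 * m + 120 * nv + 40) + ((520 * (m * Z) + 30 * Z) + 48 * nv + 20) +
      ((1200 * (A * Z ^ 2) + 408 * (A * Z) + 40 * nv) + 6) + 60"
    by (rule order_trans[OF t]) (intro add_mono 4 1 3 order_refl)
  then have "t \<le> 1608 * (A * Z ^ 2) + 1736 * (m * Z ^ 2) + 156 * Z ^ 2"
    using 2 nv by linarith
  also have "\<dots> \<le> 4000 * Z ^ 2 * (A + m + 1)" by (simp add: algebra_simps)
  finally show ?thesis by (simp add: Z_def A_def)
qed

lemma level_time_sum: "a \<le> x \<Longrightarrow> b \<le> y \<Longrightarrow> c \<le> x \<Longrightarrow> d \<le> z + 6 \<Longrightarrow>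
    a + b + c + d + 50 \<le> 2 * x + y + (z + 6) + (60 :: nat)"
  by linarith

lemma level_spec:
  assumes r: "0 < r" "m \<le> r ^ k * nv" and s: "leveled r j s" "ireg s ''l'' = j" and j: "j < k" and M: "(k
      + 1) * n < M"
  shows "wp level s (\<lambda>t s'. t \<le> 4000 * (L + 1) ^ 2 * (r * nv ^ 2 + m + 1) \<and> leveled r (Suc j) s')"
proof (rule wp_fit)
  assume "fit M s"
  note fit = fitD[OF this]
  have rd: "ready s" and adj: "adjacent s" using s(1) by (simp_all add: leveled_def ready_def)
  note A = adjacentD[OF adj]
  let ?h = "iarr s ''sz'' j" and ?h' = "iarr s ''sz'' (Suc j)"
  let ?pb = "Suc j * n" and ?qb = "j * n"
  have h': "?h' = r ^ (k - Suc j)" using s(1) j by (simp add: leveled_def)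
  have h: "?h = (if j = 0 then n + 1 else r ^ (k - j))" using s(1) j by (simp add: leveled_def)
  have "Suc j * n \<le> k * n" using j by (intro mult_right_mono) auto
  then have pbM: "?pb + n < M" "?pb < M" "?qb < M" using M by auto
  let ?s1 = "iset ''s'' ?h' (iset ''qb'' ?qb (iset ''pb'' ?pb s))"
  have piv: "pivots ?qb ?h j s s" using s(1) by (simp add: leveled_def)
  show ?thesis
    unfolding level_def
    apply (intro wp_Seq wp_ISet; (simp add: A s(2))?)
    using pbM apply simp
    using pbM apply simp
    using fit(2)[of "''sz''" "Suc j"] apply simp
    apply (rule wp_weaken)
     apply (rule build_spec[of _ ?h'], simp add: adj, simp)
    subgoal premises p1 for t1 s1
    proof -
      note S1 = sameD[OF p1(2)]
      have rd1: "ready s1" using ready_same[OF p1(2)] rd by simp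
      have e1: "ireg s1 ''pb'' = ?pb" "ireg s1 ''qb'' = ?qb" "ireg s1 ''s'' = ?h'" "ireg s1 ''l'' = j"
          "iarr s1 ''sz'' = iarr s ''sz''"
        "iarr s1 ''piv'' = iarr s ''piv''" "rarr s1 ''pwt'' = rarr s ''pwt''" "iarr s1 ''finite'' = iarr
            s ''finite''" "rarr s1 ''est'' = rarr s ''est''"
        using S1 s(2) by simp_all
      have z: "\<forall>b<n. iarr s1 ''piv'' (?pb + b) = 0" using s(1) by (simp add: e1 leveled_def)
      have hp: "0 < ?h'" using r h' by simp
      show ?thesis
      proof (rule wp_Seq, rule wp_weaken[OF hit_spec[OF _ e1(1) e1(3) hp _ z]], goal_cases)
        case (3 t2 s2)
        note S2 = sameD[OF 3(2)]
        have rd2: "ready s2" using ready_same[OF 3(2)] rd1 by simp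
        have H: "hitting ?pb ?h' s1 s2" "unhit ?pb s2 = {}" "ireg s2 ''dn'' * ?h' \<le> 2 * nv * (L + 1)"
            using 3(3) by blast+
        have e2: "ireg s2 ''pb'' = ?pb" "ireg s2 ''qb'' = ?qb" "ireg s2 ''l'' = j" "iarr s2 ''sz'' = iarr
            s ''sz''"
          "iarr s2 ''finite'' = iarr s ''finite''" "rarr s2 ''est'' = rarr s ''est''"
          using S2 e1 by simp_all
        \<comment> \<open>The new pivots occupy cells from \<open>?pb = ?qb + n\<close> on, so the
          block that the runs read is untouched.\<close>
        have row: "iarr s2 ''piv'' (?qb + b) = iarr s ''piv'' (?qb + b)" "rarr s2 ''pwt'' (?qb + b) =
            rarr s ''pwt'' (?qb + b)"
          if "b < n" for b
          using H(1) that e1 by (auto simp: hitting_def outside_def)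
        have piv2: "pivots ?qb ?h j s2 s2"
          using piv row V_less unfolding pivots_def good_def est_cong[OF e2(5,6)] by (simp add: Let_def)
        have out2: "iarr s2 ''piv'' i = 0" if "(Suc j + 1) * n \<le> i" for i
          using H(1) that s(1) e1 by (auto simp: hitting_def outside_def leveled_def)
        show ?case
          apply (intro wp_Seq wp_ISet; (simp add: e2)?)
          using fit(2)[of "''sz''" j] apply simp
          apply (rule wp_weaken)
           apply (rule build_spec[of _ ?h])
          using rd2 apply (simp add: ready_def)
           apply simp
          subgoal premises p3 for t3 s3
          proof -
            note S3 = sameD[OF p3(2)]
            have rd3: "ready s3" using ready_same[OF p3(2)] rd2 by simp
            have e3: "ireg s3 ''qb'' = ?qb" "ireg s3 ''dn'' = ireg s2 ''dn''" "iarr s3 ''sz'' = iarr s ''sz''"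
              "iarr s3 ''piv'' = iarr s2 ''piv''" "rarr s3 ''pwt'' = rarr s2 ''pwt''"
              "iarr s3 ''finite'' = iarr s2 ''finite''" "rarr s3 ''est'' = rarr s2 ''est''" "chosen s3 =
                  chosen s2"
              using S3 e2 by (simp_all add: chosen_def)
            have piv3: "pivots ?qb ?h j s3 s3"
              using piv2 unfolding pivots_def good_def e3 est_cong[OF e3(6,7)] .
            have D: "chosen s3 \<subseteq> V" using H(1) by (simp add: hitting_def e3)
            have o3: "out_lists s3 (near V ?h)" using p3(3) by blast
            show ?thesis
            proof (rule wp_weaken[OF runs_spec[OF rd3 e3(1) o3 D piv3]], goal_cases)
              case (1 t4 s4)
              note S4 = sameD[OF 1(2)]
              have e4: "iarr s4 ''sz'' = iarr s ''sz''" "iarr s4 ''piv'' = iarr s2 ''piv''" "rarr s4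
                  ''pwt'' = rarr s2 ''pwt''"
                using S4 e3 by simp_all
              \<comment> \<open>The pivots come from \<open>s2\<close>, the good estimates from
                \<open>s4\<close>; \<open>piv\<close> and \<open>pwt\<close> do not change in
                between.\<close>
              have "pivots ?pb ?h' (Suc j) s2 s4"
                using H 1(3) by (intro hits_pivots) (auto simp: hitting_def e3)
              then have "pivots ?pb ?h' (Suc j) s4 s4" unfolding pivots_def e4 .
              then have "leveled r (Suc j) s4"
                using 1(3) s(1) out2 unfolding leveled_def e4 by simp
              moreover have "t1 + t2 + t3 + t4 + 50 \<le> 4000 * (L + 1) ^ 2 * (r * nv ^ 2 + m + 1)"
              proof (rule level_time[OF r(1) _ work_bound[OF r j h H(3)[unfolded h']]])
                show "ireg s2 ''dn'' \<le> nv" using H(1) by (simp add: hitting_def)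
                show "t1 + t2 + t3 + t4 + 50 \<le> 2 * (400 * m + 60 * nv + 20) + ((L + 1) * (384 * m + 68 *
                    nv + 30) + 48 * nv + 20) +
                  (ireg s2 ''dn'' * ((card (near V ?h) + nv) * (50 * L + 150) + nv * (258 + 100 * L) +
                      40) + 6) + 60"
                  by (rule level_time_sum[OF conjunct1[OF p1(3)] conjunct1[OF 3(3)] conjunct1[OF p3(3)]
                      conjunct1[OF 1(3)[unfolded e3(2)]]])
              qed
              ultimately show ?case by simp
            qed
          qed
          done
      qed (use rd1 p1(3) in \<open>simp_all add: ready_def\<close>)
    qed
    done
qed

end

section \<open>The algorithm\<close>

text \<open>Pivots of level 0: every vertex itself, with the weight 0 that \<open>pwt\<close> holds
  by default.\<close>

definition init_piv :: com where
  "init_piv = ISet ''b'' (IArr ''vs'' (IReg ''i'')) ;; IStore ''piv'' (IReg ''b'') (IReg ''b'' +\<^sub>i Const 1)"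

text \<open>\<open>est\<close> is 0 by default, so flags are enough. Clearing the whole matrix would
  exceed the time bound when \<open>m\<close> is small compared with \<open>n\<close>.\<close>

definition diagonal :: com where
  "diagonal = IStore ''finite'' (IReg ''i'' *\<^sub>i IReg ''n'' +\<^sub>i IReg ''i'') (Const 1)"

definition estimates :: com where
  "estimates = ratio ;; For ''i'' ''nv'' init_piv ;; For ''i'' ''n'' diagonal ;; For ''l'' ''k'' level"

definition apasp :: com where
  "apasp = ISet ''N'' (IReg ''n'' *\<^sub>i IReg ''n'') ;; sort ;; estimates"

lemma writes_init_piv [simp]: "writes init_piv = {''b'', ''piv''}"
  and writes_diagonal [simp]: "writes diagonal = {''finite''}"
  by (auto simp: init_piv_def diagonal_def)

context levels
begin

lemma init_piv_spec:
  assumes s: "adjacent s" "iarr s ''piv'' = (\<lambda>_. 0)"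
  shows "wp (For ''i'' ''nv'' init_piv) s (\<lambda>t s'. t \<le> nv * 20 + 6 \<and> (\<forall>b\<in>V. iarr s' ''piv'' b = b + 1) \<and>
    (\<forall>i\<ge>n. iarr s' ''piv'' i = 0))"
proof (rule wp_For[where N = nv and T = 12 and I = "\<lambda>j s'. (\<forall>i<j. iarr s' ''piv'' (vs i) = vs i + 1) \<and>
    (\<forall>i\<ge>n. iarr s' ''piv'' i = 0)"], goal_cases)
  case (6 j s')
  have v: "vs j < n" "vs j < M" "Suc (vs j) < M"
    using V_less[OF vs_V[OF 6(1)]] nn_less_M le_square[of n] by linarith+
  have "iarr s' ''vs'' = vs" using sameD[OF 6(5)] adjacentD[OF s(1)] by simp
  then show ?case
    unfolding init_piv_def using v 6
    by (intro wp_intros) (auto simp: less_Suc_eq)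
qed (use adjacentD[OF s(1)] s in \<open>auto simp: V_def\<close>)

lemma diagonal_spec:
  assumes s: "adjacent s" "iarr s ''finite'' = (\<lambda>_. 0)" "rarr s ''est'' = (\<lambda>_. 0)"
  shows "wp (For ''i'' ''n'' diagonal) s (\<lambda>t s'. t \<le> n * 20 + 6 \<and> sound s' \<and> (\<forall>u<n. bounded s' u u 0))"
proof (rule wp_For[where N = n and T = 12 and I = "\<lambda>j s'. (\<forall>a<n. \<forall>b<n. fin s' a b \<longleftrightarrow> a = b \<and> a < j) \<and>
    rarr s' ''est'' = (\<lambda>_. 0)"], goal_cases)
  case 5
  show ?case using s by (simp add: fin_def)
next
  case (6 j s')
  have n: "ireg s' ''n'' = n" using 6(4) .
  have "a = j \<and> b = j" if "a * n + b = j * n + j" "b < n" for a b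
    using row_index[OF that(1,2)] 6(1) by simp
  then show ?case
    unfolding diagonal_def using n 6(1-3) four_le_M
    by (intro wp_intros) (auto simp: fin_def less_Suc_eq)
next
  case (7 s' t)
  have "sound s'" unfolding sound_def
  proof (intro allI impI)
    fix a b assume "a < n" "b < n" "fin s' a b"
    then have "a = b" "est s' a b = 0" using 7(1) by (auto simp: est_def)
    then show "\<exists>W. walk W a b (est s' a b)" using walk_nil by auto
  qed
  then show ?case using 7 by (auto simp: bounded_def est_def)
qed (use adjacentD[OF s(1)] in simp_all)

text \<open>The list has its head and at least one neighbour. Position 1 is thus a dropped entry for
  \<open>h = 1\<close>, which lets \<open>pivots\<close> deliver \<open>good (k - 1)\<close> after
  the last level.\<close>

lemma deg_ge_2:
  assumes "b \<in> V" shows "1 < dg b"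
proof -
  obtain c d where "arc b c d" using assms by (auto simp: V_ends arc_def)
  moreover from this obtain p where p: "p < dg b" "ad (b * n + p) = c" using ad_find by blast
  ultimately have "p \<noteq> 0" using self(1)[OF assms] arc_neq by (cases p) auto
  then show ?thesis using p by simp
qed

lemma estimates_spec:
  assumes s: "adjacent s" "pq (n * n) (iarr s ''tr'') (rarr s ''key'') {}" "iarr s ''piv'' = (\<lambda>_. 0)"
      "rarr s ''pwt'' = (\<lambda>_. 0)"
      "iarr s ''finite'' = (\<lambda>_. 0)" "rarr s ''est'' = (\<lambda>_. 0)" and M: "(k + 1) * n < M"
  shows "wp estimates s (\<lambda>t s'. sound s' \<and> (\<forall>u<n. good (k - 1) u s') \<and>
    (\<exists>r>0. (r = 1 \<or> (r - 1) ^ k * nv < m) \<and>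
      t \<le> k * (4000 * (L + 1) ^ 2 * (r * nv ^ 2 + m + 1) + 8) + n * (30 * k + 84) + 50))"
  unfolding estimates_def
proof (rule wp_Seq, rule wp_weaken[OF ratio_spec[OF s(1)]], goal_cases)
  case (1 t1 s1)
  note S1 = sameD[OF 1(2)]
  have adj1: "adjacent s1" using adjacent_same[OF 1(2)] s by simp
  from 1(3) obtain r where r: "0 < r" "m \<le> r ^ k * nv" "r = 1 \<or>
      (r - 1) ^ k * nv < m" "iarr s1 ''sz'' 0 = n + 1"
      "\<forall>l\<in>{1..k}. iarr s1 ''sz'' l = r ^ (k - l)" and t1: "t1 \<le> n * (30 * k + 44) + 20"
    by (elim conjE exE) (rule that, assumption+)
  show ?case
  proof (rule wp_Seq, rule wp_weaken[OF init_piv_spec[OF adj1]], goal_cases)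
    case (2 t2 s2)
    note S2 = sameD[OF 2(2)]
    have adj2: "adjacent s2" using adjacent_same[OF 2(2)] adj1 by simp
    show ?case
    proof (rule wp_Seq, rule wp_weaken[OF diagonal_spec[OF adj2]], goal_cases)
      case (3 t3 s3)
      note S3 = sameD[OF 3(2)]
      have adj3: "adjacent s3" using adjacent_same[OF 3(2)] adj2 by simp
      have e3: "iarr s3 ''piv'' = iarr s2 ''piv''" "rarr s3 ''pwt'' = (\<lambda>_. 0)" "iarr s3 ''sz'' = iarr s1
          ''sz''"
         "iarr s3 ''tr'' = iarr s ''tr''" "rarr s3 ''key'' = rarr s ''key''"
        using S3 S2 S1 s by simp_all
      \<comment> \<open>The size at level 0 exceeds every degree, so the clause of
        \<open>pivots\<close> on dropped entries is vacuous.\<close>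
      have "\<not> n + 1 \<le> p" if "b \<in> V" "p < dg b" for b p
        using that dg_le[of b] V_less[of b] by simp
      then have "pivots 0 (iarr s3 ''sz'' 0) 0 s3 s3"
        using 2(3) unfolding pivots_def e3 Let_def r(4) by auto
      then have lv: "leveled r 0 s3"
        using adj3 3(3) 2(3) r s(2) by (simp add: leveled_def ready_def e3)
      let ?T = "4000 * (L + 1) ^ 2 * (r * nv ^ 2 + m + 1)"
      show ?case
      proof (rule wp_For[where N = k and T = ?T and I = "\<lambda>j s. leveled r j s"], goal_cases)
        case (6 j s')
        show ?case
          by (rule wp_weaken[OF level_spec[OF r(1,2) 6(2,3,1) M]]) auto
      next
        case (7 s4 t4)
        then have rd: "ready s4" and sz: "iarr s4 ''sz'' k = 1" and pv: "pivots (k * n) (iarr s4 ''sz''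
            k) k s4 s4"
          using k_ge by (auto simp: leveled_def)
        have "good (k - 1) u s4" if u: "u < n" for u
        proof (cases "u \<in> V")
          case True
          then have "iarr s4 ''piv'' (k * n + u) - 1 = u" using pv sz unfolding pivots_def Let_def by blast
          moreover have "\<forall>p<dg u. 1 \<le> p \<longrightarrow> good (k - 1) (iarr s4 ''piv'' (k * n + u) - 1) s4"
            using pv sz True unfolding pivots_def Let_def by auto
          ultimately show ?thesis using deg_ge_2[OF True] by auto
        next
          \<comment> \<open>Only the empty walk starts at an isolated vertex, and the diagonal
            covers it.\<close>
          case False
          then have "v = u \<and> c = 0" if "walk W u v c" for W v c using walk_V[OF that] by auto
          then show ?thesis using rd u bounded_improve[OF _ improve_refl,
              of s4 u u 0] by (force simp: good_def ready_def)
        qed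
        moreover have "sound s4" using rd by (simp add: ready_def)
        moreover have "t1 + (t2 + (t3 + t4)) \<le> k * (?T + 8) + n * (30 * k + 84) + 50"
        proof -
          have "nv * 20 \<le> n * 20" using nv_le by simp
          moreover have "n * (30 * k + 84) = n * (30 * k + 44) + n * 20 + n * 20" by (simp add: algebra_simps)
          ultimately show ?thesis using t1 2(3) 3(3) 7(2) by linarith
        qed
        ultimately show ?case using r(1,3) by blast
      qed (use lv adjacentD[OF adj3] in simp_all)
    qed (use S2 S1 s in simp_all)
  qed (use S1 s in simp_all)
qed

end

locale instance_bounds = input_graph +
  assumes two_le_k: "2 \<le> k" and k_M: "2 ^ k * (n * n) < M" "(k + 1) * n < M"
begin

lemma apasp_spec:
  assumes s: "input (iset ''N'' (n * n) s)" "ireg s ''nv'' = 0" "iarr s ''tr'' = (\<lambda>_. 0)" "iarr s ''deg''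
      = (\<lambda>_. 0)"
    "iarr s ''piv'' = (\<lambda>_. 0)" "rarr s ''pwt'' = (\<lambda>_. 0)" "iarr s ''finite'' = (\<lambda>_. 0)" "rarr s ''est'' =
        (\<lambda>_. 0)"
  shows "wp apasp s (\<lambda>t s'.
    (\<forall>u<n. \<forall>v<n. iarr s' ''finite'' (u * n + v) \<noteq> 0 \<longrightarrow> (\<exists>W. walk W u v (rarr s' ''est'' (u * n + v)))) \<and>
    (\<forall>u<n. \<forall>W v c. 0 \<le> W \<longrightarrow> walk W u v c \<longrightarrow>
       iarr s' ''finite'' (u * n + v) \<noteq> 0 \<and> rarr s' ''est'' (u * n + v) \<le> c + 2 * real (k - 1) * W) \<and>
    (\<exists>r>0. \<exists>a\<le>min n (2 * m). (r = 1 \<or> (r - 1) ^ k * a < m) \<and>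
      t \<le> 5000 * k * (L + 1) ^ 2 * (r * a ^ 2 + m + n + 1)))"
  unfolding apasp_def
proof (rule wp_Seq, rule wp_ISet, goal_cases)
  case 4
  let ?s = "iset ''N'' (n * n) s"
  have n: "ireg s ''n'' = n" using s(1) by (simp add: input_def)
  have sort: "wp sort ?s (\<lambda>t s'. t \<le> m * (100 * L + 376) + 12 \<and> input s' \<and> adj_lists n s' (part {..<m}) \<and>
    pq (n * n) (iarr s' ''tr'') (rarr s' ''key'') {})"
    using s by (intro sort_spec) simp_all
  show ?case
    apply (simp add: n)
    apply (rule wp_Seq, rule wp_weaken[OF sort])
    subgoal premises p for t s1
    proof -
      note S = sameD[OF p(2)]
      \<comment> \<open>The sorted lists exist only in the state \<open>s1\<close>, whose arrays
        become the parameters.\<close>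
      interpret levels M n m k L src tgt wt "ireg s1 ''nv''" "iarr s1 ''vs''" "iarr s1 ''deg''" "iarr s1
          ''adj''" "rarr s1 ''awt''"
        using p(3) two_le_k k_M by unfold_locales auto
      let ?nv = "ireg s1 ''nv''"
      have adj: "adjacent s1" using p(3) by (simp add: adjacent_def)
      show ?thesis
      proof (rule wp_weaken[OF estimates_spec[OF adj]], goal_cases)
        case (7 t2 s2)
        from 7(3) obtain r where r: "r > 0" "r = 1 \<or> (r - 1) ^ k * ?nv < m"
          "t2 \<le> k * (4000 * (L + 1) ^ 2 * (r * ?nv ^ 2 + m + 1) + 8) + n * (30 * k + 84) + 50"
          by (elim conjE exE) (rule that, assumption+)
        have snd: "sound s2" and gd: "\<forall>u<n. good (k - 1) u s2" using 7(3) by blast+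
        have "Suc (Suc (Suc (Suc (t + t2)))) \<le> 5000 * k * (L + 1) ^ 2 * (r * ?nv ^ 2 + m + n + 1)"
        proof -
          define K where "K = k * (L + 1) ^ 2"
          define A where "A = r * ?nv ^ 2"
          have Z: "L + 1 \<le> (L + 1) ^ 2" by (simp add: power2_eq_square)
          have K: "2 \<le> K" "k \<le> K" "L + 1 \<le> K" using two_le_k Z mult_le_mono[of 1 k "L + 1" "(L + 1) ^ 2"]
              mult_le_mono[of 2 k 1 "(L + 1) ^ 2"] by (auto simp: K_def)
          have "m * (100 * L + 376) \<le> m * (376 * K)" using K by (intro mult_left_mono) auto
          also have "\<dots> = 376 * (m * K)" by simp
          finally have 1: "t \<le> 376 * (m * K) + 12" using p(3) by linarith
          have "n * (30 * k + 84) \<le> n * (72 * K)" using K by (intro mult_left_mono) auto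
          also have "\<dots> = 72 * (n * K)" by simp
          finally have 2: "n * (30 * k + 84) \<le> 72 * (n * K)" .
          have 3: "k * (4000 * (L + 1) ^ 2 * (A + m + 1) + 8) = 4000 * (A * K) + 4000 * (m * K) + 4000 *
              K + 8 * k"
            by (simp add: K_def algebra_simps)
          have "4 + (t + t2) \<le> 4000 * (A * K) + 4376 * (m * K) + 4100 * K + 72 * (n * K)"
            using 1 2 r(3)[folded A_def, unfolded 3] K by linarith
          also have "\<dots> \<le> 5000 * K * (A + m + n + 1)" by (simp add: algebra_simps)
          finally show ?thesis by (simp add: K_def A_def mult.assoc)
        qed
        moreover have "?nv \<le> min n (2 * m)" using nv_le nv_le_m by simp
        ultimately have "\<exists>r>0. \<exists>a\<le>min n (2 * m). (r = 1 \<or> (r - 1) ^ k * a < m) \<and>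
            Suc (Suc (Suc (Suc (t + t2)))) \<le> 5000 * k * (L + 1) ^ 2 * (r * a ^ 2 + m + n + 1)"
          using r(1,2) by blast
        then show ?case
          using snd gd unfolding sound_def good_def bounded_def fin_def est_def by simp
      qed (use p(3) S s k_M in simp_all)
    qed
    done
qed (use s(1) nn_less_M in \<open>simp_all add: input_def\<close>)

end

section \<open>Correctness and running time\<close>

lemma edge_list_length:
  assumes "edge_list G es" shows "card (uedges G) = length es"
proof -
  have "uedges G = set (map (\<lambda>(u, v). {u, v}) es)" using assms by (simp add: edge_list_def)
  then show ?thesis using assms distinct_card[of "map (\<lambda>(u, v). {u, v}) es"] by (simp add: edge_list_def)
qed

lemma edge_list_arc:
  assumes G: "weighted_graph G w" and es: "edge_list G es"
  shows "(a, b) \<in> parcs G \<longleftrightarrow> (a, b) \<in> set es \<or> (b, a) \<in> set es"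
proof
  interpret pair_graph G using G by (simp add: weighted_graph_def)
  assume "(a, b) \<in> parcs G"
  then have "{a, b} \<in> (\<lambda>(u, v). {u, v}) ` set es" using es by (force simp: edge_list_def uedges_def)
  then obtain u v where "(u, v) \<in> set es" "{u, v} = {a, b}" by auto
  then show "(a, b) \<in> set es \<or> (b, a) \<in> set es" by (auto simp: doubleton_eq_iff)
next
  interpret pair_graph G using G by (simp add: weighted_graph_def)
  assume "(a, b) \<in> set es \<or> (b, a) \<in> set es"
  then have "(a, b) \<in> parcs G \<or> (b, a) \<in> parcs G" using es by (auto simp: edge_list_def)
  then show "(a, b) \<in> parcs G"
    using arcs_symmetric by blast
qed

text \<open>\<open>g\<close> turns \<open>k = O(log n)\<close> into
  \<open>2 ^ k \<le> n ^ g\<close>, the form in which it limits the word size.\<close>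

locale graph_input =
  fixes G :: "nat pair_pre_digraph" and w :: "nat \<times> nat \<Rightarrow> real" and n k g L :: nat and es :: "(nat \<times> nat)
      list"
  assumes G: "weighted_graph G w" "pverts G = {..<n}" and es: "edge_list G es"
    and n2: "2 \<le> n" and k2: "2 \<le> k" and k_g: "2 ^ k \<le> n ^ g" and L: "n * n \<le> 2 ^ L"
begin

sublocale pair_graph G
  using G by (simp add: weighted_graph_def)

abbreviation "m \<equiv> length es"
text \<open>Zero beyond \<open>m\<close>, to agree with the cells of
  \<open>input_state\<close>.\<close>

abbreviation "src i \<equiv> if i < m then fst (es ! i) else 0"
abbreviation "tgt i \<equiv> if i < m then snd (es ! i) else 0"
abbreviation "wt i \<equiv> if i < m then w (es ! i) else 0"

lemma es_arc: "i < m \<Longrightarrow> es ! i \<in> parcs G"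
  using es nth_mem[of i es] by (auto simp: edge_list_def)

lemma m_le: "m \<le> n * n"
proof -
  have "distinct es" using es distinct_map unfolding edge_list_def by blast
  then have "m = card (set es)" by (simp add: distinct_card)
  also have "\<dots> \<le> card ({..<n} \<times> {..<n})"
    using es arc_fst_in_verts arc_snd_in_verts G(2) by (intro card_mono) (force simp: edge_list_def)+
  finally show ?thesis by simp
qed

text \<open>In \<open>n ^ (g + 6)\<close> the factor \<open>n ^ g\<close> pays for
  \<open>2 ^ k\<close>; the other six leave room for \<open>n * n\<close> beside it and for
  \<open>n ^ 3 + 4\<close>.\<close>

sublocale alg: instance_bounds "n ^ (g + 6)" n m k L src tgt wt
proof unfold_locales
  have n1: "1 \<le> n" using n2 by simp
  have "n ^ 3 * 1 + 4 \<le> n ^ 3 * 1 + n ^ 3" using n2 power_mono[of 2 n 3] by simp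
  also have "\<dots> = n ^ 3 * 2" by simp
  also have "\<dots> \<le> n ^ 3 * n ^ (g + 3)" using n2 power_increasing[of 1 "g + 3" n] by (intro mult_left_mono) auto
  also have "\<dots> = n ^ (g + 6)" by (simp add: add.commute flip: power_add)
  finally show M: "n ^ 3 + 4 \<le> n ^ (g + 6)" by simp
  then show "4 \<le> n ^ (g + 6)" by simp
  show "0 < n" using n2 by simp
  show "2 \<le> k" "n * n \<le> 2 ^ L" "m \<le> n * n" using k2 L m_le .
  have "2 ^ k * (n * n) \<le> n ^ g * n ^ 2" using k_g by (simp add: power2_eq_square)
  also have "\<dots> = n ^ (g + 2)" by (rule power_add[symmetric])
  also have "\<dots> < n ^ (g + 6)" using n2 by (intro power_strict_increasing) auto
  finally show k_M: "2 ^ k * (n * n) < n ^ (g + 6)" .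
  have "k + 1 \<le> 2 ^ k" by (simp add: Suc_leI)
  then have "(k + 1) * n \<le> 2 ^ k * (n * n)" by (intro mult_mono) auto
  then show "(k + 1) * n < n ^ (g + 6)" using k_M by simp
  show "src i < n" "tgt i < n" "src i \<noteq> tgt i" if "i < m" for i
    using es_arc[OF that] arc_fst_in_verts arc_snd_in_verts pair_no_loops G(2) that by auto
  show "0 \<le> wt i" if "i < m" for i
    using es_arc[OF that] G(1) that by (cases "es ! i") (auto simp: weighted_graph_def)
  show "i = j" if "i < m" "j < m" "{src i, tgt i} = {src j, tgt j}" for i j
  proof -
    have "map (\<lambda>(u, v). {u, v}) es ! i = map (\<lambda>(u, v). {u, v}) es ! j"
      using that by (simp add: case_prod_beta)
    then show ?thesis
      using es that nth_eq_iff_index_eq[of "map (\<lambda>(u, v). {u, v}) es" i j] by (simp add: edge_list_def)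
  qed
qed

lemma arc_iff: "alg.arc a b c \<longleftrightarrow> (a, b) \<in> parcs G \<and> c = w (a, b)"
proof -
  have sym: "w (a, b) = w (b, a)" if "(a, b) \<in> parcs G" using G(1) that by (auto simp: weighted_graph_def)
  have "alg.arc a b c \<longleftrightarrow> (\<exists>e\<in>set es. c = w e \<and> (e = (a, b) \<or> e = (b, a)))"
  proof
    assume "alg.arc a b c"
    then obtain i where "i < m" "c = w (es ! i)" "es ! i = (a, b) \<or> es ! i = (b, a)"
      unfolding alg.arc_def by (auto simp: prod_eq_iff)
    then show "\<exists>e\<in>set es. c = w e \<and> (e = (a, b) \<or> e = (b, a))" using nth_mem by blast
  next
    assume "\<exists>e\<in>set es. c = w e \<and> (e = (a, b) \<or> e = (b, a))"
    then obtain i where "i < m" "c = w (es ! i)" "es ! i = (a, b) \<or> es ! i = (b, a)"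
      by (metis in_set_conv_nth)
    then show "alg.arc a b c" unfolding alg.arc_def by (auto intro!: exI[of _ i])
  qed
  then show ?thesis using edge_list_arc[OF G(1) es, of a b] sym by auto
qed

lemma walk_awalk: "alg.walk W a b c \<Longrightarrow> a < n \<Longrightarrow> \<exists>p. awalk a p b \<and> awalk_cost w p = c"
proof (induction rule: alg.walk.induct)
  case walk_nil
  then show ?case using G(2) by (intro exI[of _ "[]"]) (simp add: awalk_Nil_iff)
next
  case (walk_snoc b c b' d)
  then obtain p where p: "awalk a p b" "awalk_cost w p = c" by blast
  have e: "(b, b') \<in> parcs G" "d = w (b, b')" using walk_snoc(2) arc_iff by auto
  then have "awalk a (p @ [(b, b')]) b'"
    using p(1) arc_snd_in_verts[OF e(1)] arc_fst_in_verts[OF e(1)] by (auto simp: awalk_simps)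
  moreover have "awalk_cost w (p @ [(b, b')]) = c + d" using p(2) e(2) by simp
  ultimately show ?case by blast
qed

lemma awalk_walk: "awalk a p b \<Longrightarrow> \<forall>e\<in>set p. w e \<le> W \<Longrightarrow> alg.walk W a b (awalk_cost w p)"
proof (induction p arbitrary: a)
  case Nil
  then show ?case by (simp add: awalk_Nil_iff alg.walk_nil)
next
  case (Cons e p)
  then have "e \<in> parcs G" "fst e = a" "awalk (snd e) p b" by (simp_all add: awalk_Cons_iff)
  moreover from this have "alg.arc a (snd e) (w e)" by (auto simp: arc_iff)
  ultimately show ?case using alg.walk_trans[OF Cons.IH alg.walk_arc] Cons.prems by auto
qed

text \<open>A walk is realised by an \<open>awalk\<close> of the same cost. Applied to the walks
  behind finite estimates, this is the lower bound of the theorem.\<close>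

lemma gdist_le: "alg.walk W a b c \<Longrightarrow> a < n \<Longrightarrow> gdist G w a b \<le> ereal c"
proof -
  assume "alg.walk W a b c" "a < n"
  then obtain p where "awalk a p b" "awalk_cost w p = c" using walk_awalk by blast
  then show ?thesis using min_cost_le_walk_cost[of a p b w] by (simp add: gdist_def)
qed

lemma run_spec:
  "\<exists>t s. exec (n ^ (8 * (g + 6))) apasp (input_state n es w k) t s \<and>
     (\<exists>r>0. \<exists>a\<le>min n (2 * m). (r = 1 \<or> (r - 1) ^ k * a < m) \<and>
      t \<le> 5000 * k * (L + 1) ^ 2 * (r * a ^ 2 + m + n + 1)) \<and>
     (\<forall>u < n. \<forall>v < n.
       gdist G w u v \<le> estimate n s u v \<and>
       (\<forall>p. shortest_path G w u p v \<longrightarrow>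
         estimate n s u v \<le> gdist G w u v + ereal (2 * (real k - 1) * max_weight w p)))"
proof -
  let ?s = "input_state n es w k"
  let ?M = "n ^ (g + 6)"
  have M: "n < ?M" "n * n + 1 < ?M" using alg.n_less_M alg.nn_less_M by auto
  have "k < ?M"
  proof -
    have "k < 2 ^ k" by simp
    also have "\<dots> \<le> n ^ g" by (rule k_g)
    also have "\<dots> \<le> ?M" using n2 by (intro power_increasing) auto
    finally show ?thesis .
  qed
  moreover have "src i < ?M" "tgt i < ?M" for i
    using alg.src_less[of i] alg.tgt_less[of i] M n2 by (cases "i < m"; simp)+
  moreover have "m < ?M" using m_le M by simp
  ultimately have fit: "fit ?M ?s" using M n2 by (auto simp: fit_def input_state_def)
  have inp: "alg.input (iset ''N'' (n * n) ?s)" by (simp add: alg.input_def input_state_def)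
  have z: "ireg ?s ''nv'' = 0" "iarr ?s ''tr'' = (\<lambda>_. 0)" "iarr ?s ''deg'' = (\<lambda>_. 0)"
    "iarr ?s ''piv'' = (\<lambda>_. 0)" "rarr ?s ''pwt'' = (\<lambda>_. 0)" "iarr ?s ''finite'' = (\<lambda>_. 0)" "rarr ?s
        ''est'' = (\<lambda>_. 0)"
    by (simp_all add: input_state_def)
  from mp[OF alg.apasp_spec[OF inp z, unfolded alg.wp_def] fit] obtain t s r a where ts: "exec (?M ^ 8)
      apasp ?s t s"
    and sound: "\<forall>u<n. \<forall>v<n. iarr s ''finite'' (u * n + v) \<noteq> 0 \<longrightarrow>
        (\<exists>W. alg.walk W u v (rarr s ''est'' (u * n + v)))"
    and upper: "\<forall>u<n. \<forall>W v c. 0 \<le> W \<longrightarrow> alg.walk W u v c \<longrightarrow>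
       iarr s ''finite'' (u * n + v) \<noteq> 0 \<and> rarr s ''est'' (u * n + v) \<le> c + 2 * real (k - 1) * W"
    and time: "0 < r" "a \<le> min n (2 * m)" "r = 1 \<or> (r - 1) ^ k * a < m"
      "t \<le> 5000 * k * (L + 1) ^ 2 * (r * a ^ 2 + m + n + 1)"
    by (elim exE conjE) (rule that, assumption+)
  have "gdist G w u v \<le> estimate n s u v" if "u < n" "v < n" for u v
    using sound that gdist_le[of _ u v] unfolding estimate_def by auto
  moreover have "estimate n s u v \<le> gdist G w u v + ereal (2 * (real k - 1) * max_weight w p)"
    if uv: "u < n" "v < n" and p: "shortest_path G w u p v" for u v p
  proof -
    have ap: "awalk u p v" and c: "ereal (awalk_cost w p) = gdist G w u v"
      using p awalkI_apath unfolding shortest_path_def by auto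
    have "\<forall>e\<in>set p. w e \<le> max_weight w p" by (simp add: max_weight_def)
    \<comment> \<open>The shortest path itself is the walk to which \<open>upper\<close> is applied,
      so the bound holds whichever shortest path is chosen.\<close>
    then have "alg.walk (max_weight w p) u v (awalk_cost w p)" using ap by (rule awalk_walk[rotated])
    moreover have "0 \<le> max_weight w p" by (simp add: max_weight_def)
    ultimately have "iarr s ''finite'' (u * n + v) \<noteq> 0 \<and>
        rarr s ''est'' (u * n + v) \<le> awalk_cost w p + 2 * real (k - 1) * max_weight w p"
      using upper uv by blast
    then show ?thesis using k2 by (simp add: estimate_def of_nat_diff flip: c)
  qed
  moreover have "exec (n ^ (8 * (g + 6))) apasp ?s t s"
    using ts by (simp add: power_mult[symmetric] mult.commute)
  ultimately show ?thesis using time by blast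
qed

end

text \<open>Each of \<open>n\<close>, \<open>m\<close> and \<open>r * a ^ 2\<close> is at most a
  constant times \<open>P\<close>. The cube of the logarithm is one factor for \<open>k\<close> and
  two for \<open>L + 1\<close>; the constant is \<open>5000 * 4 ^ 2 * 5\<close>.\<close>

lemma time_bound:
  fixes n m k r a L t :: nat and c :: real
  assumes n: "2 \<le> n" and k: "2 \<le> k" and m: "m \<le> n * n" and a: "a \<le> min n (2 * m)"
    and r: "0 < r" "r = 1 \<or> (r - 1) ^ k * a < m" and c: "real k \<le> c * log 2 (real n)" and L: "real L \<le> 2
        * log 2 (real n) + 1"
    and t: "t \<le> 5000 * k * (L + 1) ^ 2 * (r * a ^ 2 + m + n + 1)"
  shows "real t \<le> 400000 * c * (real n powr (2 - 1 / real k) * real (max 1 m) powr (1 / real k)) * log 2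
      (real n) ^ 3"
proof -
  define P where "P = real n powr (2 - 1 / real k) * real (max 1 m) powr (1 / real k)"
  define l where "l = log 2 (real n)"
  have l: "1 \<le> l" using n by (simp add: l_def le_log_iff)
  have e: "0 \<le> 1 / real k" "1 / real k \<le> 1" using k by (auto simp: field_simps)
  have n1: "real n \<le> real n powr (2 - 1 / real k)"
    using n e powr_mono[of 1 "2 - 1 / real k" "real n"] by simp
  have m1: "1 \<le> real (max 1 m) powr (1 / real k)" using e by (intro ge_one_powr_ge_zero) auto
  have P1: "real n \<le> P" unfolding P_def using mult_mono[OF n1 m1] by simp
  \<comment> \<open>Split off \<open>m powr (1 / k)\<close> and bound the rest by
    \<open>m \<le> n * n\<close>, which gives \<open>n\<close> the exponent
    \<open>2 - 2 / k\<close>.\<close>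
  have P2: "real m \<le> P"
  proof (cases "m = 0")
    case False
    have "real m = real m powr (1 / real k) * real m powr (1 - 1 / real k)"
      using False by (simp flip: powr_add)
    also have "real m powr (1 - 1 / real k) \<le> (real n ^ 2) powr (1 - 1 / real k)"
      using m e False of_nat_mono[OF m, where 'a = real] by (intro powr_mono2) (auto simp: power2_eq_square)
    also have "\<dots> = real n powr (2 * (1 - 1 / real k))"
      using n powr_powr[of "real n" 2 "1 - 1 / real k"] by simp
    also have "\<dots> \<le> real n powr (2 - 1 / real k)"
    proof (rule powr_mono)
      have "2 * (1 - u) \<le> 2 - u" if "0 \<le> u" for u :: real using that by simp
      from this[OF e(1)] show "2 * (1 - 1 / real k) \<le> 2 - 1 / real k" .
    qed (use n in simp)
    finally show ?thesis using False by (simp add: P_def mult.commute mult_left_mono)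
  qed (simp add: P_def)
  have P3: "real r * real a ^ 2 \<le> 2 * P"
  proof (cases "a = 0")
    case False
    then have m0: "1 \<le> m" using a by simp
    \<comment> \<open>Here the choice of \<open>r\<close> and the count of non-isolated vertices pay
      off: for \<open>r = 1\<close> use \<open>a \<le> 2 * m\<close>, otherwise
      \<open>r \<le> 2 * (r - 1)\<close> and the root of order \<open>k\<close> of
      \<open>(r - 1) ^ k * a < m\<close>.\<close>
    have ra: "real r * real a powr (1 / real k) \<le> 2 * real m powr (1 / real k)"
    proof (cases "r = 1")
      case True
      have "real a powr (1 / real k) \<le> (2 * real m) powr (1 / real k)"
        using a e by (intro powr_mono2) auto
      also have "\<dots> = 2 powr (1 / real k) * real m powr (1 / real k)" by (simp add: powr_mult)
      also have "\<dots> \<le> 2 powr 1 * real m powr (1 / real k)"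
        using e by (intro mult_right_mono powr_mono) auto
      finally show ?thesis using True by simp
    next
      case False
      then have r1: "0 < real (r - 1)" "real r \<le> 2 * real (r - 1)" using r(1) by auto
      have "real (r - 1) * real a powr (1 / real k) = (real (r - 1) ^ k * real a) powr (1 / real k)"
        using r1 k by (simp add: powr_mult powr_powr flip: powr_realpow)
      also have "\<dots> \<le> real m powr (1 / real k)"
      proof (intro powr_mono2)
        have "real ((r - 1) ^ k * a) \<le> real m" using r False by (intro of_nat_mono) auto
        then show "real (r - 1) ^ k * real a \<le> real m" by simp
      qed (use e in auto)
      finally have "2 * (real (r - 1) * real a powr (1 / real k)) \<le> 2 * real m powr (1 / real k)" by simp
      moreover have "real r * real a powr (1 / real k) \<le> 2 * real (r - 1) * real a powr (1 / real k)"
        using r1 by (intro mult_right_mono) auto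
      ultimately show ?thesis by simp
    qed
    have "real a ^ 2 = real a powr (1 / real k) * real a powr (2 - 1 / real k)"
      using False by (simp flip: powr_add powr_numeral)
    then have "real r * real a ^ 2 = (real r * real a powr (1 / real k)) * real a powr (2 - 1 / real k)"
        by simp
    also have "\<dots> \<le> (2 * real m powr (1 / real k)) * real n powr (2 - 1 / real k)"
    proof (rule mult_mono[OF ra])
      show "real a powr (2 - 1 / real k) \<le> real n powr (2 - 1 / real k)"
        using a e by (intro powr_mono2) auto
    qed auto
    finally show ?thesis using m0 by (simp add: P_def max_def ac_simps)
  qed (simp add: P_def)
  have P0: "1 \<le> P" using P1 n by linarith
  have "real (r * a ^ 2 + m + n + 1) \<le> 5 * P" using P0 P1 P2 P3 by simp
  moreover have "(real L + 1) ^ 2 \<le> (4 * l) ^ 2" using L l by (intro power_mono) (auto simp: l_def)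
  moreover have "real t \<le> 5000 * real k * (real L + 1) ^ 2 * real (r * a ^ 2 + m + n + 1)"
  proof -
    have "real t \<le> real (5000 * k * (L + 1) ^ 2 * (r * a ^ 2 + m + n + 1))" using t by (rule of_nat_mono)
    then show ?thesis by (simp only: of_nat_mult of_nat_power of_nat_add of_nat_numeral of_nat_1)
  qed
  moreover have "5000 * real k * (real L + 1) ^ 2 * real (r * a ^ 2 + m + n + 1) \<le> 5000 * (c * l) * (4 *
      l) ^ 2 * (5 * P)"
  proof (rule mult_mono[OF _ calculation(1)])
    have kl: "real k \<le> c * l" using c by (simp add: l_def)
    have cl: "real k \<le> c * l" "0 \<le> c * l" by (rule kl, rule order_trans[OF of_nat_0_le_iff kl])
    show "5000 * real k * (real L + 1) ^ 2 \<le> 5000 * (c * l) * (4 * l) ^ 2"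
      using cl calculation(2) by (intro mult_mono) auto
    show "0 \<le> 5000 * (c * l) * (4 * l) ^ 2" by (rule mult_nonneg_nonneg, rule mult_nonneg_nonneg, simp,
        rule cl(2), simp)
  qed simp
  moreover have "5000 * (c * l) * (4 * l) ^ 2 * (5 * P) = 400000 * c * P * l ^ 3"
    by (simp add: power2_eq_square power3_eq_cube)
  ultimately show ?thesis unfolding P_def l_def by linarith
qed

theorem theorem7p2:
  shows "\<exists>P :: com. \<forall>c :: real. \<exists>(C :: real) (e :: nat) (\<gamma> :: nat).
    \<forall>(G :: nat pair_pre_digraph) (w :: nat \<times> nat \<Rightarrow> real) (n :: nat) (m :: nat) (k :: nat)
      (es :: (nat \<times> nat) list).
      weighted_graph G w \<longrightarrow> pverts G = {..<n} \<longrightarrow> m = card (uedges G) \<longrightarrow> edge_list G es \<longrightarrow>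
      2 \<le> k \<longrightarrow> real k \<le> c * log 2 (real n) \<longrightarrow>
      (\<exists>t s. exec (n ^ \<gamma>) P (input_state n es w k) t s \<and>
        real t \<le> C * (real n powr (2 - 1 / real k) * real (max 1 m) powr (1 / real k))
                  * log 2 (real n) ^ e \<and>
        (\<forall>u < n. \<forall>v < n.
          gdist G w u v \<le> estimate n s u v \<and>
          (\<forall>p. shortest_path G w u p v \<longrightarrow>
            estimate n s u v \<le> gdist G w u v + ereal (2 * (real k - 1) * max_weight w p))))"
proof (intro exI[of _ apasp] allI)
  fix c :: real
  let ?g = "nat \<lceil>c\<rceil>"
  show "\<exists>(C :: real) (e :: nat) (\<gamma> :: nat).
    \<forall>(G :: nat pair_pre_digraph) (w :: nat \<times> nat \<Rightarrow> real) (n :: nat) (m :: nat) (k :: nat)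
      (es :: (nat \<times> nat) list).
      weighted_graph G w \<longrightarrow> pverts G = {..<n} \<longrightarrow> m = card (uedges G) \<longrightarrow> edge_list G es \<longrightarrow>
      2 \<le> k \<longrightarrow> real k \<le> c * log 2 (real n) \<longrightarrow>
      (\<exists>t s. exec (n ^ \<gamma>) apasp (input_state n es w k) t s \<and>
        real t \<le> C * (real n powr (2 - 1 / real k) * real (max 1 m) powr (1 / real k))
                  * log 2 (real n) ^ e \<and>
        (\<forall>u < n. \<forall>v < n.
          gdist G w u v \<le> estimate n s u v \<and>
          (\<forall>p. shortest_path G w u p v \<longrightarrow>
            estimate n s u v \<le> gdist G w u v + ereal (2 * (real k - 1) * max_weight w p))))"
  \<comment> \<open>The word bound is \<open>M ^ 8\<close> for \<open>M = n ^ (?g + 6)\<close>: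
    cells stay below \<open>M\<close>, and intermediate values of expressions below
    \<open>M ^ 8\<close>.\<close>
  proof (rule exI[of _ "400000 * c"], rule exI[of _ 3], rule exI[of _ "8 * (?g + 6)"], intro allI impI)
    fix G :: "nat pair_pre_digraph" and w :: "nat \<times> nat \<Rightarrow> real" and n m k :: nat and es :: "(nat \<times> nat) list"
    assume G: "weighted_graph G w" "pverts G = {..<n}" and m: "m = card (uedges G)" and es: "edge_list G es"
      and k: "2 \<le> k" and kc: "real k \<le> c * log 2 (real n)"
    \<comment> \<open>In HOL the logarithm vanishes at 0 as well as at 1, so either value would
      contradict \<open>2 \<le> k\<close>.\<close>
    have n: "2 \<le> n"
    proof (rule ccontr)
      assume "\<not> 2 \<le> n"
      then have "n = 0 \<or> n = 1" by auto
      then have "log 2 (real n) = 0" by (auto simp: log_def)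
      then show False using kc k by simp
    qed
    \<comment> \<open>The base-2 logarithm of \<open>n * n\<close>, rounded up: the lower bound
      gives \<open>n * n \<le> 2 ^ L\<close>, and the upper one enters the running time.\<close>
    define L where "L = nat \<lceil>2 * log 2 (real n)\<rceil>"
    have log: "1 \<le> log 2 (real n)" using n by (simp add: le_log_iff)
    have Llog: "2 * log 2 (real n) \<le> real L" "real L \<le> 2 * log 2 (real n) + 1" using log unfolding L_def by linarith+
    have "2 powr log 2 (real n) = real n" using n by simp
    then have "real (n * n) = 2 powr log 2 (real n) * 2 powr log 2 (real n)" by simp
    also have "\<dots> = 2 powr (log 2 (real n) + log 2 (real n))" by (rule powr_add[symmetric])
    also have "\<dots> \<le> 2 powr real L" using Llog by (intro powr_mono) auto
    finally have nL: "n * n \<le> 2 ^ L" by (simp add: powr_realpow flip: of_nat_mult)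
    have "c \<le> real ?g" by linarith
    then have "real k \<le> real ?g * log 2 (real n)" using kc log mult_right_mono[of c "real ?g" "log 2 (real n)"] by linarith
    then have "2 powr real k \<le> 2 powr (log 2 (real n) * real ?g)" by (simp add: mult.commute)
    also have "\<dots> = real n ^ ?g" using n by (simp add: powr_realpow flip: powr_powr)
    finally have "real (2 ^ k) \<le> real (n ^ ?g)" by (simp add: powr_realpow)
    then have kg: "2 ^ k \<le> n ^ ?g" by (simp only: of_nat_le_iff)
    interpret graph_input G w n k ?g L es
      using G es n k kg nL by unfold_locales
    from run_spec obtain t s r a where run: "exec (n ^ (8 * (?g + 6))) apasp (input_state n es w k) t s"
      "0 < r" "a \<le> min n (2 * length es)" "r = 1 \<or> (r - 1) ^ k * a < length es"
      "t \<le> 5000 * k * (L + 1) ^ 2 * (r * a ^ 2 + length es + n + 1)"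
      "\<forall>u < n. \<forall>v < n. gdist G w u v \<le> estimate n s u v \<and>
       (\<forall>p. shortest_path G w u p v \<longrightarrow>
         estimate n s u v \<le> gdist G w u v + ereal (2 * (real k - 1) * max_weight w p))"
      by (elim exE conjE) (rule that)
    have "real t \<le> 400000 * c * (real n powr (2 - 1 / real k) * real (max 1 m) powr (1 / real k)) * log 2 (real n) ^ 3"
      unfolding m edge_list_length[OF es]
      by (rule time_bound[OF n k m_le run(3,2,4) kc Llog(2) run(5)])
    then show "\<exists>t s. exec (n ^ (8 * (?g + 6))) apasp (input_state n es w k) t s \<and>
        real t \<le> 400000 * c * (real n powr (2 - 1 / real k) * real (max 1 m) powr (1 / real k)) * log 2 (real n) ^ 3 \<and>
        (\<forall>u < n. \<forall>v < n.
          gdist G w u v \<le> estimate n s u v \<and>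
          (\<forall>p. shortest_path G w u p v \<longrightarrow>
            estimate n s u v \<le> gdist G w u v + ereal (2 * (real k - 1) * max_weight w p)))"
      using run(1,6) by blast
  qed
qed

end
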